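(* Let $\sigma_m$ be an $m$-variable geodesic mean and let $A_1,\dots,A_m\in\mathbb{M}_n\{\Omega\}$ for an interval $\Omega\subset(0,\infty)$. 1. If $f$ is a doubly concave function on $\Omega$, then $$\|f(\sigma_m(A_1,\dots,A_m))\|_!\ge\sigma_m(\|f(A_1)\|_!,\dots,\|f(A_m)\|_!)$$ for all derived anti-norms $\|\cdot\|_!$ on $\mathbb{M}_n^+$. 2. If $g$ is a doubly convex function on $\Omega$, then $$\|g(\sigma_m(A_1,\dots,A_m))\|\le\sigma_m(\|g(A_1)\|,\dots,\|g(A_m)\|)$$ for all symmetric norms $\|\cdot\|$ on $\mathbb{M}_n$.
   Context: $\mathbb{M}_n$ is the algebra of $n\times n$ complex matrices, $\mathbb{M}_n\{\Omega\}$ the set of Hermitian matrices with spectrum in $\Omega$, $\mathbb{M}_n^+$ the positive semidefinite matrices, $\mathbb{P}_n$ the positive definite ones. A function $f$ on $\Omega$ is doubly concave if it is non-negative, continuous, concave and satisfies $f(\sqrt{xy})\ge\sqrt{f(x)f(y)}$ for all $x,y\in\Omega$; $g$ is doubly convex if it is non-negative, continuous, convex and satisfies $g(\sqrt{xy})\le\sqrt{g(x)g(y)}$ for all $x,y\in\Omega$. A symmetric norm on $\mathbb{M}_n$ is a unitarily invariant norm. A derived anti-norm is a functional on $\mathbb{M}_n^+$ of the form $\|A\|_!=\|A^{-p}\|^{-1/p}$ if $A$ is invertible and $\|A\|_!=0$ otherwise, for some symmetric norm $\|\cdot\|$ on $\mathbb{M}_n$ and some $p>0$. On $\mathbb{P}_n$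 let $\delta(A,B)=\|\log A^{-1/2}BA^{-1/2}\|_2$, with $\|\cdot\|_2$ the Hilbert–Schmidt norm. Let $\Sigma_m=\{\mathbf{w}=(w_1,\dots,w_m):w_i\ge0,\ \sum_iw_i=1\}$. For $\mathbf{w}\in\Sigma_m$ and $A_1,\dots,A_m\in\mathbb{P}_n$, the weighted geometric mean $G_m(\mathbf{w};A_1,\dots,A_m)$ is the unique minimizer over $X\in\mathbb{P}_n$ of $\sum_{i=1}^mw_i\delta^2(X,A_i)$. An $m$-variable geodesic mean is $\sigma_m(A_1,\dots,A_m)=\int_{\Sigma_m}G_m(\mathbf{w};A_1,\dots,A_m)\,d\nu(\mathbf{w})$ for a probability measure $\nu$ on $\Sigma_m$ (the same $\nu$ for all $n$). For scalars $a_1,\dots,a_m\ge0$ this is read as $\sigma_m(a_1,\dots,a_m)=\int_{\Sigma_m}\prod_{i=1}^ma_i^{w_i}\,d\nu(\mathbf{w})$ (with $0^0=1$), which agrees with the case $n=1$ when all $a_i>0$. *)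

theory Defs
  imports "HOL-Analysis.Analysis" "HOL-Probability.Probability"
begin

section \<open>Complex matrices\<close>

text \<open>The algebra of \<open>n \<times> n\<close> complex matrices is the type
  \<open>complex^'n^'n\<close>, with \<open>n = CARD('n)\<close>.\<close>

definition adjoint_mat :: "complex^'n^'n \<Rightarrow> complex^'n^'n" where
  "adjoint_mat A = (\<chi> i j. cnj (A $ j $ i))"

definition hermitian :: "complex^'n^'n \<Rightarrow> bool" where
  "hermitian A \<longleftrightarrow> adjoint_mat A = A"

definition unitary :: "complex^'n^'n \<Rightarrow> bool" where
  "unitary U \<longleftrightarrow> adjoint_mat U ** U = mat 1 \<and> U ** adjoint_mat U = mat 1"

definition spectrum :: "complex^'n^'n \<Rightarrow> complex set" where
  "spectrum A = {c. \<exists>v. v \<noteq> 0 \<and> A *v v = c *s v}"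

definition hermitian_on :: "real set \<Rightarrow> (complex^'n^'n) set" where
  "hermitian_on \<Omega> = {A. hermitian A \<and> spectrum A \<subseteq> complex_of_real ` \<Omega>}"

text \<open>On \<open>complex^'n\<close>, the library's \<open>x \<bullet> y\<close> is the real part of the Hermitian
  inner product; the quadratic form of a Hermitian matrix is real, so nothing is lost below.\<close>

definition psd_matrices :: "(complex^'n^'n) set" where
  "psd_matrices = {A. hermitian A \<and> (\<forall>x. 0 \<le> x \<bullet> (A *v x))}"

definition pd_matrices :: "(complex^'n^'n) set" where
  "pd_matrices = {A. hermitian A \<and> (\<forall>x. x \<noteq> 0 \<longrightarrow> 0 < x \<bullet> (A *v x))}"

definition diag_mat :: "real^'n \<Rightarrow> complex^'n^'n" where
  "diag_mat d = (\<chi> i j. if i = j then complex_of_real (d $ i) else 0)"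

text \<open>Functional calculus of a Hermitian matrix. The spectral theorem gives a decomposition
  \<open>A = U diag(d) U\<^sup>*\<close>, and \<open>U diag(f(d)) U\<^sup>*\<close> does not depend on which
  decomposition is used. Only the values of \<open>f\<close> on the spectrum matter.\<close>

definition mat_fun :: "(real \<Rightarrow> real) \<Rightarrow> complex^'n^'n \<Rightarrow> complex^'n^'n" where
  "mat_fun f A = (THE B. \<exists>U d. unitary U \<and> A = U ** diag_mat d ** adjoint_mat U
      \<and> B = U ** diag_mat (\<chi> i. f (d $ i)) ** adjoint_mat U)"

section \<open>Doubly concave and doubly convex functions\<close>

definition doubly_concave_on :: "real set \<Rightarrow> (real \<Rightarrow> real) \<Rightarrow> bool" where
  "doubly_concave_on \<Omega> f \<longleftrightarrow>
     (\<forall>x\<in>\<Omega>. 0 \<le> f x) \<and> continuous_on \<Omega> f \<and> concave_on \<Omega> f \<and>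
     (\<forall>x\<in>\<Omega>. \<forall>y\<in>\<Omega>. sqrt (f x * f y) \<le> f (sqrt (x * y)))"

definition doubly_convex_on :: "real set \<Rightarrow> (real \<Rightarrow> real) \<Rightarrow> bool" where
  "doubly_convex_on \<Omega> g \<longleftrightarrow>
     (\<forall>x\<in>\<Omega>. 0 \<le> g x) \<and> continuous_on \<Omega> g \<and> convex_on \<Omega> g \<and>
     (\<forall>x\<in>\<Omega>. \<forall>y\<in>\<Omega>. g (sqrt (x * y)) \<le> sqrt (g x * g y))"

section \<open>Symmetric norms and derived anti-norms\<close>

definition symmetric_norm :: "(complex^'n^'n \<Rightarrow> real) \<Rightarrow> bool" where
  "symmetric_norm N \<longleftrightarrow>
     (\<forall>A. 0 \<le> N A) \<and>
     (\<forall>A. N A = 0 \<longleftrightarrow> A = 0) \<and>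
     (\<forall>c A. N (\<chi> i j. c * A $ i $ j) = cmod c * N A) \<and>
     (\<forall>A B. N (A + B) \<le> N A + N B) \<and>
     (\<forall>U V A. unitary U \<and> unitary V \<longrightarrow> N (U ** A ** V) = N A)"

text \<open>A derived anti-norm is a functional on the positive semidefinite matrices; its values
  elsewhere are unconstrained.\<close>

definition derived_anti_norm :: "(complex^'n^'n \<Rightarrow> real) \<Rightarrow> bool" where
  "derived_anti_norm M \<longleftrightarrow> (\<exists>N p. symmetric_norm N \<and> 0 < p \<and>
     (\<forall>A\<in>psd_matrices. M A =
        (if invertible A then N (mat_fun (\<lambda>x. x powr (- p)) A) powr (- 1 / p) else 0)))"

section \<open>Geodesic means\<close>

text \<open>The library norm on \<open>complex^'n^'n\<close> is the square root of the sum of the squared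
  moduli of the entries, that is, the Hilbert--Schmidt norm.\<close>

definition riem_dist :: "complex^'n^'n \<Rightarrow> complex^'n^'n \<Rightarrow> real" where
  "riem_dist A B = norm (mat_fun ln
     (mat_fun (\<lambda>x. x powr (- 1 / 2)) A ** B ** mat_fun (\<lambda>x. x powr (- 1 / 2)) A))"

definition weight_simplex :: "(real^'m) set" where
  "weight_simplex = {w. (\<forall>i. 0 \<le> w $ i) \<and> (\<Sum>i\<in>UNIV. w $ i) = 1}"

definition geometric_mean :: "real^'m \<Rightarrow> ('m \<Rightarrow> complex^'n^'n) \<Rightarrow> complex^'n^'n" where
  "geometric_mean w A = (THE X. is_arg_min
     (\<lambda>X. \<Sum>i\<in>UNIV. w $ i * (riem_dist X (A i))\<^sup>2) (\<lambda>X. X \<in> pd_matrices) X)"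

definition simplex_probability :: "(real^'m) measure \<Rightarrow> bool" where
  "simplex_probability \<nu> \<longleftrightarrow>
     prob_space \<nu> \<and> sets \<nu> = sets (restrict_space borel weight_simplex)"

definition geodesic_mean :: "(real^'m) measure \<Rightarrow> ('m \<Rightarrow> complex^'n^'n) \<Rightarrow> complex^'n^'n" where
  "geodesic_mean \<nu> A = (LINT w|\<nu>. geometric_mean w A)"

text \<open>The case distinction implements \<open>0\<^sup>0 = 1\<close>, whereas \<open>0 powr 0 = 0\<close> in the library.\<close>

definition scalar_geodesic_mean :: "(real^'m) measure \<Rightarrow> ('m \<Rightarrow> real) \<Rightarrow> real" where
  "scalar_geodesic_mean \<nu> a =
     (LINT w|\<nu>. (\<Prod>i\<in>UNIV. if w $ i = 0 then 1 else a i powr (w $ i)))"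

end

theory Submission
  imports Defs
begin

text \<open>
  Everything is read off from diagonals in the eigenbasis of the mean. Write \<open>G\<^sub>w\<close> for the weighted geometric mean of the
  \<open>A\<^sub>i\<close> and \<open>X = \<integral> G\<^sub>w d\<nu>(w)\<close>, with eigenvalues \<open>x\<^sub>j\<close>. In the eigenbasis of \<open>X\<close> the diagonal entries \<open>\<xi>\<^sub>j(w)\<close> of
  \<open>G\<^sub>w\<close> have mean \<open>x\<^sub>j\<close>, so a convex \<open>g\<close> satisfies \<open>g(x\<^sub>j) \<le> \<integral> g(\<xi>\<^sub>j)\<close>. A functional that attains the norm of the
  diagonal matrix with entries \<open>g(x\<^sub>j)\<close> makes the norm linear, and pinching bounds the norm of the diagonal
  matrix with entries \<open>g(\<xi>\<^sub>j(w))\<close> by that of \<open>g(G\<^sub>w)\<close>. It remains to prove \<open>\<parallel>g(G\<^sub>w)\<parallel> \<le> \<Prod>\<^sub>i \<parallel>g(A\<^sub>i)\<parallel>\<^sup>w\<^sup>i\<close> for fixed weights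
  (\<open>norm_fun_geometric_mean_le\<close>); integrating it gives \<open>norm_fun_geodesic_mean_le\<close>.

  For this let \<open>K = log G\<^sub>w\<close>. The mean is the critical point of the cost, which means that the logarithms
  \<open>H\<^sub>i = log (G\<^sub>w\<^sup>-\<^sup>1\<^sup>/\<^sup>2 A\<^sub>i G\<^sub>w\<^sup>-\<^sup>1\<^sup>/\<^sup>2)\<close> average to \<open>0\<close>. Hence \<open>K = \<Sum>\<^sub>i w\<^sub>i (K + H\<^sub>i)\<close>, and each \<open>K + H\<^sub>i\<close> is majorized by
  \<open>log (e\<^sup>K\<^sup>/\<^sup>2 e\<^sup>H\<^sup>i e\<^sup>K\<^sup>/\<^sup>2) = log A\<^sub>i\<close>. In the eigenbasis of \<open>G\<^sub>w\<close> the logarithms of its eigenvalues are therefore averages of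
  diagonals that are majorized by the spectra of the \<open>log A\<^sub>i\<close>. Since \<open>log g(e\<^sup>t)\<close> is convex for a doubly convex \<open>g > 0\<close>,
  Hoelder's inequality for symmetric norms finishes the argument.

  The existence and uniqueness of \<open>G\<^sub>w\<close>, its continuity in \<open>w\<close> and the majorization just used rest on one inequality,
  \<open>\<parallel>log A - log B\<parallel> \<le> \<parallel>log (B\<^sup>-\<^sup>1\<^sup>/\<^sup>2 A B\<^sup>-\<^sup>1\<^sup>/\<^sup>2)\<parallel>\<close> for all unitarily invariant seminorms (\<open>log_diff_le\<close>). In the pair of eigenbases of
  \<open>A\<close> and \<open>B\<close>, with logarithms \<open>a\<^sub>i\<close> and \<open>b\<^sub>j\<close> of the eigenvalues, the left-hand matrix arises from
  \<open>A\<^sup>1\<^sup>/\<^sup>2 B\<^sup>-\<^sup>1\<^sup>/\<^sup>2 - A\<^sup>-\<^sup>1\<^sup>/\<^sup>2 B\<^sup>1\<^sup>/\<^sup>2\<close> by the Schur multiplier \<open>(a\<^sub>i - b\<^sub>j) / (2 sinh ((a\<^sub>i - b\<^sub>j)/2))\<close>. Euler's product for the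
  hyperbolic sine shows that it is contractive, and cutting the geodesic from \<open>B\<close> to \<open>A\<close> into small pieces
  removes the difference between \<open>2 sinh (t/2)\<close> and \<open>t\<close>. Taking seminorms that are support functionals of unitary orbits turns the
  inequality into majorization (\<open>log_diff_majorized\<close>); taking the Hilbert--Schmidt norm gives the comparison
  with the Euclidean distance of the logarithms that makes the cost coercive and its critical points unique.

  For a doubly concave \<open>f\<close> the function \<open>f\<^sup>-\<^sup>p\<close> is convex and geometrically convex where \<open>f > 0\<close>, so the inequality for
  fixed weights applies to it. The integration step then uses the tangent of the concave function
  \<open>r \<mapsto> (\<Sum>\<^sub>j \<pi>\<^sub>j r\<^sub>j\<^sup>-\<^sup>p)\<^sup>-\<^sup>1\<^sup>/\<^sup>p\<close> in place of the norming functional alone (\<open>anti_norm_fun_geodesic_mean_ge\<close>).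
\<close>

section \<open>Matrix algebra\<close>

lemma bounded_bilinear_matrix_mul:
  "bounded_bilinear ((**) :: complex^'n^'n \<Rightarrow> complex^'n^'n \<Rightarrow> complex^'n^'n)"
  unfolding bilinear_conv_bounded_bilinear [symmetric] bilinear_def
  by (auto intro!: linearI simp: matrix_matrix_mult_def vec_eq_iff sum.distrib algebra_simps scaleR_sum_right)

interpretation matmul: bounded_bilinear "(**) :: complex^'n^'n \<Rightarrow> complex^'n^'n \<Rightarrow> complex^'n^'n"
  by (rule bounded_bilinear_matrix_mul)

lemma bounded_linear_adjoint: "bounded_linear (adjoint_mat :: complex^'n^'n \<Rightarrow> complex^'n^'n)"
  unfolding linear_conv_bounded_linear [symmetric]
  by (auto intro!: linearI simp: adjoint_mat_def vec_eq_iff)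

lemmas adjoint_add = linear_add [OF bounded_linear.linear [OF bounded_linear_adjoint]]
lemmas adjoint_scaleR = linear_scale [OF bounded_linear.linear [OF bounded_linear_adjoint]]
lemmas continuous_on_adjoint = bounded_linear.continuous_on [OF bounded_linear_adjoint]

lemma adjoint_mul [simp]: "adjoint_mat (A ** B) = adjoint_mat B ** adjoint_mat A"
  by (simp add: adjoint_mat_def matrix_matrix_mult_def vec_eq_iff mult.commute)

lemma adjoint_adjoint [simp]: "adjoint_mat (adjoint_mat A) = A"
  by (simp add: adjoint_mat_def vec_eq_iff)

lemma adjoint_one [simp]: "adjoint_mat (mat 1) = mat 1"
  by (auto simp: adjoint_mat_def mat_def vec_eq_iff)

lemma adjoint_diag [simp]: "adjoint_mat (diag_mat d) = diag_mat d"
  by (auto simp: adjoint_mat_def diag_mat_def vec_eq_iff)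

lemma diag_mat_nth: "diag_mat d $ i $ j = (if i = j then complex_of_real (d $ i) else 0)"
  by (simp add: diag_mat_def)

lemma diag_mul_nth: "(diag_mat d ** A) $ i $ j = complex_of_real (d $ i) * A $ i $ j"
  by (simp add: matrix_matrix_mult_def diag_mat_def if_distrib [of "\<lambda>x. x * _"] cong: if_cong)

lemma mul_diag_nth: "(A ** diag_mat d) $ i $ j = A $ i $ j * complex_of_real (d $ j)"
  by (simp add: matrix_matrix_mult_def diag_mat_def if_distrib [of "\<lambda>x. _ * x"] cong: if_cong)

lemma diag_mul_diag: "diag_mat d ** diag_mat e = diag_mat (\<chi> i. d $ i * e $ i)"
  by (simp add: vec_eq_iff diag_mul_nth diag_mat_nth)

lemma bounded_linear_diag: "bounded_linear (diag_mat :: real^'n \<Rightarrow> complex^'n^'n)"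
  unfolding linear_conv_bounded_linear [symmetric]
  by (rule linearI; simp add: diag_mat_def vec_eq_iff; simp add: scaleR_conv_of_real)

lemmas diag_add = linear_add [OF bounded_linear.linear [OF bounded_linear_diag]]
lemmas diag_scaleR = linear_scale [OF bounded_linear.linear [OF bounded_linear_diag]]
lemmas diag_sum = linear_sum [OF bounded_linear.linear [OF bounded_linear_diag]]

lemma diag_one: "diag_mat (\<chi> i. c) = c *\<^sub>R mat 1"
  by (simp add: diag_mat_def mat_def vec_eq_iff; simp add: scaleR_conv_of_real)

lemma inner_mat_def: "A \<bullet> B = Re (\<Sum>i\<in>UNIV. \<Sum>j\<in>UNIV. cnj (A $ i $ j) * B $ i $ j)"
  for A B :: "complex^'n^'n"
  by (simp add: inner_vec_def inner_complex_def)

lemma inner_mul_left: "(M ** A) \<bullet> B = A \<bullet> (adjoint_mat M ** B)" for A B M :: "complex^'n^'n"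
proof -
  have "(\<Sum>i\<in>UNIV. \<Sum>j\<in>UNIV. cnj ((M ** A) $ i $ j) * B $ i $ j)
      = (\<Sum>i\<in>UNIV. \<Sum>j\<in>UNIV. \<Sum>k\<in>UNIV. cnj (M $ i $ k) * cnj (A $ k $ j) * B $ i $ j)"
    by (simp add: matrix_matrix_mult_def sum_distrib_right)
  also have "\<dots> = (\<Sum>k\<in>UNIV. \<Sum>j\<in>UNIV. \<Sum>i\<in>UNIV. cnj (M $ i $ k) * cnj (A $ k $ j) * B $ i $ j)"
    by (subst sum.swap, subst (2) sum.swap, subst sum.swap, rule refl)
  also have "\<dots> = (\<Sum>k\<in>UNIV. \<Sum>j\<in>UNIV. cnj (A $ k $ j) * (adjoint_mat M ** B) $ k $ j)"
    by (simp add: matrix_matrix_mult_def adjoint_mat_def sum_distrib_left mult_ac)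
  finally show ?thesis by (simp add: inner_mat_def)
qed

lemma inner_adjoint: "adjoint_mat A \<bullet> adjoint_mat B = A \<bullet> B" for A B :: "complex^'n^'n"
  unfolding inner_vec_def inner_complex_def adjoint_mat_def by (simp, rule sum.swap)

lemma inner_mul_right: "(A ** M) \<bullet> B = A \<bullet> (B ** adjoint_mat M)" for A B M :: "complex^'n^'n"
  using inner_mul_left [of "adjoint_mat M" "adjoint_mat A" "adjoint_mat B"]
    inner_adjoint [of "A ** M" B] inner_adjoint [of A "B ** adjoint_mat M"] by simp

lemma unitaryD: "unitary U \<Longrightarrow> adjoint_mat U ** U = mat 1" "unitary U \<Longrightarrow> U ** adjoint_mat U = mat 1"
  by (simp_all add: unitary_def)

lemma unitary_if_isometry: "adjoint_mat U ** U = mat 1 \<Longrightarrow> unitary U"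
  by (simp add: unitary_def matrix_left_right_inverse)

lemma unitary_if_coisometry: "U ** adjoint_mat U = mat 1 \<Longrightarrow> unitary U"
  by (simp add: unitary_def matrix_left_right_inverse)

lemma unitary_one [simp]: "unitary (mat 1)"
  by (simp add: unitary_def)

lemma unitary_adjoint [simp]: "unitary (adjoint_mat U) \<longleftrightarrow> unitary U"
  by (auto simp: unitary_def)

lemma unitary_cancel:
  assumes "unitary U"
  shows "adjoint_mat U ** (U ** A) = A" "U ** (adjoint_mat U ** A) = A"
    "A ** U ** adjoint_mat U = A" "A ** adjoint_mat U ** U = A"
  using unitaryD [OF assms] by (simp_all add: matrix_mul_assoc, simp_all add: matrix_mul_assoc [symmetric])

lemma unitary_mul: "unitary U \<Longrightarrow> unitary V \<Longrightarrow> unitary (U ** V)"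
  by (rule unitary_if_isometry)
    (simp add: matrix_mul_assoc [symmetric] unitary_cancel unitaryD)

lemma inner_unitary: "unitary U \<Longrightarrow> unitary V \<Longrightarrow> (U ** A ** V) \<bullet> (U ** B ** V) = A \<bullet> B"
  for A B :: "complex^'n^'n"
  by (simp only: inner_mul_right [of "U ** A" V] unitary_cancel inner_mul_left [of U])

lemma norm_unitary: "unitary U \<Longrightarrow> unitary V \<Longrightarrow> norm (U ** A ** V) = norm A"
  for A :: "complex^'n^'n"
  by (simp add: norm_eq_sqrt_inner inner_unitary)

lemma compact_unitary: "compact {U :: complex^'n^'n. unitary U}"
  unfolding compact_eq_bounded_closed
proof
  have "norm U \<le> norm (mat 1 :: complex^'n^'n)" if "unitary U" for U :: "complex^'n^'n"
    using norm_unitary [of U "mat 1" "mat 1"] that by simp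
  then show "bounded {U :: complex^'n^'n. unitary U}" unfolding bounded_iff by blast
  have "continuous_on UNIV (\<lambda>U :: complex^'n^'n. adjoint_mat U ** U)"
    by (rule matmul.continuous_on [OF continuous_on_adjoint [OF continuous_on_id] continuous_on_id])
  then have "closed ((\<lambda>U :: complex^'n^'n. adjoint_mat U ** U) -` {mat 1})"
    by (rule closed_vimage [OF closed_singleton])
  moreover have "{U :: complex^'n^'n. unitary U} = (\<lambda>U. adjoint_mat U ** U) -` {mat 1}"
    by (auto simp: unitaryD intro: unitary_if_isometry)
  ultimately show "closed {U :: complex^'n^'n. unitary U}" by simp
qed

lemma hermitian_conj: "hermitian A \<Longrightarrow> hermitian (S ** A ** adjoint_mat S)"
  by (simp add: hermitian_def matrix_mul_assoc)

lemma hermitian_nth: "hermitian A \<Longrightarrow> A $ i $ j = cnj (A $ j $ i)"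
  by (metis (no_types, lifting) adjoint_mat_def hermitian_def vec_lambda_beta)

section \<open>The spectral theorem\<close>

definition spectral_mat :: "complex^'n^'n \<Rightarrow> real^'n \<Rightarrow> complex^'n^'n" where
  "spectral_mat U d = U ** diag_mat d ** adjoint_mat U"

definition plane_rotation :: "'n \<Rightarrow> 'n \<Rightarrow> real \<Rightarrow> real \<Rightarrow> complex \<Rightarrow> complex^'n^'n" where
  "plane_rotation i j c s p = (\<chi> k l.
     if l = i then (if k = i then of_real c else if k = j then of_real s * p else 0)
     else if l = j then (if k = i then - of_real s * cnj p else if k = j then of_real c else 0)
     else if k = l then 1 else 0)"

lemma sum_supported_pair:
  fixes i j :: "'n::finite"
  assumes "i \<noteq> j" "\<And>k. k \<noteq> i \<Longrightarrow> k \<noteq> j \<Longrightarrow> f k = 0"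
  shows "(\<Sum>k\<in>UNIV. f k) = f i + (f j :: 'a::comm_monoid_add)"
proof -
  have "(\<Sum>k\<in>UNIV. f k) = (\<Sum>k\<in>{i, j}. f k)"
    by (rule sum.mono_neutral_right) (use assms in auto)
  then show ?thesis using assms(1) by simp
qed

lemma unitary_plane_rotation:
  fixes i j :: "'n::finite"
  assumes "i \<noteq> j" "c\<^sup>2 + s\<^sup>2 = 1" "cmod p = 1"
  shows "unitary (plane_rotation i j c s p :: complex^'n^'n)"
proof (rule unitary_if_isometry, simp only: vec_eq_iff, intro allI)
  fix k l
  let ?R = "plane_rotation i j c s p :: complex^'n^'n"
  have pp: "cnj p * p = 1" "p * cnj p = 1"
    using assms(3) by (simp_all add: complex_norm_square [symmetric] mult.commute)
  have cs: "complex_of_real c * of_real c + of_real s * of_real s = 1"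
    using assms(2) by (metis of_real_1 of_real_add of_real_mult power2_eq_square)
  have sum: "(adjoint_mat ?R ** ?R) $ k $ l = (\<Sum>a\<in>UNIV. cnj (?R $ a $ k) * ?R $ a $ l)"
    by (simp add: matrix_matrix_mult_def adjoint_mat_def)
  show "(adjoint_mat ?R ** ?R) $ k $ l = (mat 1 :: complex^'n^'n) $ k $ l"
  proof (cases "k = i \<or> k = j")
    case True
    then have "(\<Sum>a\<in>UNIV. cnj (?R $ a $ k) * ?R $ a $ l)
        = cnj (?R $ i $ k) * ?R $ i $ l + cnj (?R $ j $ k) * ?R $ j $ l"
      by (intro sum_supported_pair assms(1)) (auto simp: plane_rotation_def)
    then have eq: "(adjoint_mat ?R ** ?R) $ k $ l = cnj (?R $ i $ k) * ?R $ i $ l + cnj (?R $ j $ k) * ?R $ j $ l"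
      by (simp only: sum)
    have ppx: "p * (cnj p * x) = x" for x
      by (metis mult.assoc mult_1 pp(2))
    show ?thesis
      unfolding eq using True assms(1) cs
      by (auto simp: plane_rotation_def mat_def algebra_simps ppx)
  next
    case False
    have "(\<Sum>a\<in>UNIV. cnj (?R $ a $ k) * ?R $ a $ l) = (\<Sum>a\<in>UNIV. if a = k then ?R $ k $ l else 0)"
      by (rule sum.cong) (use False in \<open>auto simp: plane_rotation_def\<close>)
    then show ?thesis using False unfolding sum by (auto simp: plane_rotation_def mat_def)
  qed
qed

lemma quadratic_sum_nth: "(adjoint_mat R ** B ** R) $ k $ l
   = (\<Sum>b\<in>UNIV. (\<Sum>a\<in>UNIV. cnj (R $ a $ k) * B $ a $ b) * R $ b $ l)"
  by (simp add: matrix_matrix_mult_def adjoint_mat_def)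

text \<open>A maximiser \<open>U\<close> of \<open>\<Sum>\<^sub>k z\<^sub>k Re (U\<^sup>* A U)\<^sub>k\<^sub>k\<close> over the compact unitary group, for pairwise
  different weights \<open>z\<^sub>k\<close>, diagonalises \<open>A\<close>: if the entry \<open>(i,j)\<close> of \<open>U\<^sup>* A U\<close> were not \<open>0\<close>, a small
  rotation in the plane of \<open>i\<close> and \<open>j\<close> would move weight between these two diagonal entries at first
  order in the angle and so increase the sum.\<close>

theorem hermitian_diagonalizable:
  fixes A :: "complex^'n^'n"
  assumes "hermitian A"
  obtains U d where "unitary U" "A = spectral_mat U d"
proof -
  obtain z0 :: "'n \<Rightarrow> nat" where z0: "inj z0"
    using finite_imp_inj_to_nat_seg [of "UNIV :: 'n set"] by auto
  define z where "z k = real (z0 k)" for k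
  have z: "z i \<noteq> z j" if "i \<noteq> j" for i j using z0 that by (auto simp: z_def inj_eq)
  define f where "f U = (\<Sum>k\<in>UNIV. z k * Re ((adjoint_mat U ** A ** U) $ k $ k))" for U
  have "continuous_on {U. unitary U} f"
    unfolding f_def by (intro continuous_intros matmul.continuous_on continuous_on_adjoint)
  moreover have "{U :: complex^'n^'n. unitary U} \<noteq> {}" using unitary_one by blast
  ultimately obtain U where U: "unitary U" and max: "\<And>V. unitary V \<Longrightarrow> f V \<le> f U"
    using continuous_attains_sup [OF compact_unitary, of f] by auto
  define B where "B = adjoint_mat U ** A ** U"
  have B: "hermitian B" using hermitian_conj [OF assms, of "adjoint_mat U"] by (simp add: B_def)
  have off: "B $ i $ j = 0" if lt: "z j < z i" for i j
  proof (rule ccontr)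
    assume nz: "B $ i $ j \<noteq> 0"
    have ij: "i \<noteq> j" using lt by auto
    define r where "r = cmod (B $ i $ j)"
    define p where "p = cnj (B $ i $ j) / of_real r"
    have r: "r > 0" using nz by (simp add: r_def)
    have p: "cmod p = 1" using r by (simp add: p_def norm_divide r_def)
    have Bp: "B $ i $ j * p = of_real r"
      using r by (simp add: p_def complex_norm_square [symmetric] r_def power2_eq_square)
    have Bp': "B $ j $ i * cnj p = of_real r"
      using arg_cong [OF Bp, of cnj] hermitian_nth [OF B, of j i] by simp
    have pp: "cnj p * p = 1" "p * cnj p = 1"
      using p by (simp_all add: complex_norm_square [symmetric] mult.commute)
    define D where "D = Re (B $ j $ j) - Re (B $ i $ i)"
    \<comment> \<open>\<open>t\<close> is the tangent of the rotation angle, small enough for the first-order gain \<open>2 t r\<close> to beat \<open>t\<^sup>2 |D|\<close>.\<close>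
    define t where "t = min 1 (r / (\<bar>D\<bar> + 1))"
    have t: "0 < t" "t \<le> 1" "t * \<bar>D\<bar> < 2 * r"
    proof -
      show "0 < t" "t \<le> 1" using r by (auto simp: t_def)
      have "t * \<bar>D\<bar> \<le> r / (\<bar>D\<bar> + 1) * \<bar>D\<bar>" by (intro mult_right_mono) (auto simp: t_def)
      also have "\<dots> \<le> r" using r by (simp add: field_simps)
      finally show "t * \<bar>D\<bar> < 2 * r" using r by simp
    qed
    define c where "c = 1 / sqrt (1 + t\<^sup>2)"
    define s where "s = t * c"
    have pos: "1 + t\<^sup>2 > 0" by (simp add: add_pos_nonneg)
    have c: "c > 0" using pos by (simp add: c_def)
    have cs: "c\<^sup>2 + s\<^sup>2 = 1"
    proof -
      have "c\<^sup>2 + s\<^sup>2 = (1 + t\<^sup>2) * c\<^sup>2" by (simp add: s_def power_mult_distrib algebra_simps)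
      also have "\<dots> = 1" using pos by (simp add: c_def power_divide)
      finally show ?thesis .
    qed
    define R where "R = (plane_rotation i j c s p :: complex^'n^'n)"
    have R: "unitary R" unfolding R_def by (rule unitary_plane_rotation [OF ij cs p])
    have other: "(adjoint_mat R ** B ** R) $ k $ k = B $ k $ k" if "k \<noteq> i" "k \<noteq> j" for k
    proof -
      have Rk: "R $ a $ k = (if a = k then 1 else 0)" for a
        using that by (simp add: R_def plane_rotation_def)
      have "(\<Sum>a\<in>UNIV. cnj (R $ a $ k) * B $ a $ b) = B $ k $ b" for b
        unfolding Rk by (subst sum.cong [OF refl, of _ _ "\<lambda>a. if a = k then B $ k $ b else 0"]) auto
      then have "(adjoint_mat R ** B ** R) $ k $ k = (\<Sum>b\<in>UNIV. if b = k then B $ k $ k else 0)"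
        unfolding quadratic_sum_nth Rk by (intro sum.cong) auto
      then show ?thesis by simp
    qed
    have two: "(adjoint_mat R ** B ** R) $ k $ k =
        (cnj (R $ i $ k) * B $ i $ i + cnj (R $ j $ k) * B $ j $ i) * R $ i $ k +
        (cnj (R $ i $ k) * B $ i $ j + cnj (R $ j $ k) * B $ j $ j) * R $ j $ k"
      if k: "k = i \<or> k = j" for k
    proof -
      have "(\<Sum>a\<in>UNIV. cnj (R $ a $ k) * B $ a $ b)
          = cnj (R $ i $ k) * B $ i $ b + cnj (R $ j $ k) * B $ j $ b" for b
        by (rule sum_supported_pair [OF ij]) (use k in \<open>auto simp: R_def plane_rotation_def\<close>)
      then show ?thesis
        unfolding quadratic_sum_nth
        by (subst sum_supported_pair [OF ij]) (use k in \<open>auto simp: R_def plane_rotation_def\<close>)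
    qed
    have entries: "R $ i $ i = of_real c" "R $ j $ i = of_real s * p"
      "R $ i $ j = - of_real s * cnj p" "R $ j $ j = of_real c"
      using ij by (auto simp: R_def plane_rotation_def)
    have "(adjoint_mat R ** B ** R) $ i $ i
        = of_real (c * c) * B $ i $ i + of_real (s * c) * (B $ j $ i * cnj p)
          + of_real (s * c) * (B $ i $ j * p) + of_real (s * s) * (B $ j $ j * (cnj p * p))"
      unfolding two [OF disjI1 [OF refl]] entries by (simp add: algebra_simps)
    then have Ri: "Re ((adjoint_mat R ** B ** R) $ i $ i)
        = c\<^sup>2 * Re (B $ i $ i) + s\<^sup>2 * Re (B $ j $ j) + 2 * s * c * r"
      unfolding Bp Bp' pp by (simp add: power2_eq_square)
    have "(adjoint_mat R ** B ** R) $ j $ j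
        = of_real (c * c) * B $ j $ j - of_real (s * c) * (B $ j $ i * cnj p)
          - of_real (s * c) * (B $ i $ j * p) + of_real (s * s) * (B $ i $ i * (p * cnj p))"
      unfolding two [OF disjI2 [OF refl]] entries by (simp add: algebra_simps)
    then have Rj: "Re ((adjoint_mat R ** B ** R) $ j $ j)
        = c\<^sup>2 * Re (B $ j $ j) + s\<^sup>2 * Re (B $ i $ i) - 2 * s * c * r"
      unfolding Bp Bp' pp by (simp add: power2_eq_square)
    have fUR: "f (U ** R) = (\<Sum>k\<in>UNIV. z k * Re ((adjoint_mat R ** B ** R) $ k $ k))"
      by (simp add: f_def B_def matrix_mul_assoc)
    have fU: "f U = (\<Sum>k\<in>UNIV. z k * Re (B $ k $ k))"
      by (simp add: f_def B_def)
    have "f (U ** R) - f U = (\<Sum>k\<in>UNIV. z k * (Re ((adjoint_mat R ** B ** R) $ k $ k) - Re (B $ k $ k)))"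
      unfolding fUR fU by (simp add: sum_subtractf right_diff_distrib)
    also have "\<dots> = z i * (Re ((adjoint_mat R ** B ** R) $ i $ i) - Re (B $ i $ i))
          + z j * (Re ((adjoint_mat R ** B ** R) $ j $ j) - Re (B $ j $ j))"
      by (rule sum_supported_pair [OF ij]) (simp add: other)
    also have "\<dots> = (z i - z j) * (s\<^sup>2 * D + 2 * s * c * r)"
    proof -
      have c2: "c\<^sup>2 = 1 - s\<^sup>2" using cs by simp
      show ?thesis unfolding Ri Rj D_def c2 by (simp add: algebra_simps)
    qed
    also have "s\<^sup>2 * D + 2 * s * c * r = t * c\<^sup>2 * (t * D + 2 * r)"
      by (simp add: s_def power2_eq_square algebra_simps)
    also have "(z i - z j) * (t * c\<^sup>2 * (t * D + 2 * r)) > 0"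
    proof -
      have "- (t * \<bar>D\<bar>) \<le> t * D" using t(1) by (metis abs_ge_minus_self abs_mult abs_of_pos minus_le_iff)
      then have "t * D + 2 * r > 0" using t(3) by linarith
      then show ?thesis using lt t(1) c by (intro mult_pos_pos) auto
    qed
    finally have "f U < f (U ** R)" by simp
    moreover have "f (U ** R) \<le> f U" by (intro max unitary_mul U R)
    ultimately show False by simp
  qed
  have diag: "B = diag_mat (\<chi> k. Re (B $ k $ k))"
  proof (simp only: vec_eq_iff, intro allI)
    fix i j
    show "B $ i $ j = diag_mat (\<chi> k. Re (B $ k $ k)) $ i $ j"
    proof (cases "i = j")
      case True
      have "B $ i $ i = cnj (B $ i $ i)" by (rule hermitian_nth [OF B])
      then show ?thesis using True by (simp add: diag_mat_nth complex_eq_iff)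
    next
      case False
      then have "z j < z i \<or> z i < z j" using z by (meson linorder_neqE_linordered_idom)
      then have "B $ i $ j = 0" using off hermitian_nth [OF B, of i j] by fastforce
      then show ?thesis using False by (simp add: diag_mat_nth)
    qed
  qed
  have "A = U ** B ** adjoint_mat U"
    unfolding B_def by (simp add: matrix_mul_assoc unitaryD [OF U] unitary_cancel [OF U])
  then have "A = spectral_mat U (\<chi> k. Re (B $ k $ k))" using diag by (simp add: spectral_mat_def)
  with U show ?thesis by (rule that)
qed

section \<open>Functional calculus\<close>

lemma adjoint_spectral [simp]: "adjoint_mat (spectral_mat U d) = spectral_mat U d"
  by (simp add: spectral_mat_def matrix_mul_assoc)

lemma hermitian_spectral [simp]: "hermitian (spectral_mat U d)"
  by (simp add: hermitian_def)

lemma spectral_mul: "unitary U \<Longrightarrow> spectral_mat U d ** spectral_mat U e = spectral_mat U (\<chi> i. d $ i * e $ i)"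
  unfolding spectral_mat_def diag_mul_diag [symmetric]
  by (simp add: matrix_mul_assoc [symmetric] unitary_cancel)

lemma spectral_add: "spectral_mat U d + spectral_mat U e = spectral_mat U (d + e)"
  by (simp add: spectral_mat_def diag_add matmul.add_left matmul.add_right)

lemma spectral_scaleR: "c *\<^sub>R spectral_mat U d = spectral_mat U (c *\<^sub>R d)"
  by (simp add: spectral_mat_def diag_scaleR matmul.scaleR_left matmul.scaleR_right)

lemma spectral_const: "unitary U \<Longrightarrow> spectral_mat U (\<chi> i. c) = c *\<^sub>R mat 1"
  by (simp add: spectral_mat_def diag_one matmul.scaleR_left matmul.scaleR_right unitaryD)

lemma spectral_conj: "V ** spectral_mat U d ** adjoint_mat V = spectral_mat (V ** U) d"
  by (simp add: spectral_mat_def matrix_mul_assoc)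

text \<open>Two diagonalisations of the same matrix are intertwined by \<open>W = V\<^sup>* U\<close>: from \<open>W diag(d) = diag(e) W\<close> an entry
  of \<open>W\<close> can only be nonzero where \<open>d\<^sub>j = e\<^sub>i\<close>, hence \<open>f(d\<^sub>j) = f(e\<^sub>i)\<close> there.\<close>

lemma mat_fun_spectral:
  assumes U: "unitary U"
  shows "mat_fun f (spectral_mat U d) = spectral_mat U (\<chi> i. f (d $ i))"
  unfolding mat_fun_def
proof (rule the_equality, intro exI conjI)
  show "unitary U" by (rule U)
  show "spectral_mat U d = U ** diag_mat d ** adjoint_mat U" by (simp add: spectral_mat_def)
  show "spectral_mat U (\<chi> i. f (d $ i)) = U ** diag_mat (\<chi> i. f (d $ i)) ** adjoint_mat U"
    by (simp add: spectral_mat_def)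
next
  fix B
  assume "\<exists>V e. unitary V \<and> spectral_mat U d = V ** diag_mat e ** adjoint_mat V \<and>
    B = V ** diag_mat (\<chi> i. f (e $ i)) ** adjoint_mat V"
  then obtain V e where V: "unitary V" and eq: "spectral_mat U d = V ** diag_mat e ** adjoint_mat V"
    and B: "B = V ** diag_mat (\<chi> i. f (e $ i)) ** adjoint_mat V" by blast
  define W where "W = adjoint_mat V ** U"
  have "adjoint_mat V ** spectral_mat U d ** U = W ** diag_mat d"
    by (simp add: spectral_mat_def W_def matrix_mul_assoc unitary_cancel U)
  moreover have "adjoint_mat V ** spectral_mat U d ** U = diag_mat e ** W"
    by (simp add: eq W_def matrix_mul_assoc unitary_cancel V unitaryD)
  ultimately have 1: "W ** diag_mat d = diag_mat e ** W" by simp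
  have 2: "W ** diag_mat (\<chi> i. f (d $ i)) = diag_mat (\<chi> i. f (e $ i)) ** W"
  proof (simp only: vec_eq_iff, intro allI)
    fix i j
    have "W $ i $ j * of_real (d $ j) = of_real (e $ i) * W $ i $ j"
      using arg_cong [OF 1, of "\<lambda>M. M $ i $ j"] by (simp add: mul_diag_nth diag_mul_nth)
    then have "W $ i $ j = 0 \<or> d $ j = e $ i" by auto
    then show "(W ** diag_mat (\<chi> i. f (d $ i))) $ i $ j = (diag_mat (\<chi> i. f (e $ i)) ** W) $ i $ j"
      by (auto simp: mul_diag_nth diag_mul_nth)
  qed
  have "B = V ** (diag_mat (\<chi> i. f (e $ i)) ** W) ** adjoint_mat U"
    by (simp add: B W_def matrix_mul_assoc unitary_cancel U V unitaryD)
  also have "\<dots> = spectral_mat U (\<chi> i. f (d $ i))"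
    unfolding 2 [symmetric] by (simp add: W_def spectral_mat_def matrix_mul_assoc unitary_cancel U V unitaryD)
  finally show "B = spectral_mat U (\<chi> i. f (d $ i))" .
qed

lemma inner_matrix_vector: "(M *v x) \<bullet> y = x \<bullet> (adjoint_mat M *v y)" for x y :: "complex^'n"
proof -
  have inn: "u \<bullet> v = Re (\<Sum>i\<in>UNIV. cnj (u $ i) * v $ i)" for u v :: "complex^'n"
    by (simp add: inner_vec_def inner_complex_def)
  have "(\<Sum>i\<in>UNIV. cnj ((M *v x) $ i) * y $ i) = (\<Sum>i\<in>UNIV. \<Sum>j\<in>UNIV. cnj (M $ i $ j) * cnj (x $ j) * y $ i)"
    by (simp add: matrix_vector_mult_def sum_distrib_right)
  also have "\<dots> = (\<Sum>j\<in>UNIV. cnj (x $ j) * (adjoint_mat M *v y) $ j)"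
    by (subst sum.swap) (simp add: matrix_vector_mult_def adjoint_mat_def sum_distrib_left mult_ac)
  finally show ?thesis by (simp add: inn)
qed

lemma diag_mul_vec_nth: "(diag_mat d *v x) $ i = of_real (d $ i) * x $ i"
  by (simp add: matrix_vector_mult_def diag_mat_def if_distrib [of "\<lambda>x. x * _"] cong: if_cong)

lemma unitary_vec_eq_0: "unitary U \<Longrightarrow> adjoint_mat U *v x = 0 \<longleftrightarrow> x = 0"
  by (metis matrix_vector_mul_assoc matrix_vector_mul_lid matrix_vector_mult_0_right unitaryD(2))

lemma quadratic_form_spectral:
  "x \<bullet> (spectral_mat U d *v x) = (\<Sum>i\<in>UNIV. d $ i * (cmod ((adjoint_mat U *v x) $ i))\<^sup>2)"
proof -
  define w where "w = adjoint_mat U *v x"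
  have "x \<bullet> (spectral_mat U d *v x) = x \<bullet> (U *v (diag_mat d *v w))"
    by (simp add: spectral_mat_def w_def matrix_vector_mul_assoc matrix_mul_assoc)
  also have "\<dots> = w \<bullet> (diag_mat d *v w)"
    using inner_matrix_vector [of "adjoint_mat U" x "diag_mat d *v w"] by (simp add: w_def)
  also have "\<dots> = (\<Sum>i\<in>UNIV. d $ i * (cmod (w $ i))\<^sup>2)"
    by (simp add: inner_vec_def inner_complex_def diag_mul_vec_nth cmod_power2)
      (simp add: power2_eq_square algebra_simps)
  finally show ?thesis by (simp add: w_def)
qed

lemma eigenvector_column:
  assumes U: "unitary U"
  shows "spectral_mat U d *v (U *v axis j 1) = of_real (d $ j) *s (U *v axis j 1)"
    and "adjoint_mat U *v (U *v axis j 1) = axis j 1" and "U *v axis j 1 \<noteq> 0"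
proof -
  show ax: "adjoint_mat U *v (U *v axis j 1) = axis j 1"
    by (simp add: matrix_vector_mul_assoc unitaryD [OF U])
  have D: "diag_mat d *v axis j 1 = of_real (d $ j) *s axis j 1"
    by (simp add: vec_eq_iff diag_mul_vec_nth axis_def)
  have "spectral_mat U d *v (U *v axis j 1) = U *v (diag_mat d *v (adjoint_mat U *v (U *v axis j 1)))"
    by (simp add: spectral_mat_def matrix_vector_mul_assoc matrix_mul_assoc)
  then show "spectral_mat U d *v (U *v axis j 1) = of_real (d $ j) *s (U *v axis j 1)"
    by (simp only: ax D vec.scale)
  show "U *v axis j 1 \<noteq> 0"
    using ax by (metis axis_eq_0_iff matrix_vector_mult_0_right one_neq_zero)
qed

lemma hermitian_on_iff:
  "A \<in> hermitian_on S \<longleftrightarrow> (\<exists>U d. unitary U \<and> A = spectral_mat U d \<and> (\<forall>i. d $ i \<in> S))"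
proof
  assume A: "A \<in> hermitian_on S"
  then obtain U d where U: "unitary U" and Ad: "A = spectral_mat U d"
    using hermitian_diagonalizable [of A] by (auto simp: hermitian_on_def)
  have "d $ j \<in> S" for j
  proof -
    have "complex_of_real (d $ j) \<in> spectrum A"
      unfolding spectrum_def Ad using eigenvector_column [OF U] by blast
    then show ?thesis using A by (auto simp: hermitian_on_def)
  qed
  with U Ad show "\<exists>U d. unitary U \<and> A = spectral_mat U d \<and> (\<forall>i. d $ i \<in> S)" by blast
next
  assume "\<exists>U d. unitary U \<and> A = spectral_mat U d \<and> (\<forall>i. d $ i \<in> S)"
  then obtain U d where U: "unitary U" and A: "A = spectral_mat U d" and d: "\<And>i. d $ i \<in> S" by blast
  have "c \<in> complex_of_real ` S" if "c \<in> spectrum A" for c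
  proof -
    obtain v where v: "v \<noteq> 0" "A *v v = c *s v" using \<open>c \<in> spectrum A\<close> by (auto simp: spectrum_def)
    define w where "w = adjoint_mat U *v v"
    have "w \<noteq> 0" using v U by (simp add: w_def unitary_vec_eq_0)
    then obtain i where i: "w $ i \<noteq> 0" by (auto simp: vec_eq_iff)
    have "adjoint_mat U *v (A *v v) = diag_mat d *v w"
      by (simp add: A spectral_mat_def w_def matrix_vector_mul_assoc matrix_mul_assoc unitaryD U)
    then have "diag_mat d *v w = c *s w" by (simp add: v w_def vec.scale)
    then have "of_real (d $ i) * w $ i = c * w $ i" by (metis diag_mul_vec_nth vector_smult_component)
    then show ?thesis using i d by auto
  qed
  then show "A \<in> hermitian_on S" by (auto simp: hermitian_on_def A)
qed

lemma hermitian_onE: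
  assumes "A \<in> hermitian_on S"
  obtains U d where "unitary U" "A = spectral_mat U d" "\<And>i. d $ i \<in> S"
  using assms hermitian_on_iff [of A S] by auto

lemma spectral_in: "unitary U \<Longrightarrow> (\<And>i. d $ i \<in> S) \<Longrightarrow> spectral_mat U d \<in> hermitian_on S"
  using hermitian_on_iff by blast

lemma hermitian_on_UNIV [simp]: "A \<in> hermitian_on UNIV \<longleftrightarrow> hermitian A"
  by (metis UNIV_I hermitian_diagonalizable hermitian_on_iff hermitian_spectral)

lemma hermitian_onD: "A \<in> hermitian_on S \<Longrightarrow> hermitian A"
  by (simp add: hermitian_on_def)

lemma hermitian_on_mono: "S \<subseteq> T \<Longrightarrow> A \<in> hermitian_on S \<Longrightarrow> A \<in> hermitian_on T"
  unfolding hermitian_on_def by blast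

lemma pd_iff: "A \<in> pd_matrices \<longleftrightarrow> A \<in> hermitian_on {0<..}"
proof
  assume A: "A \<in> pd_matrices"
  then obtain U d where U: "unitary U" and Ad: "A = spectral_mat U d"
    using hermitian_diagonalizable [of A] by (auto simp: pd_matrices_def)
  have "d $ j > 0" for j
  proof -
    have "0 < (U *v axis j 1) \<bullet> (A *v (U *v axis j 1))"
      using A eigenvector_column(3) [OF U] by (auto simp: pd_matrices_def)
    also have "\<dots> = (\<Sum>i\<in>UNIV. if i = j then d $ j else 0)"
      unfolding Ad quadratic_form_spectral eigenvector_column(2) [OF U]
      by (rule sum.cong) (auto simp: axis_def)
    also have "\<dots> = d $ j" by simp
    finally show ?thesis .
  qed
  then show "A \<in> hermitian_on {0<..}" using U Ad by (auto intro: spectral_in)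
next
  assume "A \<in> hermitian_on {0<..}"
  then obtain U d where U: "unitary U" and A: "A = spectral_mat U d" and d: "\<And>i. d $ i > 0"
    by (auto elim: hermitian_onE)
  have "0 < x \<bullet> (A *v x)" if "x \<noteq> 0" for x
  proof -
    have "adjoint_mat U *v x \<noteq> 0" using that U by (simp add: unitary_vec_eq_0)
    then obtain i where "(adjoint_mat U *v x) $ i \<noteq> 0" by (auto simp: vec_eq_iff)
    then show ?thesis
      unfolding A quadratic_form_spectral using d
      by (intro sum_pos2 [of _ i]) (auto simp: less_imp_le)
  qed
  then show "A \<in> pd_matrices" by (auto simp: pd_matrices_def A)
qed

lemma psd_if: "A \<in> hermitian_on {0..} \<Longrightarrow> A \<in> psd_matrices"
  by (auto simp: psd_matrices_def quadratic_form_spectral intro!: sum_nonneg elim!: hermitian_onE)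

lemma mat_fun_in: "A \<in> hermitian_on S \<Longrightarrow> f ` S \<subseteq> T \<Longrightarrow> mat_fun f A \<in> hermitian_on T"
  by (erule hermitian_onE) (auto simp: mat_fun_spectral intro!: spectral_in)

lemma hermitian_mat_fun: "hermitian A \<Longrightarrow> hermitian (mat_fun f A)"
  using mat_fun_in [of A UNIV f UNIV] by simp

lemma mat_fun_cong: "A \<in> hermitian_on S \<Longrightarrow> (\<And>x. x \<in> S \<Longrightarrow> f x = g x) \<Longrightarrow> mat_fun f A = mat_fun g A"
  by (erule hermitian_onE) (simp add: mat_fun_spectral)

lemma mat_fun_ident: "hermitian A \<Longrightarrow> mat_fun (\<lambda>x. x) A = A"
  by (erule hermitian_diagonalizable) (simp add: mat_fun_spectral)

lemma mat_fun_const: "hermitian A \<Longrightarrow> mat_fun (\<lambda>x. c) A = c *\<^sub>R mat 1"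
  by (erule hermitian_diagonalizable) (simp add: mat_fun_spectral spectral_const)

lemma mat_fun_mul: "hermitian A \<Longrightarrow> mat_fun f A ** mat_fun g A = mat_fun (\<lambda>x. f x * g x) A"
  by (erule hermitian_diagonalizable) (simp add: mat_fun_spectral spectral_mul)

lemma mat_fun_add: "hermitian A \<Longrightarrow> mat_fun f A + mat_fun g A = mat_fun (\<lambda>x. f x + g x) A"
  by (erule hermitian_diagonalizable)
    (simp add: mat_fun_spectral spectral_add, rule arg_cong [of _ _ "spectral_mat _"], simp add: vec_eq_iff)

lemma mat_fun_scaleR: "hermitian A \<Longrightarrow> c *\<^sub>R mat_fun f A = mat_fun (\<lambda>x. c * f x) A"
  by (erule hermitian_diagonalizable)
    (simp add: mat_fun_spectral spectral_scaleR, rule arg_cong [of _ _ "spectral_mat _"], simp add: vec_eq_iff)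

lemma mat_fun_comp: "hermitian A \<Longrightarrow> mat_fun f (mat_fun g A) = mat_fun (\<lambda>x. f (g x)) A"
  by (erule hermitian_diagonalizable) (simp add: mat_fun_spectral)

lemma mat_fun_unitary:
  "hermitian A \<Longrightarrow> unitary U \<Longrightarrow> mat_fun f (U ** A ** adjoint_mat U) = U ** mat_fun f A ** adjoint_mat U"
  by (erule hermitian_diagonalizable) (simp add: mat_fun_spectral spectral_conj unitary_mul)

text \<open>For two Hermitian matrices with eigenbases \<open>u\<^sub>i\<close> and \<open>v\<^sub>j\<close> every inner product of a function of the
  one with a function of the other is a sum with the same weights \<open>P\<^sub>i\<^sub>j = |\<langle>u\<^sub>i, v\<^sub>j\<rangle>|\<^sup>2\<close>. Inequalities
  between real functions of two variables thereby become inequalities between matrices, without any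
  commutativity.\<close>

lemma two_matrix_weights:
  fixes A B :: "complex^'n^'n"
  assumes "A \<in> hermitian_on S" "B \<in> hermitian_on T"
  obtains d e :: "real^'n" and P :: "'n \<Rightarrow> 'n \<Rightarrow> real"
  where "\<And>i. d $ i \<in> S" "\<And>j. e $ j \<in> T" "\<And>i j. P i j \<ge> 0"
    "\<And>f g. mat_fun f A \<bullet> mat_fun g B = (\<Sum>i\<in>UNIV. \<Sum>j\<in>UNIV. f (d $ i) * g (e $ j) * P i j)"
    "\<And>f. (norm (mat_fun f A - mat_fun f B))\<^sup>2 = (\<Sum>i\<in>UNIV. \<Sum>j\<in>UNIV. (f (d $ i) - f (e $ j))\<^sup>2 * P i j)"
proof -
  obtain U d where U: "unitary U" and A: "A = spectral_mat U d" and d: "\<And>i. d $ i \<in> S"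
    using hermitian_onE [OF assms(1)] by blast
  obtain V e where V: "unitary V" and B: "B = spectral_mat V e" and e: "\<And>i. e $ i \<in> T"
    using hermitian_onE [OF assms(2)] by blast
  define W where "W = adjoint_mat U ** V"
  define P where "P i j = (cmod (W $ i $ j))\<^sup>2" for i j
  have eq: "mat_fun f A \<bullet> mat_fun g B = (\<Sum>i\<in>UNIV. \<Sum>j\<in>UNIV. f (d $ i) * g (e $ j) * P i j)" for f g
  proof -
    let ?f = "\<chi> i. f (d $ i)" and ?g = "\<chi> i. g (e $ i)"
    have "mat_fun f A \<bullet> mat_fun g B = (adjoint_mat U ** spectral_mat U ?f ** V) \<bullet> (adjoint_mat U ** spectral_mat V ?g ** V)"
      by (simp add: A B mat_fun_spectral U V inner_unitary)
    also have "adjoint_mat U ** spectral_mat U ?f ** V = diag_mat ?f ** W"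
      by (simp add: spectral_mat_def W_def matrix_mul_assoc unitaryD U)
    also have "adjoint_mat U ** spectral_mat V ?g ** V = W ** diag_mat ?g"
      by (simp add: spectral_mat_def W_def matrix_mul_assoc unitary_cancel V)
    also have "(diag_mat ?f ** W) \<bullet> (W ** diag_mat ?g) = (\<Sum>i\<in>UNIV. \<Sum>j\<in>UNIV. f (d $ i) * g (e $ j) * P i j)"
      unfolding inner_vec_def inner_complex_def P_def
      by (simp add: diag_mul_nth mul_diag_nth cmod_power2) (simp add: power2_eq_square algebra_simps)
    finally show ?thesis .
  qed
  have sq: "(norm (mat_fun f A - mat_fun f B))\<^sup>2 = (\<Sum>i\<in>UNIV. \<Sum>j\<in>UNIV. (f (d $ i) - f (e $ j))\<^sup>2 * P i j)" for f
  proof -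
    have hA: "hermitian A" and hB: "hermitian B" by (simp_all add: A B)
    have adj: "adjoint_mat (mat_fun f C) = mat_fun f C" if "hermitian C" for C :: "complex^'n^'n"
      using hermitian_mat_fun [OF that] by (simp add: hermitian_def)
    have AA: "mat_fun f A \<bullet> mat_fun f A = mat_fun (\<lambda>x. f x * f x) A \<bullet> mat_fun (\<lambda>x. 1) B"
      using inner_mul_left [of "mat_fun f A" "mat_fun f A" "mat 1"] adj [OF hA]
      by (simp add: mat_fun_const hB mat_fun_mul [OF hA, symmetric])
    have BB: "mat_fun f B \<bullet> mat_fun f B = mat_fun (\<lambda>x. 1) A \<bullet> mat_fun (\<lambda>x. f x * f x) B"
      using inner_mul_left [of "mat_fun f B" "mat 1" "mat_fun f B"] adj [OF hB]
      by (simp add: mat_fun_const hA mat_fun_mul [OF hB, symmetric])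
    have "(norm (mat_fun f A - mat_fun f B))\<^sup>2 = mat_fun f A \<bullet> mat_fun f A - 2 * (mat_fun f A \<bullet> mat_fun f B)
        + mat_fun f B \<bullet> mat_fun f B"
      by (simp add: power2_norm_eq_inner inner_diff_left inner_diff_right inner_commute)
    also have "\<dots> = (\<Sum>i\<in>UNIV. \<Sum>j\<in>UNIV. (f (d $ i) - f (e $ j))\<^sup>2 * P i j)"
      unfolding AA BB eq
      by (simp add: sum_distrib_left sum_subtractf [symmetric] sum.distrib [symmetric] power2_eq_square algebra_simps)
    finally show ?thesis .
  qed
  show ?thesis by (rule that [OF d e _ eq sq]) (simp add: P_def)
qed

lemma mat_fun_Lipschitz:
  fixes A B :: "complex^'n^'n"
  assumes A: "A \<in> hermitian_on S" and B: "B \<in> hermitian_on S" and "L \<ge> 0"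
    and lip: "\<And>x y. x \<in> S \<Longrightarrow> y \<in> S \<Longrightarrow> \<bar>f x - f y\<bar> \<le> L * \<bar>x - y\<bar>"
  shows "norm (mat_fun f A - mat_fun f B) \<le> L * norm (A - B)"
proof -
  obtain d e :: "real^'n" and P :: "'n \<Rightarrow> 'n \<Rightarrow> real"
    where d: "\<And>i. d $ i \<in> S" and e: "\<And>j. e $ j \<in> S" and P: "\<And>i j. P i j \<ge> 0"
    and "\<And>f g. mat_fun f A \<bullet> mat_fun g B = (\<Sum>i\<in>UNIV. \<Sum>j\<in>UNIV. f (d $ i) * g (e $ j) * P i j)"
    and sq: "\<And>f. (norm (mat_fun f A - mat_fun f B))\<^sup>2 = (\<Sum>i\<in>UNIV. \<Sum>j\<in>UNIV. (f (d $ i) - f (e $ j))\<^sup>2 * P i j)"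
    by (rule two_matrix_weights [OF A B]) (rule that)
  have "(norm (mat_fun f A - mat_fun f B))\<^sup>2 \<le> (\<Sum>i\<in>UNIV. \<Sum>j\<in>UNIV. L\<^sup>2 * ((d $ i - e $ j)\<^sup>2 * P i j))"
    unfolding sq
  proof (intro sum_mono)
    fix i j
    have "(f (d $ i) - f (e $ j))\<^sup>2 \<le> (L * \<bar>d $ i - e $ j\<bar>)\<^sup>2"
      using lip [OF d e] by (metis abs_ge_zero power2_abs power_mono)
    from mult_right_mono [OF this P]
    show "(f (d $ i) - f (e $ j))\<^sup>2 * P i j \<le> L\<^sup>2 * ((d $ i - e $ j)\<^sup>2 * P i j)"
      by (simp add: power_mult_distrib mult.assoc)
  qed
  also have "\<dots> = (L * norm (A - B))\<^sup>2"
    using sq [of "\<lambda>x. x"] A B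
    by (simp add: mat_fun_ident hermitian_onD power_mult_distrib sum_distrib_left)
  finally show ?thesis by (rule power2_le_imp_le) (use \<open>L \<ge> 0\<close> in simp)
qed

section \<open>Square roots and congruences\<close>

definition root_mat :: "complex^'n^'n \<Rightarrow> complex^'n^'n" where
  "root_mat A = mat_fun (\<lambda>x. x powr (1 / 2)) A"

definition inv_root_mat :: "complex^'n^'n \<Rightarrow> complex^'n^'n" where
  "inv_root_mat A = mat_fun (\<lambda>x. x powr (- 1 / 2)) A"

lemma pd_hermitian: "A \<in> pd_matrices \<Longrightarrow> hermitian A"
  by (simp add: pd_matrices_def)

lemma pd_mat_fun_mul_eq:
  assumes "A \<in> pd_matrices" "\<And>x. x > 0 \<Longrightarrow> f x * g x = h x"
  shows "mat_fun f A ** mat_fun g A = mat_fun h A"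
  using assms mat_fun_cong [of A "{0<..}" "\<lambda>x. f x * g x" h]
  by (simp add: mat_fun_mul pd_hermitian pd_iff [symmetric])

context
  fixes A :: "complex^'n^'n"
  assumes A: "A \<in> pd_matrices"
begin

lemma root_mul_root: "root_mat A ** root_mat A = A"
  using pd_mat_fun_mul_eq [OF A, of "\<lambda>x. x powr (1 / 2)" "\<lambda>x. x powr (1 / 2)" "\<lambda>x. x"]
  by (simp add: root_mat_def mat_fun_ident pd_hermitian [OF A] powr_add [symmetric])

lemma root_mul_inv_root [simp]: "root_mat A ** inv_root_mat A = mat 1"
  using pd_mat_fun_mul_eq [OF A, of "\<lambda>x. x powr (1 / 2)" "\<lambda>x. x powr (- 1 / 2)" "\<lambda>x. 1"]
  by (simp add: root_mat_def inv_root_mat_def mat_fun_const pd_hermitian [OF A] powr_add [symmetric])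

lemma inv_root_mul_root [simp]: "inv_root_mat A ** root_mat A = mat 1"
  using root_mul_inv_root matrix_left_right_inverse by blast

lemma adjoint_root [simp]: "adjoint_mat (root_mat A) = root_mat A"
  using hermitian_mat_fun [OF pd_hermitian [OF A]] by (simp add: root_mat_def hermitian_def)

lemma adjoint_inv_root [simp]: "adjoint_mat (inv_root_mat A) = inv_root_mat A"
  using hermitian_mat_fun [OF pd_hermitian [OF A]] by (simp add: inv_root_mat_def hermitian_def)

lemma inv_root_root_cancel:
  "inv_root_mat A ** (root_mat A ** B) = B" "root_mat A ** (inv_root_mat A ** B) = B"
  "B ** root_mat A ** inv_root_mat A = B" "B ** inv_root_mat A ** root_mat A = B"
  by (simp_all add: matrix_mul_assoc) (simp_all add: matrix_mul_assoc [symmetric])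

lemma inv_root_conj_self: "inv_root_mat A ** A ** inv_root_mat A = mat 1"
proof -
  have "inv_root_mat A ** A ** inv_root_mat A = inv_root_mat A ** (root_mat A ** root_mat A) ** inv_root_mat A"
    by (simp only: root_mul_root)
  then show ?thesis by (simp only: inv_root_root_cancel matrix_mul_assoc inv_root_mul_root matrix_mul_lid root_mul_inv_root)
qed

end

lemma pd_congruence:
  assumes A: "A \<in> pd_matrices" and ST: "S ** T = mat 1"
  shows "S ** A ** adjoint_mat S \<in> pd_matrices"
proof -
  have "0 < x \<bullet> (S ** A ** adjoint_mat S *v x)" if "x \<noteq> 0" for x
  proof -
    have "adjoint_mat T *v (adjoint_mat S *v x) = x"
      using arg_cong [OF ST, of adjoint_mat] by (simp add: matrix_vector_mul_assoc)
    then have "adjoint_mat S *v x \<noteq> 0" using that by auto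
    then have "0 < (adjoint_mat S *v x) \<bullet> (A *v (adjoint_mat S *v x))"
      using A by (auto simp: pd_matrices_def)
    also have "\<dots> = x \<bullet> (S ** A ** adjoint_mat S *v x)"
      by (simp add: inner_matrix_vector matrix_vector_mul_assoc matrix_mul_assoc)
    finally show ?thesis .
  qed
  then show ?thesis using A by (simp add: pd_matrices_def hermitian_conj)
qed

lemma pd_one: "mat 1 \<in> pd_matrices"
  using spectral_in [of "mat 1" "\<chi> i. 1" "{0<..}"] by (simp add: pd_iff spectral_const)

lemma pd_mat_fun: "A \<in> pd_matrices \<Longrightarrow> (\<And>x. x > 0 \<Longrightarrow> f x > 0) \<Longrightarrow> mat_fun f A \<in> pd_matrices"
  unfolding pd_iff by (erule mat_fun_in) auto

lemma pd_inv_root_conj: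
  assumes "A \<in> pd_matrices" "B \<in> pd_matrices"
  shows "inv_root_mat A ** B ** inv_root_mat A \<in> pd_matrices"
  using pd_congruence [OF assms(2), of "inv_root_mat A" "root_mat A"] assms(1) by simp

text \<open>Two factorisations \<open>A = S S\<^sup>* = A\<^sup>1\<^sup>/\<^sup>2 A\<^sup>1\<^sup>/\<^sup>2\<close> differ by a unitary factor. Hence whatever is unitarily
  invariant may be computed with \<open>S\<inverse>\<close> in place of \<open>A\<^sup>-\<^sup>1\<^sup>/\<^sup>2\<close>.\<close>

lemma inv_root_conj_factor:
  assumes ST: "S ** T = mat 1"
  obtains W where "unitary W"
    "\<And>B. inv_root_mat (S ** adjoint_mat S) ** B ** inv_root_mat (S ** adjoint_mat S)
        = W ** (T ** B ** adjoint_mat T) ** adjoint_mat W"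
proof -
  let ?A = "S ** adjoint_mat S"
  have A: "?A \<in> pd_matrices" using pd_congruence [OF pd_one ST] by simp
  define W where "W = inv_root_mat ?A ** S"
  have "W ** adjoint_mat W = inv_root_mat ?A ** ?A ** inv_root_mat ?A"
    by (simp add: W_def A matrix_mul_assoc)
  then have W: "unitary W" using inv_root_conj_self [OF A] by (simp add: unitary_if_coisometry)
  have WT: "W ** T = inv_root_mat ?A"
    by (simp add: W_def ST matrix_mul_assoc [symmetric])
  have TW: "adjoint_mat T ** adjoint_mat W = inv_root_mat ?A"
    using arg_cong [OF WT, of adjoint_mat] A by simp
  have "inv_root_mat ?A ** B ** inv_root_mat ?A = W ** (T ** B ** adjoint_mat T) ** adjoint_mat W" for B
  proof -
    have "W ** (T ** B ** adjoint_mat T) ** adjoint_mat W = (W ** T) ** B ** (adjoint_mat T ** adjoint_mat W)"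
      by (simp only: matrix_mul_assoc)
    then show ?thesis by (simp only: WT TW)
  qed
  with W show ?thesis by (rule that)
qed

section \<open>Unitarily invariant seminorms and Schur multipliers\<close>

text \<open>Definiteness is left out so that one theory covers the given symmetric norms, the Hilbert--Schmidt norm and the
  support functionals that detect majorization.\<close>

locale ui_seminorm =
  fixes N :: "complex^'n^'n \<Rightarrow> real"
  assumes triangle: "N (A + B) \<le> N A + N B"
    and scale: "N (c *\<^sub>R A) = \<bar>c\<bar> * N A"
    and invariant: "unitary U \<Longrightarrow> unitary V \<Longrightarrow> N (U ** A ** V) = N A"

definition phase_mat :: "real^'n \<Rightarrow> complex^'n^'n" where
  "phase_mat a = (\<chi> i j. if i = j then cis (a $ i) else 0)"

lemma phase_mul_nth: "(phase_mat a ** A) $ i $ j = cis (a $ i) * A $ i $ j"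
  by (simp add: matrix_matrix_mult_def phase_mat_def if_distrib [of "\<lambda>x. x * _"] cong: if_cong)

lemma mul_phase_nth: "(A ** phase_mat b) $ i $ j = A $ i $ j * cis (b $ j)"
  by (simp add: matrix_matrix_mult_def phase_mat_def if_distrib [of "\<lambda>x. _ * x"] cong: if_cong)

lemma unitary_phase: "unitary (phase_mat a)"
proof (rule unitary_if_isometry)
  have "adjoint_mat (phase_mat a) = phase_mat (- a)"
    by (simp add: adjoint_mat_def phase_mat_def vec_eq_iff cis_cnj)
  moreover have "phase_mat (- a) ** phase_mat a = mat 1"
    by (simp add: vec_eq_iff phase_mul_nth) (simp add: phase_mat_def mat_def cis_mult)
  ultimately show "adjoint_mat (phase_mat a) ** phase_mat a = mat 1" by (simp only:)
qed

definition schur :: "('n \<Rightarrow> 'n \<Rightarrow> real) \<Rightarrow> complex^'n^'n \<Rightarrow> complex^'n^'n" where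
  "schur m A = (\<chi> i j. of_real (m i j) * A $ i $ j)"

lemma schur_schur: "schur m (schur m' A) = schur (\<lambda>i j. m i j * m' i j) A"
  by (simp add: schur_def vec_eq_iff)

lemma tendsto_schur:
  assumes "\<And>i j. ((\<lambda>k. m k i j) \<longlongrightarrow> l i j) F"
  shows "((\<lambda>k. schur (m k) A) \<longlongrightarrow> schur l A) F"
  unfolding schur_def by (intro vec_tendstoI) (auto intro!: tendsto_intros assms)

lemma tendsto_one_minus_cos:
  "(\<lambda>n. 2 * c\<^sup>2 * (real (Suc n))\<^sup>2 * (1 - cos (x / real (Suc n)))) \<longlonglongrightarrow> (c * x)\<^sup>2" for c x :: real
proof -
  have "(\<lambda>n. x / real (Suc n)) \<longlonglongrightarrow> 0"
    by (rule LIMSEQ_Suc) (rule lim_const_over_n)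
  moreover have "((\<lambda>h. sin (h / 2) / h) \<longlongrightarrow> (1 / 2 :: real)) (at 0)"
  proof -
    have "((\<lambda>h. sin (h / 2)) has_real_derivative cos (0 / 2) * (1 / 2)) (at 0)"
      by (auto intro!: derivative_eq_intros)
    then show ?thesis by (simp add: has_field_derivative_iff)
  qed
  ultimately have lim: "(\<lambda>n. sin (x / real (Suc n) / 2) / (x / real (Suc n))) \<longlonglongrightarrow> 1 / 2" if "x \<noteq> 0"
    using that by (rule_tac filterlim_compose [of _ "nhds (1/2)" "at 0"]) (auto simp: filterlim_at)
  show ?thesis
  proof (cases "x = 0")
    case False
    have "2 * c\<^sup>2 * (real (Suc n))\<^sup>2 * (1 - cos (x / real (Suc n)))
        = 4 * (c * x)\<^sup>2 * (sin (x / real (Suc n) / 2) / (x / real (Suc n)))\<^sup>2" for n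
    proof -
      have "1 - cos y = 2 * (sin (y / 2))\<^sup>2" for y :: real
        using cos_double_sin [of "y / 2"] by simp
      moreover have "2 * c\<^sup>2 * M\<^sup>2 * (2 * t\<^sup>2) = 4 * (c * x)\<^sup>2 * (t / (x / M))\<^sup>2" for M t :: real
        using False by (simp add: power_mult_distrib power_divide)
      ultimately show ?thesis by (simp only:)
    qed
    moreover have "(\<lambda>n. 4 * (c * x)\<^sup>2 * (sin (x / real (Suc n) / 2) / (x / real (Suc n)))\<^sup>2) \<longlonglongrightarrow> 4 * (c * x)\<^sup>2 * (1 / 2)\<^sup>2"
      by (intro tendsto_intros lim False)
    ultimately show ?thesis by (simp add: power_divide)
  qed simp
qed

lemma sinh_product:
  "(\<lambda>m. x * (\<Prod>k=1..m. 1 + (1 / (2 * pi * real k) * x)\<^sup>2)) \<longlonglongrightarrow> 2 * sinh (x / 2)" for x :: real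
proof -
  define z where "z = \<i> * complex_of_real (x / (2 * pi))"
  have "(\<lambda>m. - 2 * \<i> * (of_real pi * z * (\<Prod>k=1..m. 1 - z\<^sup>2 / of_nat k^2))) \<longlonglongrightarrow> - 2 * \<i> * sin (of_real pi * z)"
    by (intro tendsto_intros sin_product_formula_complex)
  moreover have "- 2 * \<i> * (of_real pi * z * (\<Prod>k=1..m. 1 - z\<^sup>2 / of_nat k^2))
      = of_real (x * (\<Prod>k=1..m. 1 + (1 / (2 * pi * real k) * x)\<^sup>2))" for m
  proof -
    have "1 - z\<^sup>2 / of_nat k^2 = of_real (1 + (1 / (2 * pi * real k) * x)\<^sup>2)" for k
      by (simp add: z_def power_mult_distrib power_divide)
    then have "(\<Prod>k=1..m. 1 - z\<^sup>2 / of_nat k^2) = of_real (\<Prod>k=1..m. 1 + (1 / (2 * pi * real k) * x)\<^sup>2)"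
      unfolding of_real_prod by (intro prod.cong refl) 
    moreover have "- 2 * \<i> * (of_real pi * z * y) = of_real x * y" for y
      by (simp add: z_def)
    ultimately show ?thesis by (simp only: of_real_mult)
  qed
  moreover have "- 2 * \<i> * sin (of_real pi * z) = of_real (2 * sinh (x / 2))"
  proof -
    have "of_real pi * z = \<i> * of_real (x / 2)" by (simp add: z_def)
    then have "- 2 * \<i> * sin (of_real pi * z) = 2 * sinh (of_real (x / 2))"
      by (simp only: sinh_conv_sin) simp
    moreover have "sinh (of_real y) = (of_real (sinh y) :: complex)" for y
      by (simp add: sinh_field_def exp_minus exp_of_real)
    ultimately show ?thesis by (simp only: of_real_mult of_real_numeral)
  qed
  ultimately show ?thesis by (simp only: tendsto_of_real_iff)
qed

context ui_seminorm
begin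

lemma zero [simp]: "N 0 = 0"
  using scale [of 0 0] by simp

lemma nonneg: "0 \<le> N A"
  using triangle [of A "- 1 *\<^sub>R A"] scale [of "- 1" A] by simp

lemma left_invariant: "unitary U \<Longrightarrow> N (U ** A) = N A"
  using invariant [of U "mat 1" A] by simp

lemma conj_invariant: "unitary U \<Longrightarrow> N (U ** A ** adjoint_mat U) = N A"
  by (simp add: invariant)

lemma sum_le: "N (sum f I) \<le> (\<Sum>i\<in>I. N (f i))"
proof (induction I rule: infinite_finite_induct)
  case (insert i I)
  then show ?case using triangle [of "f i" "sum f I"] by simp
qed auto

lemma convex: "convex_on UNIV N"
  by (intro convex_onI convex_UNIV) (use triangle scale in \<open>metis abs_of_nonneg diff_ge_0_iff_ge less_imp_le\<close>)

lemma continuous: "continuous_on UNIV N"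
  by (rule convex_on_continuous [OF open_UNIV convex])

lemma tendsto: "(f \<longlongrightarrow> l) F \<Longrightarrow> ((\<lambda>x. N (f x)) \<longlongrightarrow> N l) F"
  using continuous_on_tendsto_compose [OF continuous, of f l F] by simp

text \<open>The cosine part of the multiplier is the average of the two isometries
  \<open>E \<mapsto> (e\<^sup>\<plusminus>\<^sup>i\<^sup>(\<^sup>a\<^sub>i\<^sup>-\<^sup>b\<^sub>j\<^sup>) E\<^sub>i\<^sub>j)\<close>, so the multiplier is \<open>1 + r\<close> times the identity minus \<open>r\<close> times a contraction.\<close>

lemma schur_cos_le:
  assumes "r \<ge> 0"
  shows "N E \<le> N (schur (\<lambda>i j. 1 + r * (1 - cos (a $ i - b $ j))) E)"
proof -
  let ?F = "schur (\<lambda>i j. 1 + r * (1 - cos (a $ i - b $ j))) E"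
  let ?T = "\<lambda>a b. phase_mat a ** E ** phase_mat b"
  have eq: "(1 + r) *\<^sub>R E = ?F + (r / 2) *\<^sub>R (?T a (- b) + ?T (- a) b)"
  proof (simp only: vec_eq_iff, intro allI)
    fix i j
    have "cis (a $ i) * cis (- b $ j) + cis (- a $ i) * cis (b $ j) = of_real (2 * cos (a $ i - b $ j))"
      by (simp add: cis_mult complex_eq_iff cos_diff sin_diff)
    then have "cis (a $ i) * E $ i $ j * cis (- b $ j) + cis (- a $ i) * E $ i $ j * cis (b $ j)
        = of_real (2 * cos (a $ i - b $ j)) * E $ i $ j"
      unfolding mult.assoc mult.commute [of "E $ i $ j"] by (simp only: mult.assoc [symmetric] distrib_right [symmetric])
    moreover have "(?F + (r / 2) *\<^sub>R (?T a (- b) + ?T (- a) b)) $ i $ j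
        = of_real (1 + r * (1 - cos (a $ i - b $ j))) * E $ i $ j + of_real (r / 2) *
          (cis (a $ i) * E $ i $ j * cis (- b $ j) + cis (- a $ i) * E $ i $ j * cis (b $ j))"
      by (simp add: schur_def phase_mul_nth mul_phase_nth) (simp add: scaleR_conv_of_real)
    moreover have "((1 + r) *\<^sub>R E) $ i $ j = of_real (1 + r) * E $ i $ j"
      by (simp only: vector_scaleR_component) (simp only: scaleR_conv_of_real)
    ultimately show "((1 + r) *\<^sub>R E) $ i $ j = (?F + (r / 2) *\<^sub>R (?T a (- b) + ?T (- a) b)) $ i $ j"
      by (simp add: algebra_simps)
  qed
  have "(1 + r) * N E = N ((1 + r) *\<^sub>R E)" using assms by (simp add: scale)
  also have "\<dots> \<le> N ?F + (r / 2) * N (?T a (- b) + ?T (- a) b)"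
    unfolding eq using triangle [of ?F "(r / 2) *\<^sub>R (?T a (- b) + ?T (- a) b)"] assms
    by (simp only: scale abs_of_nonneg divide_nonneg_nonneg zero_le_numeral)
  also have "\<dots> \<le> N ?F + (r / 2) * (N E + N E)"
  proof -
    have "N (?T a (- b) + ?T (- a) b) \<le> N E + N E"
      using triangle [of "?T a (- b)" "?T (- a) b"] by (simp add: invariant unitary_phase)
    then show ?thesis using assms by (intro add_left_mono mult_left_mono) auto
  qed
  finally show ?thesis by (simp add: algebra_simps)
qed

text \<open>The limit of the cosine multipliers with frequency \<open>1/n\<close> and \<open>r = 2 (c n)\<^sup>2\<close>, as
  \<open>2 n\<^sup>2 (1 - cos (x/n)) \<rightarrow> x\<^sup>2\<close>.\<close>

lemma schur_quadratic_le: "N E \<le> N (schur (\<lambda>i j. 1 + (c * (a $ i - b $ j))\<^sup>2) E)"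
proof (rule tendsto_lowerbound)
  show "((\<lambda>n. N (schur (\<lambda>i j. 1 + 2 * c\<^sup>2 * (real (Suc n))\<^sup>2 *
      (1 - cos ((a $ i - b $ j) / real (Suc n)))) E)) \<longlongrightarrow> N (schur (\<lambda>i j. 1 + (c * (a $ i - b $ j))\<^sup>2) E)) sequentially"
    by (intro tendsto tendsto_schur tendsto_add tendsto_const tendsto_one_minus_cos)
  show "\<forall>\<^sub>F n in sequentially. N E \<le> N (schur (\<lambda>i j. 1 + 2 * c\<^sup>2 * (real (Suc n))\<^sup>2 *
      (1 - cos ((a $ i - b $ j) / real (Suc n)))) E)"
  proof (rule always_eventually, rule allI)
    fix n
    show "N E \<le> N (schur (\<lambda>i j. 1 + 2 * c\<^sup>2 * (real (Suc n))\<^sup>2 * (1 - cos ((a $ i - b $ j) / real (Suc n)))) E)"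
      using schur_cos_le [of "2 * c\<^sup>2 * (real (Suc n))\<^sup>2" E "(1 / real (Suc n)) *\<^sub>R a" "(1 / real (Suc n)) *\<^sub>R b"]
      by (simp add: diff_divide_distrib)
  qed
qed simp

text \<open>Euler's product \<open>sinh (x/2) = (x/2) \<Prod>\<^sub>k (1 + x\<^sup>2 / (2 \<pi> k)\<^sup>2)\<close> splits this multiplier into quadratic ones.\<close>

lemma schur_sinh_le:
  "N (schur (\<lambda>i j. a $ i - b $ j) W) \<le> N (schur (\<lambda>i j. 2 * sinh ((a $ i - b $ j) / 2)) W)"
proof (rule tendsto_lowerbound)
  let ?P = "\<lambda>m i j. \<Prod>k=1..m. 1 + (1 / (2 * pi * real k) * (a $ i - b $ j))\<^sup>2"
  show "((\<lambda>m. N (schur (\<lambda>i j. (a $ i - b $ j) * ?P m i j) W)) \<longlongrightarrow>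
      N (schur (\<lambda>i j. 2 * sinh ((a $ i - b $ j) / 2)) W)) sequentially"
    by (intro tendsto tendsto_schur sinh_product)
  have "N (schur (\<lambda>i j. a $ i - b $ j) W) \<le> N (schur (\<lambda>i j. (a $ i - b $ j) * ?P m i j) W)" for m
  proof (induction m)
    case (Suc m)
    note Suc.IH
    also have "N (schur (\<lambda>i j. (a $ i - b $ j) * ?P m i j) W)
        \<le> N (schur (\<lambda>i j. 1 + (1 / (2 * pi * real (Suc m)) * (a $ i - b $ j))\<^sup>2)
              (schur (\<lambda>i j. (a $ i - b $ j) * ?P m i j) W))"
      by (rule schur_quadratic_le)
    also have "\<dots> = N (schur (\<lambda>i j. (a $ i - b $ j) * ?P (Suc m) i j) W)"
      unfolding schur_schur prod.nat_ivl_Suc' [OF le_SucI, of 1]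
      by (intro arg_cong [of _ _ N] arg_cong2 [of _ _ _ _ schur] refl ext) (simp add: mult_ac)
    finally show ?case .
  qed simp
  then show "\<forall>\<^sub>F m in sequentially. N (schur (\<lambda>i j. a $ i - b $ j) W) \<le> N (schur (\<lambda>i j. (a $ i - b $ j) * ?P m i j) W)"
    by (intro always_eventually allI)
qed simp

text \<open>With pairwise different \<open>a\<^sub>i = b\<^sub>i\<close> the reciprocals of the quadratic multipliers kill everything off
  the diagonal as \<open>c \<rightarrow> \<infinity>\<close>.\<close>

lemma pinching:
  assumes "hermitian A"
  shows "N (diag_mat (\<chi> i. Re (A $ i $ i))) \<le> N A"
proof -
  obtain z0 :: "'n \<Rightarrow> nat" where z0: "inj z0"
    using finite_imp_inj_to_nat_seg [of "UNIV :: 'n set"] by auto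
  define z where "z = (\<chi> k. real (z0 k))"
  have z: "z $ i - z $ j \<noteq> 0" if "i \<noteq> j" for i j using z0 that by (auto simp: z_def inj_eq)
  define m where "m n i j = 1 / (1 + (real n * (z $ i - z $ j))\<^sup>2)" for n i j
  have lim: "(\<lambda>n. m n i j) \<longlonglongrightarrow> (if i = j then 1 else 0)" for i j
  proof (cases "i = j")
    case True then show ?thesis by (simp add: m_def)
  next
    case False
    have "filterlim (\<lambda>n. 1 + (real n * (z $ i - z $ j))\<^sup>2) at_top sequentially"
      unfolding power_mult_distrib
      by (intro filterlim_tendsto_add_at_top tendsto_const filterlim_at_top_mult_tendsto_pos [OF tendsto_const]
          filterlim_pow_at_top filterlim_real_sequentially) (use z [OF False] in auto)
    then show ?thesis
      using False by (simp add: m_def tendsto_divide_0 [OF tendsto_const filterlim_at_top_imp_at_infinity])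
  qed
  have le: "N (schur (m n) A) \<le> N A" for n
  proof -
    have "schur (\<lambda>i j. 1 + (real n * (z $ i - z $ j))\<^sup>2) (schur (m n) A) = A"
    proof -
      have "1 + (real n * (z $ i - z $ j))\<^sup>2 \<noteq> 0" for i j
        by (metis add_cancel_right_right le_add_same_cancel1 less_numeral_extra(1) not_one_le_zero order_antisym zero_le_power2)
      then have "(1 + (real n * (z $ i - z $ j))\<^sup>2) * m n i j = 1" for i j
        by (simp add: m_def)
      then show ?thesis unfolding schur_schur by (simp add: schur_def vec_eq_iff)
    qed
    then show ?thesis using schur_quadratic_le [of "schur (m n) A" "real n" z z] by simp
  qed
  have "diag_mat (\<chi> i. Re (A $ i $ i)) = schur (\<lambda>i j. if i = j then 1 else 0) A"
  proof -
    have "of_real (Re (A $ i $ i)) = A $ i $ i" for i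
      using hermitian_nth [OF assms, of i i] by (simp add: complex_eq_iff)
    then show ?thesis by (simp add: vec_eq_iff diag_mat_nth schur_def)
  qed
  moreover have "N (schur (\<lambda>i j. if i = j then 1 else 0) A) \<le> N A"
    by (rule tendsto_upperbound [OF tendsto [OF tendsto_schur [of m, OF lim]]]) (use le in auto)
  ultimately show ?thesis by simp
qed

text \<open>A diagonal contraction \<open>diag(cos \<phi>)\<close> is the average of the unitaries \<open>diag(e\<^sup>\<plusminus>\<^sup>i\<^sup>\<phi>)\<close>.\<close>

lemma diag_mono:
  assumes "\<And>i. 0 \<le> u $ i" "\<And>i. u $ i \<le> v $ i"
  shows "N (diag_mat u) \<le> N (diag_mat v)"
proof -
  define t where "t = (\<chi> i. arccos (u $ i / v $ i))"
  have c: "cos (t $ i) * v $ i = u $ i" for i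
  proof (cases "v $ i = 0")
    case True then show ?thesis using assms [of i] by simp
  next
    case False
    then have "0 \<le> u $ i / v $ i" "u $ i / v $ i \<le> 1"
      using assms [of i] by (auto simp: divide_le_eq_1)
    then have "cos (t $ i) = u $ i / v $ i" by (simp add: t_def)
    then show ?thesis using False by simp
  qed
  have eq: "2 *\<^sub>R diag_mat u = phase_mat t ** diag_mat v + phase_mat (- t) ** diag_mat v"
  proof (simp only: vec_eq_iff, intro allI)
    fix i j
    show "(2 *\<^sub>R diag_mat u) $ i $ j = (phase_mat t ** diag_mat v + phase_mat (- t) ** diag_mat v) $ i $ j"
      using c [of i] by (cases "i = j") (simp_all add: phase_mul_nth diag_mat_nth complex_eq_iff)
  qed
  have "2 * N (diag_mat u) = N (2 *\<^sub>R diag_mat u)" by (simp add: scale)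
  also have "\<dots> \<le> N (diag_mat v) + N (diag_mat v)"
    unfolding eq using triangle [of "phase_mat t ** diag_mat v" "phase_mat (- t) ** diag_mat v"]
    by (simp add: left_invariant unitary_phase)
  finally show ?thesis by simp
qed

lemma diag_spectral: "unitary U \<Longrightarrow> N (spectral_mat U d) = N (diag_mat d)"
  by (simp add: spectral_mat_def conj_invariant)

end

section \<open>The exponential metric increasing property\<close>

lemma tendsto_mat_fun:
  assumes "A \<in> hermitian_on S" "\<And>x. x \<in> S \<Longrightarrow> ((\<lambda>m. g m x) \<longlongrightarrow> h x) F"
  shows "((\<lambda>m. mat_fun (g m) A) \<longlongrightarrow> mat_fun h A) F"
proof -
  obtain U d where U: "unitary U" and A: "A = spectral_mat U d" and d: "\<And>i. d $ i \<in> S"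
    using hermitian_onE [OF assms(1)] by blast
  have "((\<lambda>m. \<chi> i. g m (d $ i)) \<longlongrightarrow> (\<chi> i. h (d $ i))) F"
    by (intro vec_tendstoI) (simp add: assms(2) d)
  then have "((\<lambda>m. diag_mat (\<chi> i. g m (d $ i))) \<longlongrightarrow> diag_mat (\<chi> i. h (d $ i))) F"
    by (rule bounded_linear.tendsto [OF bounded_linear_diag])
  moreover have "mat_fun f A = U ** diag_mat (\<chi> i. f (d $ i)) ** adjoint_mat U" for f
    unfolding A mat_fun_spectral [OF U] by (simp only: spectral_mat_def)
  ultimately show ?thesis by (simp only: matmul.tendsto tendsto_const)
qed

text \<open>In the eigenbases of \<open>A\<close> and \<open>B\<close> the matrix \<open>log A - log B\<close> becomes \<open>((a\<^sub>i - b\<^sub>j) W\<^sub>i\<^sub>j)\<close>, and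
  \<open>A\<^sup>1\<^sup>/\<^sup>2 B\<^sup>-\<^sup>1\<^sup>/\<^sup>2 - A\<^sup>-\<^sup>1\<^sup>/\<^sup>2 B\<^sup>1\<^sup>/\<^sup>2\<close> becomes \<open>(2 sinh ((a\<^sub>i - b\<^sub>j)/2) W\<^sub>i\<^sub>j)\<close>, where \<open>a\<close> and \<open>b\<close> are the
  logarithms of the eigenvalues. The polar decomposition of \<open>A\<^sup>1\<^sup>/\<^sup>2 B\<^sup>-\<^sup>1\<^sup>/\<^sup>2\<close> identifies the norm of the second.\<close>

lemma (in ui_seminorm) log_diff_le_sinh:
  assumes A: "A \<in> pd_matrices" and B: "B \<in> pd_matrices"
  shows "N (mat_fun ln A - mat_fun ln B)
      \<le> N (mat_fun (\<lambda>x. x powr (1 / 2) - x powr (- 1 / 2)) (inv_root_mat B ** A ** inv_root_mat B))"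
proof -
  obtain U d where U: "unitary U" and Ad: "A = spectral_mat U d" and d: "\<And>i. d $ i > 0"
    using hermitian_onE [OF A [unfolded pd_iff]] by auto
  obtain V e where V: "unitary V" and Be: "B = spectral_mat V e" and e: "\<And>i. e $ i > 0"
    using hermitian_onE [OF B [unfolded pd_iff]] by auto
  define W where "W = adjoint_mat U ** V"
  define R where "R = root_mat A ** inv_root_mat B"
  define C where "C = inv_root_mat B ** A ** inv_root_mat B"
  have C: "C \<in> pd_matrices" unfolding C_def by (rule pd_inv_root_conj [OF B A])
  have mixed: "adjoint_mat U ** (spectral_mat U x ** spectral_mat V y) ** V = diag_mat x ** W ** diag_mat y" for x y
    unfolding spectral_mat_def W_def by (simp add: matrix_mul_assoc unitaryD U V unitary_cancel)
  have log: "adjoint_mat U ** (mat_fun ln A - mat_fun ln B) ** V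
      = schur (\<lambda>i j. (\<chi> i. ln (d $ i)) $ i - (\<chi> j. ln (e $ j)) $ j) W"
  proof -
    have "mat_fun ln A = spectral_mat U (\<chi> i. ln (d $ i)) ** spectral_mat V (\<chi> i. 1)"
      "mat_fun ln B = spectral_mat U (\<chi> i. 1) ** spectral_mat V (\<chi> i. ln (e $ i))"
      by (simp_all add: Ad Be mat_fun_spectral U V spectral_const)
    then have "adjoint_mat U ** (mat_fun ln A - mat_fun ln B) ** V
        = diag_mat (\<chi> i. ln (d $ i)) ** W ** diag_mat (\<chi> i. 1) - diag_mat (\<chi> i. 1) ** W ** diag_mat (\<chi> i. ln (e $ i))"
      by (simp only: matmul.diff_left matmul.diff_right mixed)
    then show ?thesis by (simp add: vec_eq_iff diag_mul_nth mul_diag_nth schur_def algebra_simps)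
  qed
  have sinh: "adjoint_mat U ** (R - inv_root_mat A ** root_mat B) ** V
      = schur (\<lambda>i j. 2 * sinh (((\<chi> i. ln (d $ i)) $ i - (\<chi> j. ln (e $ j)) $ j) / 2)) W"
  proof -
    have "adjoint_mat U ** (R - inv_root_mat A ** root_mat B) ** V
        = diag_mat (\<chi> i. d $ i powr (1 / 2)) ** W ** diag_mat (\<chi> i. e $ i powr (- 1 / 2))
          - diag_mat (\<chi> i. d $ i powr (- 1 / 2)) ** W ** diag_mat (\<chi> i. e $ i powr (1 / 2))"
      by (simp add: R_def Ad Be root_mat_def inv_root_mat_def mat_fun_spectral U V matmul.diff_left matmul.diff_right mixed)
    moreover have "2 * sinh ((ln (d $ i) - ln (e $ j)) / 2)
        = d $ i powr (1 / 2) * e $ j powr (- 1 / 2) - d $ i powr (- 1 / 2) * e $ j powr (1 / 2)" for i j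
      using d [of i] e [of j] by (simp add: sinh_field_def powr_def exp_add [symmetric] diff_divide_distrib)
    ultimately show ?thesis
      by (simp only: vec_eq_iff schur_def vec_lambda_beta of_real_diff of_real_mult
          vector_minus_component diag_mul_nth mul_diag_nth left_diff_distrib mult_ac)
        (simp add: right_diff_distrib)
  qed
  \<comment> \<open>The polar decomposition is \<open>R = Q C\<^sup>1\<^sup>/\<^sup>2\<close>; inverting its adjoint gives \<open>A\<^sup>-\<^sup>1\<^sup>/\<^sup>2 B\<^sup>1\<^sup>/\<^sup>2 = Q C\<^sup>-\<^sup>1\<^sup>/\<^sup>2\<close> with the same \<open>Q\<close>.\<close>
  define Q where "Q = R ** inv_root_mat C"
  have RR: "adjoint_mat R ** R = C"
  proof -
    have "adjoint_mat R ** R = inv_root_mat B ** (root_mat A ** root_mat A) ** inv_root_mat B"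
      by (simp add: R_def A B matrix_mul_assoc)
    then show ?thesis by (simp only: C_def root_mul_root [OF A])
  qed
  have Q: "unitary Q"
  proof (rule unitary_if_isometry)
    have "adjoint_mat Q ** Q = inv_root_mat C ** (adjoint_mat R ** R) ** inv_root_mat C"
      by (simp add: Q_def C matrix_mul_assoc)
    then show "adjoint_mat Q ** Q = mat 1" by (simp add: RR inv_root_conj_self C)
  qed
  have QC: "Q ** root_mat C = R"
    by (simp add: Q_def inv_root_root_cancel C)
  have QC': "Q ** inv_root_mat C = inv_root_mat A ** root_mat B"
  proof -
    have "C = inv_root_mat B ** (root_mat A ** root_mat A) ** inv_root_mat B" by (simp only: C_def root_mul_root [OF A])
    then have "C ** (root_mat B ** inv_root_mat A ** inv_root_mat A ** root_mat B) = mat 1"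
      by (simp add: matrix_mul_assoc inv_root_root_cancel A B)
    then have "inv_root_mat C ** inv_root_mat C ** C ** (root_mat B ** inv_root_mat A ** inv_root_mat A ** root_mat B)
        = inv_root_mat C ** inv_root_mat C"
      by (simp only: matrix_mul_assoc [symmetric] matrix_mul_rid)
    moreover have "inv_root_mat C ** inv_root_mat C ** C = mat 1"
    proof -
      have "inv_root_mat C ** inv_root_mat C ** (root_mat C ** root_mat C) = mat 1"
        by (simp add: matrix_mul_assoc inv_root_root_cancel C)
      then show ?thesis by (simp only: root_mul_root [OF C])
    qed
    ultimately have "inv_root_mat C ** inv_root_mat C = root_mat B ** inv_root_mat A ** inv_root_mat A ** root_mat B"
      by simp
    then have "Q ** inv_root_mat C = R ** (root_mat B ** inv_root_mat A ** inv_root_mat A ** root_mat B)"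
      by (simp add: Q_def matrix_mul_assoc [symmetric])
    then show ?thesis by (simp add: R_def matrix_mul_assoc inv_root_root_cancel A B)
  qed
  have "mat_fun (\<lambda>x. x powr (1 / 2) - x powr (- 1 / 2)) C = root_mat C - inv_root_mat C"
    using mat_fun_add [OF pd_hermitian [OF C], of "\<lambda>x. x powr (1 / 2) - x powr (- 1 / 2)" "\<lambda>x. x powr (- 1 / 2)"]
    by (simp add: root_mat_def inv_root_mat_def algebra_simps)
  then have "N (mat_fun (\<lambda>x. x powr (1 / 2) - x powr (- 1 / 2)) C) = N (R - inv_root_mat A ** root_mat B)"
    using left_invariant [OF Q, of "root_mat C - inv_root_mat C"] by (simp add: matmul.diff_right QC QC')
  also have "\<dots> = N (schur (\<lambda>i j. 2 * sinh (((\<chi> i. ln (d $ i)) $ i - (\<chi> j. ln (e $ j)) $ j) / 2)) W)"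
    unfolding sinh [symmetric] by (simp only: invariant unitary_adjoint U V)
  also have "\<dots> \<ge> N (schur (\<lambda>i j. (\<chi> i. ln (d $ i)) $ i - (\<chi> j. ln (e $ j)) $ j) W)"
    by (rule schur_sinh_le)
  also have "N (schur (\<lambda>i j. (\<chi> i. ln (d $ i)) $ i - (\<chi> j. ln (e $ j)) $ j) W) = N (mat_fun ln A - mat_fun ln B)"
    unfolding log [symmetric] by (simp only: invariant unitary_adjoint U V)
  finally show ?thesis by (simp add: C_def)
qed

lemma tendsto_scaled_powr_diff:
  assumes "x > 0"
  shows "(\<lambda>m. real (Suc m) * (x powr (1 / (2 * real (Suc m))) - x powr (- 1 / (2 * real (Suc m))))) \<longlonglongrightarrow> ln x"
proof -
  have "((\<lambda>h. exp (h * ln x / 2) - exp (- h * ln x / 2)) has_real_derivative ln x) (at 0)"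
    by (auto intro!: derivative_eq_intros)
  then have "((\<lambda>h. (exp (h * ln x / 2) - exp (- h * ln x / 2)) / h) \<longlongrightarrow> ln x) (at 0)"
    by (simp add: has_field_derivative_iff)
  moreover have "filterlim (\<lambda>m. 1 / real (Suc m)) (at 0) sequentially"
    using LIMSEQ_Suc [OF lim_1_over_n] by (auto simp: filterlim_at)
  ultimately have "(\<lambda>m. (exp (1 / real (Suc m) * ln x / 2) - exp (- (1 / real (Suc m)) * ln x / 2)) / (1 / real (Suc m))) \<longlonglongrightarrow> ln x"
    by (rule filterlim_compose)
  moreover have "(exp (1 / real (Suc m) * ln x / 2) - exp (- (1 / real (Suc m)) * ln x / 2)) / (1 / real (Suc m))
      = real (Suc m) * (x powr (1 / (2 * real (Suc m))) - x powr (- 1 / (2 * real (Suc m))))" for m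
    using assms by (simp add: powr_def mult.commute)
  ultimately show ?thesis by (simp only:)
qed

text \<open>With \<open>C = B\<^sup>-\<^sup>1\<^sup>/\<^sup>2 A B\<^sup>-\<^sup>1\<^sup>/\<^sup>2\<close>, cutting the geodesic \<open>B\<^sup>1\<^sup>/\<^sup>2 C\<^sup>t B\<^sup>1\<^sup>/\<^sup>2\<close> from \<open>B\<close> to \<open>A\<close> into \<open>m\<close> congruent pieces turns the hyperbolic sine of
  the preceding bound into \<open>2 m sinh (\<sqdot> / (2 m))\<close>, which tends to the identity.\<close>

theorem (in ui_seminorm) log_diff_le:
  assumes A: "A \<in> pd_matrices" and B: "B \<in> pd_matrices"
  shows "N (mat_fun ln A - mat_fun ln B) \<le> N (mat_fun ln (inv_root_mat B ** A ** inv_root_mat B))"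
proof -
  define C where "C = inv_root_mat B ** A ** inv_root_mat B"
  have C: "C \<in> pd_matrices" unfolding C_def by (rule pd_inv_root_conj [OF B A])
  define P where "P t = mat_fun (\<lambda>x. x powr t) C" for t
  have P0: "P 0 = mat 1" and P1: "P 1 = C"
    using mat_fun_cong [of C "{0<..}" "\<lambda>x. x powr 0" "\<lambda>x. 1"] mat_fun_cong [of C "{0<..}" "\<lambda>x. x powr 1" "\<lambda>x. x"]
      C pd_hermitian [OF C] by (auto simp: P_def pd_iff mat_fun_const mat_fun_ident)
  have PP: "P s ** P t = P (s + t)" for s t
    unfolding P_def using pd_mat_fun_mul_eq [OF C] by (simp add: powr_add)
  have adjP: "adjoint_mat (P t) = P t" for t
    using hermitian_mat_fun [OF pd_hermitian [OF C]] by (simp add: P_def hermitian_def)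
  have bound: "N (mat_fun ln A - mat_fun ln B)
      \<le> N (mat_fun (\<lambda>x. real (Suc m) * (x powr (1 / (2 * real (Suc m))) - x powr (- 1 / (2 * real (Suc m))))) C)" for m
  proof -
    define M where "M = real (Suc m)"
    have M: "M > 0" by (simp add: M_def)
    \<comment> \<open>\<open>G k = S k (S k)\<^sup>*\<close> is the point at time \<open>k/M\<close>, and \<open>S k\<close> carries the step from \<open>I\<close> to \<open>C\<^sup>1\<^sup>/\<^sup>M\<close> to the step from \<open>G k\<close>.\<close>
    define S where "S k = root_mat B ** P (real k / (2 * M))" for k
    define T where "T k = P (- (real k / (2 * M))) ** inv_root_mat B" for k
    define G where "G k = S k ** adjoint_mat (S k)" for k
    let ?psi = "\<lambda>x. x powr (1 / 2) - x powr (- 1 / 2) :: real"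
    have ST: "S k ** T k = mat 1" for k
    proof -
      have "S k ** T k = root_mat B ** (P (real k / (2 * M)) ** P (- (real k / (2 * M)))) ** inv_root_mat B"
        by (simp add: S_def T_def matrix_mul_assoc)
      then show ?thesis using P0 B by (simp add: PP)
    qed
    have G: "G k \<in> pd_matrices" for k using pd_congruence [OF pd_one ST, of k] by (simp add: G_def)
    have G_eq: "G k = root_mat B ** P (real k / M) ** root_mat B" for k
    proof -
      have "G k = root_mat B ** (P (real k / (2 * M)) ** P (real k / (2 * M))) ** root_mat B"
        by (simp add: G_def S_def adjP B matrix_mul_assoc)
      moreover have "real k / (2 * M) + real k / (2 * M) = real k / M" by (simp add: field_simps)
      ultimately show ?thesis by (simp add: PP)
    qed
    have step: "N (mat_fun ln (G (Suc k)) - mat_fun ln (G k)) \<le> N (mat_fun ?psi (P (1 / M)))" for k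
    proof -
      obtain Q where Q: "unitary Q" and eq: "\<And>Y. inv_root_mat (G k) ** Y ** inv_root_mat (G k)
          = Q ** (T k ** Y ** adjoint_mat (T k)) ** adjoint_mat Q"
        using inv_root_conj_factor [OF ST [of k]] unfolding G_def by blast
      have "T k ** G (Suc k) ** adjoint_mat (T k)
          = P (- (real k / (2 * M))) ** P (real (Suc k) / M) ** P (- (real k / (2 * M)))"
        by (simp add: T_def G_eq adjP B matrix_mul_assoc inv_root_root_cancel)
      also have "\<dots> = P (1 / M)" using M by (simp add: PP field_simps)
      finally have "inv_root_mat (G k) ** G (Suc k) ** inv_root_mat (G k) = Q ** P (1 / M) ** adjoint_mat Q"
        by (simp add: eq)
      then have "N (mat_fun ?psi (inv_root_mat (G k) ** G (Suc k) ** inv_root_mat (G k))) = N (mat_fun ?psi (P (1 / M)))"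
        using Q C by (simp add: mat_fun_unitary conj_invariant P_def hermitian_mat_fun pd_hermitian)
      with log_diff_le_sinh [OF G G, of "Suc k" k] show ?thesis by simp
    qed
    have "G 0 = B" using B by (simp add: G_eq P0 root_mul_root)
    moreover have "G (Suc m) = A"
    proof -
      have "G (Suc m) = root_mat B ** C ** root_mat B" using M by (simp add: G_eq M_def P1)
      then show ?thesis by (simp add: C_def matrix_mul_assoc inv_root_root_cancel B)
    qed
    ultimately have "mat_fun ln A - mat_fun ln B = (\<Sum>k<Suc m. mat_fun ln (G (Suc k)) - mat_fun ln (G k))"
      using sum_lessThan_telescope [of "\<lambda>k. mat_fun ln (G k)" "Suc m"] by (simp only:)
    also have "N \<dots> \<le> (\<Sum>k<Suc m. N (mat_fun ?psi (P (1 / M))))"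
      by (rule order_trans [OF sum_le]) (intro sum_mono step)
    also have "\<dots> = N (M *\<^sub>R mat_fun ?psi (P (1 / M)))"
      using M by (simp add: scale M_def)
    also have "M *\<^sub>R mat_fun ?psi (P (1 / M)) = mat_fun (\<lambda>x. M * (x powr (1 / (2 * M)) - x powr (- 1 / (2 * M)))) C"
      using C by (simp add: P_def mat_fun_comp pd_hermitian mat_fun_scaleR powr_powr mult.commute [of M 2])
    finally show ?thesis by (simp only: M_def)
  qed
  have "(\<lambda>m. N (mat_fun (\<lambda>x. real (Suc m) * (x powr (1 / (2 * real (Suc m))) - x powr (- 1 / (2 * real (Suc m))))) C))
      \<longlonglongrightarrow> N (mat_fun ln C)"
    using C unfolding pd_iff by (intro tendsto tendsto_mat_fun [of C "{0<..}"] tendsto_scaled_powr_diff) auto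
  then have "N (mat_fun ln A - mat_fun ln B) \<le> N (mat_fun ln C)"
    by (rule tendsto_lowerbound) (use bound in auto)
  then show ?thesis by (simp add: C_def)
qed

section \<open>Majorization as membership in the convex hull of a unitary orbit\<close>

text \<open>That \<open>X\<close> lies in this set expresses that the eigenvalues of \<open>X\<close> are majorized by those of \<open>L\<close>. In this form
  no eigenvalue has to be sorted, and convex functions and norms can be estimated directly.\<close>

definition unitary_hull :: "complex^'n^'n \<Rightarrow> (complex^'n^'n) set" where
  "unitary_hull L = convex hull ((\<lambda>U. U ** L ** adjoint_mat U) ` {U. unitary U})"

text \<open>A unitarily invariant form of the functional \<open>T \<mapsto> Z \<bullet> T\<close>.\<close>

definition orbit_support :: "complex^'n^'n \<Rightarrow> complex^'n^'n \<Rightarrow> real" where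
  "orbit_support Z T = (SUP p\<in>{U. unitary U} \<times> {V. unitary V}. Z \<bullet> (fst p ** T ** snd p))"

lemma orbit_support_upper:
  fixes U V Z T :: "complex^'n^'n"
  assumes "unitary U" "unitary V"
  shows "Z \<bullet> (U ** T ** V) \<le> orbit_support Z T"
proof -
  have "bdd_above ((\<lambda>p. Z \<bullet> (fst p ** T ** snd p)) ` ({U. unitary U} \<times> {V. unitary V}))"
  proof (rule bdd_aboveI2)
    fix p assume "p \<in> {U :: complex^'n^'n. unitary U} \<times> {V :: complex^'n^'n. unitary V}"
    then have "norm (fst p ** T ** snd p) = norm T" by (intro norm_unitary) auto
    then show "Z \<bullet> (fst p ** T ** snd p) \<le> norm Z * norm T"
      using norm_cauchy_schwarz [of Z "fst p ** T ** snd p"] by simp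
  qed
  then show ?thesis
    unfolding orbit_support_def using assms by (intro cSUP_upper2 [where x = "(U, V)"]) auto
qed

lemma orbit_support_least:
  fixes Z T :: "complex^'n^'n"
  assumes "\<And>U V. unitary U \<Longrightarrow> unitary V \<Longrightarrow> Z \<bullet> (U ** T ** V) \<le> b"
  shows "orbit_support Z T \<le> b"
proof -
  have "(mat 1, mat 1) \<in> {U :: complex^'n^'n. unitary U} \<times> {V :: complex^'n^'n. unitary V}" by simp
  then have "{U :: complex^'n^'n. unitary U} \<times> {V :: complex^'n^'n. unitary V} \<noteq> {}" by blast
  then show ?thesis unfolding orbit_support_def using assms by (intro cSUP_least) auto
qed

lemma ui_seminorm_orbit_support: "ui_seminorm (orbit_support Z)" for Z :: "complex^'n^'n"
proof
  fix A B :: "complex^'n^'n"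
  show "orbit_support Z (A + B) \<le> orbit_support Z A + orbit_support Z B"
    by (rule orbit_support_least)
      (simp add: matmul.add_left matmul.add_right inner_add_right add_mono orbit_support_upper)
next
  have le: "orbit_support Z (c *\<^sub>R A) \<le> \<bar>c\<bar> * orbit_support Z A" for c and A :: "complex^'n^'n"
  proof (rule orbit_support_least)
    fix U V :: "complex^'n^'n" assume U: "unitary U" and V: "unitary V"
    have "unitary (- U)"
      using U by (intro unitary_if_isometry)
        (simp add: unitaryD matmul.minus_left matmul.minus_right bounded_linear_adjoint linear_neg bounded_linear.linear)
    then have "Z \<bullet> (- U ** A ** V) \<le> orbit_support Z A" by (intro orbit_support_upper V)
    moreover have "Z \<bullet> (U ** A ** V) \<le> orbit_support Z A" by (intro orbit_support_upper U V)
    ultimately have "\<bar>Z \<bullet> (U ** A ** V)\<bar> \<le> orbit_support Z A"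
      by (simp add: matmul.minus_left)
    then have "\<bar>c\<bar> * \<bar>Z \<bullet> (U ** A ** V)\<bar> \<le> \<bar>c\<bar> * orbit_support Z A" by (rule mult_left_mono) simp
    then show "Z \<bullet> (U ** (c *\<^sub>R A) ** V) \<le> \<bar>c\<bar> * orbit_support Z A"
      by (simp add: matmul.scaleR_left matmul.scaleR_right flip: abs_mult)
  qed
  fix c and A :: "complex^'n^'n"
  show "orbit_support Z (c *\<^sub>R A) = \<bar>c\<bar> * orbit_support Z A"
  proof (cases "c = 0")
    case True
    have "0 = Z \<bullet> (mat 1 ** 0 ** mat 1)" by simp
    also have "\<dots> \<le> orbit_support Z 0" by (intro orbit_support_upper) auto
    finally show ?thesis using le [of 0 A] True by simp
  next
    case False
    have "orbit_support Z A \<le> \<bar>1 / c\<bar> * orbit_support Z (c *\<^sub>R A)"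
      using le [of "1 / c" "c *\<^sub>R A"] False by simp
    then have "\<bar>c\<bar> * orbit_support Z A \<le> orbit_support Z (c *\<^sub>R A)"
      using False by (simp add: field_simps abs_divide)
    then show ?thesis using le [of c A] by simp
  qed
next
  have le: "orbit_support Z (U ** A ** V) \<le> orbit_support Z A" if "unitary U" "unitary V" for U V A :: "complex^'n^'n"
  proof (rule orbit_support_least)
    fix P Q :: "complex^'n^'n" assume "unitary P" "unitary Q"
    then have "Z \<bullet> ((P ** U) ** A ** (V ** Q)) \<le> orbit_support Z A"
      using that by (intro orbit_support_upper unitary_mul)
    then show "Z \<bullet> (P ** (U ** A ** V) ** Q) \<le> orbit_support Z A" by (simp add: matrix_mul_assoc)
  qed
  fix U V A :: "complex^'n^'n" assume U: "unitary U" and V: "unitary V"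
  have "orbit_support Z (adjoint_mat U ** (U ** A ** V) ** adjoint_mat V) \<le> orbit_support Z (U ** A ** V)"
    by (intro le) (simp_all add: U V)
  then have "orbit_support Z A \<le> orbit_support Z (U ** A ** V)"
    by (simp add: matrix_mul_assoc unitaryD unitary_cancel U V)
  with le [OF U V, of A] show "orbit_support Z (U ** A ** V) = orbit_support Z A" by simp
qed

text \<open>For positive \<open>Z = S\<^sup>2\<close> and \<open>Y = R\<^sup>2\<close> two different unitaries are no better than a unitary and its
  adjoint: \<open>Z \<bullet> (U Y V) = (S V\<^sup>* R) \<bullet> (S U R)\<close>, and the squared norms of the two factors are
  \<open>Z \<bullet> (V\<^sup>* Y V)\<close> and \<open>Z \<bullet> (U Y U\<^sup>*)\<close>.\<close>

lemma orbit_support_square_le: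
  fixes S R :: "complex^'n^'n"
  assumes S: "hermitian S" and R: "hermitian R"
    and le: "\<And>U. unitary U \<Longrightarrow> (S ** S) \<bullet> (U ** (R ** R) ** adjoint_mat U) \<le> b"
  shows "orbit_support (S ** S) (R ** R) \<le> b"
proof (rule orbit_support_least)
  have adj: "adjoint_mat S = S" "adjoint_mat R = R" using S R by (simp_all add: hermitian_def)
  have sq: "(norm (S ** U ** R))\<^sup>2 \<le> b" if "unitary U" for U
  proof -
    have "(norm (S ** U ** R))\<^sup>2 = (S ** U ** R) \<bullet> (S ** U ** R)" by (simp add: power2_norm_eq_inner)
    also have "\<dots> = (S ** (U ** R)) \<bullet> (S ** U ** R)" by (simp add: matrix_mul_assoc)
    also have "\<dots> = (U ** R) \<bullet> (S ** S ** U ** R)" by (subst inner_mul_left) (simp add: adj matrix_mul_assoc)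
    also have "\<dots> = (S ** S ** (U ** R)) \<bullet> (U ** R)" by (simp add: inner_commute matrix_mul_assoc)
    also have "\<dots> = (S ** S) \<bullet> (U ** R ** adjoint_mat (U ** R))" by (rule inner_mul_right)
    also have "\<dots> = (S ** S) \<bullet> (U ** (R ** R) ** adjoint_mat U)" by (simp add: adj matrix_mul_assoc)
    also have "\<dots> \<le> b" by (rule le [OF that])
    finally show ?thesis .
  qed
  fix U V :: "complex^'n^'n" assume U: "unitary U" and V: "unitary V"
  have b: "0 \<le> b" using sq [OF U] by (meson order_trans zero_le_power2)
  have "(S ** S) \<bullet> (U ** (R ** R) ** V) = S \<bullet> (S ** U ** R ** (R ** V))"
    by (subst inner_mul_left) (simp add: adj matrix_mul_assoc)
  also have "\<dots> = (S ** adjoint_mat V ** R) \<bullet> (S ** U ** R)"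
    using inner_mul_right [of S "adjoint_mat (R ** V)" "S ** U ** R"] by (simp add: adj matrix_mul_assoc)
  also have "\<dots> \<le> norm (S ** adjoint_mat V ** R) * norm (S ** U ** R)" by (rule norm_cauchy_schwarz)
  also have "\<dots> \<le> sqrt b * sqrt b"
    using sq [of "adjoint_mat V"] sq [of U] U V b by (intro mult_mono real_le_rsqrt) auto
  also have "\<dots> = b" using b by simp
  finally show "(S ** S) \<bullet> (U ** (R ** R) ** V) \<le> b" .
qed

lemma hermitian_shift_square:
  fixes L :: "complex^'n^'n"
  assumes "hermitian L"
  obtains c0 where "\<And>c. c \<ge> c0 \<Longrightarrow> \<exists>R. hermitian R \<and> R ** R = L + c *\<^sub>R mat 1"
proof -
  obtain V d where V: "unitary V" and L: "L = spectral_mat V d"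
    using hermitian_diagonalizable [OF assms] by blast
  have "\<exists>R. hermitian R \<and> R ** R = L + c *\<^sub>R mat 1" if c: "c \<ge> (\<Sum>i\<in>UNIV. \<bar>d $ i\<bar>)" for c
  proof (intro exI conjI)
    have "\<bar>d $ i\<bar> \<le> (\<Sum>i\<in>UNIV. \<bar>d $ i\<bar>)" for i by (rule member_le_sum) auto
    then have "0 \<le> d $ i + c" for i using c by (smt (verit))
    then have "spectral_mat V (\<chi> i. sqrt (d $ i + c)) ** spectral_mat V (\<chi> i. sqrt (d $ i + c))
        = spectral_mat V (d + (\<chi> i. c))"
      by (simp add: spectral_mul V) (rule arg_cong [of _ _ "spectral_mat V"], simp add: vec_eq_iff)
    also have "\<dots> = L + c *\<^sub>R mat 1" by (simp add: L spectral_const [OF V] flip: spectral_add)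
    finally show "spectral_mat V (\<chi> i. sqrt (d $ i + c)) ** spectral_mat V (\<chi> i. sqrt (d $ i + c)) = L + c *\<^sub>R mat 1" .
    show "hermitian (spectral_mat V (\<chi> i. sqrt (d $ i + c)))" by simp
  qed
  then show ?thesis by (rule that)
qed

lemma compact_unitary_hull: "compact (unitary_hull L)"
  unfolding unitary_hull_def
  by (intro compact_convex_hull compact_continuous_image compact_unitary matmul.continuous_on
      continuous_on_adjoint continuous_on_id continuous_on_const)

text \<open>A Hermitian \<open>Z\<close> that separates \<open>X\<close> from the orbit of \<open>L\<close> may be shifted by a multiple of the identity,
  because \<open>X\<close> and \<open>L\<close> have the same trace, and so may be taken positive definite. Then the seminorm
  \<open>orbit_support Z\<close>, evaluated at shifts of \<open>X\<close> and \<open>L\<close>, violates the hypothesis.\<close>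

theorem in_unitary_hull_if_seminorms_le:
  fixes X L :: "complex^'n^'n"
  assumes X: "hermitian X" and L: "hermitian L"
    and le: "\<And>N c. ui_seminorm N \<Longrightarrow> N (X + c *\<^sub>R mat 1) \<le> N (L + c *\<^sub>R mat 1)"
  shows "X \<in> unitary_hull L"
proof (rule ccontr)
  assume notin: "X \<notin> unitary_hull L"
  let ?I = "mat 1 :: complex^'n^'n"
  have II: "?I ** ?I = ?I" "hermitian ?I" by (simp_all add: hermitian_def)
  have support_le: "Z \<bullet> X \<le> b"
    if pos: "hermitian S" "Z = S ** S" and b: "\<And>U. unitary U \<Longrightarrow> Z \<bullet> (U ** L ** adjoint_mat U) \<le> b"
      and X: "hermitian X" and L: "hermitian L"
      and le: "\<And>N c. ui_seminorm N \<Longrightarrow> N (X + c *\<^sub>R mat 1) \<le> N (L + c *\<^sub>R mat 1)"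
    for S Z X L :: "complex^'n^'n" and b
  proof -
    obtain c R where R: "hermitian R" and RR: "R ** R = L + c *\<^sub>R ?I"
      using hermitian_shift_square [OF L] by (metis order_refl)
    have "Z \<bullet> (X + c *\<^sub>R ?I) \<le> orbit_support Z (X + c *\<^sub>R ?I)"
      using orbit_support_upper [of ?I ?I Z "X + c *\<^sub>R ?I"] by simp
    also have "\<dots> \<le> orbit_support Z (L + c *\<^sub>R ?I)" by (rule le [OF ui_seminorm_orbit_support])
    also have "\<dots> \<le> b + c * (Z \<bullet> ?I)"
      unfolding RR [symmetric] pos(2)
    proof (rule orbit_support_square_le [OF pos(1) R])
      fix U :: "complex^'n^'n" assume U: "unitary U"
      then have "U ** (R ** R) ** adjoint_mat U = U ** L ** adjoint_mat U + c *\<^sub>R ?I"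
        by (simp add: RR matmul.add_left matmul.add_right matmul.scaleR_left matmul.scaleR_right unitaryD)
      then show "(S ** S) \<bullet> (U ** (R ** R) ** adjoint_mat U) \<le> b + c * ((S ** S) \<bullet> ?I)"
        using b [OF U] by (simp add: pos(2) inner_add_right)
    qed
    finally show ?thesis by (simp add: inner_add_right)
  qed
  have conj_I: "?I \<bullet> (U ** Y ** adjoint_mat U) = ?I \<bullet> Y" if "unitary U" for U Y :: "complex^'n^'n"
    using inner_unitary [of U "adjoint_mat U" ?I Y] that by (simp add: unitaryD)
  have "?I \<bullet> X \<le> ?I \<bullet> L"
    by (rule support_le [OF II(2) II(1) [symmetric] _ X L le]) (simp add: conj_I)
  moreover have "?I \<bullet> (- X) \<le> ?I \<bullet> (- L)"
  proof (rule support_le [OF II(2) II(1) [symmetric]])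
    show "hermitian (- X)" "hermitian (- L)"
      using X L adjoint_scaleR [of "- 1" X] adjoint_scaleR [of "- 1" L] by (simp_all add: hermitian_def)
    fix N :: "complex^'n^'n \<Rightarrow> real" and c assume N: "ui_seminorm N"
    show "N (- X + c *\<^sub>R ?I) \<le> N (- L + c *\<^sub>R ?I)"
      using le [OF N, of "- c"] ui_seminorm.scale [OF N, of "- 1" "X - c *\<^sub>R ?I"]
        ui_seminorm.scale [OF N, of "- 1" "L - c *\<^sub>R ?I"] by simp
  qed (simp add: conj_I)
  ultimately have tr: "?I \<bullet> X = ?I \<bullet> L" by simp
  have "convex (unitary_hull L)" by (simp add: unitary_hull_def)
  then obtain a b where ab: "a \<bullet> X < b" "\<And>Y. Y \<in> unitary_hull L \<Longrightarrow> b < a \<bullet> Y"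
    using separating_hyperplane_closed_point [OF _ compact_imp_closed [OF compact_unitary_hull] notin] by metis
  define Z where "Z = (- 1 / 2) *\<^sub>R (a + adjoint_mat a)"
  have ZY: "Z \<bullet> Y = - (a \<bullet> Y)" if "hermitian Y" for Y
    using inner_adjoint [of a Y] that by (simp add: Z_def inner_add_left hermitian_def)
  have "hermitian Z" 
    unfolding hermitian_def Z_def adjoint_scaleR adjoint_add adjoint_adjoint by (simp only: add.commute)
  then obtain z S where S: "hermitian S" "S ** S = Z + z *\<^sub>R ?I"
    using hermitian_shift_square by (metis order_refl)
  have "(Z + z *\<^sub>R ?I) \<bullet> X \<le> - b + z * (?I \<bullet> L)"
  proof (rule support_le [OF S(1) S(2) [symmetric] _ X L le])
    fix U :: "complex^'n^'n" assume U: "unitary U"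
    then have "U ** L ** adjoint_mat U \<in> unitary_hull L"
      unfolding unitary_hull_def by (intro hull_inc) auto
    then show "(Z + z *\<^sub>R ?I) \<bullet> (U ** L ** adjoint_mat U) \<le> - b + z * (?I \<bullet> L)"
      using ab(2) [of "U ** L ** adjoint_mat U"] U
      by (simp add: inner_add_left ZY hermitian_conj L conj_I)
  qed
  then show False using ab(1) tr by (simp add: inner_add_left ZY X)
qed

lemma ln_scaleR:
  assumes "A \<in> pd_matrices"
  shows "mat_fun ln (exp c *\<^sub>R A) = mat_fun ln A + c *\<^sub>R mat 1"
proof -
  have h: "hermitian A" by (rule pd_hermitian [OF assms])
  have "exp c *\<^sub>R A = mat_fun (\<lambda>x. exp c * x) A"
    using mat_fun_scaleR [OF h, of "exp c" "\<lambda>x. x"] by (simp add: mat_fun_ident h)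
  then have "mat_fun ln (exp c *\<^sub>R A) = mat_fun (\<lambda>x. ln (exp c * x)) A"
    by (simp add: mat_fun_comp h)
  also have "\<dots> = mat_fun (\<lambda>x. ln x + c) A"
    using assms unfolding pd_iff by (rule mat_fun_cong) (simp add: ln_mult)
  also have "\<dots> = mat_fun ln A + c *\<^sub>R mat 1"
    using mat_fun_add [OF h, of ln "\<lambda>x. c"] by (simp add: mat_fun_const h)
  finally show ?thesis .
qed

lemma pd_scaleR:
  assumes "A \<in> pd_matrices" "c > 0"
  shows "c *\<^sub>R A \<in> pd_matrices"
proof -
  have "c *\<^sub>R A = mat_fun (\<lambda>x. c * x) A"
    using mat_fun_scaleR [of A c "\<lambda>x. x"] by (simp add: mat_fun_ident pd_hermitian [OF assms(1)])
  then show ?thesis using pd_mat_fun [OF assms(1), of "\<lambda>x. c * x"] assms(2) by simp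
qed

lemma hermitian_diff: "hermitian A \<Longrightarrow> hermitian B \<Longrightarrow> hermitian (A - B)"
  using adjoint_add [of A "- 1 *\<^sub>R B"] adjoint_scaleR [of "- 1" B] by (simp add: hermitian_def)

text \<open>For \<open>A = e\<^sup>H\<close> and \<open>B = e\<^sup>-\<^sup>K\<close> this is the majorization form of the Golden--Thompson inequality. Shifting \<open>log A\<close> by
  \<open>c I\<close>, that is, scaling \<open>A\<close> by \<open>e\<^sup>c\<close>, shifts both sides by \<open>c I\<close>, as the criterion above asks.\<close>

theorem log_diff_majorized:
  fixes A B :: "complex^'n^'n"
  assumes A: "A \<in> pd_matrices" and B: "B \<in> pd_matrices"
  shows "mat_fun ln A - mat_fun ln B \<in> unitary_hull (mat_fun ln (inv_root_mat B ** A ** inv_root_mat B))"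
proof (rule in_unitary_hull_if_seminorms_le)
  let ?C = "inv_root_mat B ** A ** inv_root_mat B"
  have C: "?C \<in> pd_matrices" by (rule pd_inv_root_conj [OF B A])
  show "hermitian (mat_fun ln A - mat_fun ln B)" "hermitian (mat_fun ln ?C)"
    by (intro hermitian_diff hermitian_mat_fun pd_hermitian A B C)+
  fix N :: "complex^'n^'n \<Rightarrow> real" and c
  assume "ui_seminorm N"
  from ui_seminorm.log_diff_le [OF this pd_scaleR [OF A exp_gt_zero, of c] B]
  show "N (mat_fun ln A - mat_fun ln B + c *\<^sub>R mat 1) \<le> N (mat_fun ln ?C + c *\<^sub>R mat 1)"
    by (simp add: matmul.scaleR_left matmul.scaleR_right ln_scaleR A C algebra_simps)
qed

abbreviation diag_entry :: "complex^'n^'n \<Rightarrow> complex^'n^'n \<Rightarrow> 'n \<Rightarrow> real" where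
  "diag_entry U X j \<equiv> Re ((adjoint_mat U ** X ** U) $ j $ j)"

text \<open>Jensen's inequality for the spectral measures of \<open>L\<close>, followed by pinching in the chosen orthonormal
  basis, settles the points of the orbit; the rest is convexity.\<close>

lemma (in ui_seminorm) diagonal_le_of_unitary_hull:
  assumes L: "L \<in> hermitian_on I" and k: "convex_on I k" and k0: "\<And>x. x \<in> I \<Longrightarrow> 0 \<le> k x"
    and T: "T \<in> unitary_hull L" and U: "unitary U"
  shows "diag_entry U T j \<in> I"
    and "N (diag_mat (\<chi> j. k (diag_entry U T j))) \<le> N (mat_fun k L)"
proof -
  let ?x = "\<lambda>T j. diag_entry U T j"
  define G where "G = {T. (\<forall>j. ?x T j \<in> I) \<and> N (diag_mat (\<chi> j. k (?x T j))) \<le> N (mat_fun k L)}"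
  obtain V l where V: "unitary V" and Ll: "L = spectral_mat V l" and l: "\<And>i. l $ i \<in> I"
    using hermitian_onE [OF L] by blast
  have cI: "convex I" using k by (rule convex_on_imp_convex)
  have "T \<in> G"
  proof (rule subsetD [OF hull_minimal T [unfolded unitary_hull_def]])
    show "(\<lambda>Q. Q ** L ** adjoint_mat Q) ` {Q. unitary Q} \<subseteq> G"
    proof clarify
      fix Q :: "complex^'n^'n" assume Q: "unitary Q"
      \<comment> \<open>The squared moduli of the entries of \<open>Y\<close> are the weights of the spectral measures.\<close>
      define Y where "Y = adjoint_mat U ** Q ** V"
      have Y: "unitary Y" unfolding Y_def by (intro unitary_mul) (simp_all add: U Q V)
      have eq: "adjoint_mat U ** (Q ** spectral_mat V d ** adjoint_mat Q) ** U = spectral_mat Y d" for d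
        by (simp add: spectral_mat_def Y_def matrix_mul_assoc)
      have diag: "Re (spectral_mat Y d $ j $ j) = (\<Sum>m\<in>UNIV. (cmod (Y $ j $ m))\<^sup>2 * d $ m)" for d j
      proof -
        have "spectral_mat Y d $ j $ j = (\<Sum>m\<in>UNIV. Y $ j $ m * of_real (d $ m) * cnj (Y $ j $ m))"
          unfolding spectral_mat_def by (subst matrix_matrix_mult_def) (simp add: mul_diag_nth adjoint_mat_def)
        also have "\<dots> = of_real (\<Sum>m\<in>UNIV. (cmod (Y $ j $ m))\<^sup>2 * d $ m)"
          by (simp add: complex_norm_square mult_ac del: of_real_power)
        finally show ?thesis by simp
      qed
      have one: "(\<Sum>m\<in>UNIV. (cmod (Y $ j $ m))\<^sup>2) = 1" for j
        using diag [of "\<chi> i. 1" j] by (simp add: spectral_const Y mat_def)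
      have x: "?x (Q ** L ** adjoint_mat Q) j = (\<Sum>m\<in>UNIV. (cmod (Y $ j $ m))\<^sup>2 * l $ m)" for j
        by (simp add: Ll eq diag)
      have "?x (Q ** L ** adjoint_mat Q) j \<in> I" for j
        unfolding x using convex_sum [of UNIV I "\<lambda>m. (cmod (Y $ j $ m))\<^sup>2" "\<lambda>m. l $ m"] cI l one by simp
      moreover have "N (diag_mat (\<chi> j. k (?x (Q ** L ** adjoint_mat Q) j))) \<le> N (mat_fun k L)"
      proof -
        have "k (?x (Q ** L ** adjoint_mat Q) j) \<le> Re (spectral_mat Y (\<chi> i. k (l $ i)) $ j $ j)" for j
          unfolding x diag
          using convex_on_sum [of UNIV I k "\<lambda>m. (cmod (Y $ j $ m))\<^sup>2" "\<lambda>m. l $ m"] k l one by simp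
        then have "N (diag_mat (\<chi> j. k (?x (Q ** L ** adjoint_mat Q) j)))
            \<le> N (diag_mat (\<chi> j. Re (spectral_mat Y (\<chi> i. k (l $ i)) $ j $ j)))"
          using calculation by (intro diag_mono) (auto intro!: k0)
        also have "\<dots> \<le> N (spectral_mat Y (\<chi> i. k (l $ i)))" by (rule pinching) simp
        also have "\<dots> = N (mat_fun k L)" by (simp add: diag_spectral Y V Ll mat_fun_spectral)
        finally show ?thesis .
      qed
      ultimately show "Q ** L ** adjoint_mat Q \<in> G" by (simp add: G_def)
    qed
    show "convex G"
    proof (rule convexI)
      fix S T :: "complex^'n^'n" and u v :: real
      assume S: "S \<in> G" and T: "T \<in> G" and uv: "0 \<le> u" "0 \<le> v" "u + v = 1"
      have x: "?x (u *\<^sub>R S + v *\<^sub>R T) j = u *\<^sub>R ?x S j + v *\<^sub>R ?x T j" for j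
        by (simp add: matmul.add_left matmul.add_right matmul.scaleR_left matmul.scaleR_right)
      have I: "?x S j \<in> I" "?x T j \<in> I" for j using S T by (auto simp: G_def)
      have 1: "?x (u *\<^sub>R S + v *\<^sub>R T) j \<in> I" for j
        unfolding x by (rule convexD [OF cI I uv])
      have kx: "k (?x (u *\<^sub>R S + v *\<^sub>R T) j) \<le> u * k (?x S j) + v * k (?x T j)" for j
      proof (cases "v = 0")
        case False
        then show ?thesis unfolding x using convex_onD [OF k, of v "?x S j" "?x T j"] uv I
          by (simp add: eq_diff_eq [symmetric] add.commute [of u])
      qed (use x uv in simp)
      have "N (diag_mat (\<chi> j. k (?x (u *\<^sub>R S + v *\<^sub>R T) j)))
          \<le> N (diag_mat (u *\<^sub>R (\<chi> j. k (?x S j)) + v *\<^sub>R (\<chi> j. k (?x T j))))"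
        by (rule diag_mono) (use 1 kx k0 in auto)
      also have "\<dots> \<le> u * N (diag_mat (\<chi> j. k (?x S j))) + v * N (diag_mat (\<chi> j. k (?x T j)))"
        unfolding diag_add diag_scaleR
        using triangle [of "u *\<^sub>R diag_mat (\<chi> j. k (?x S j))" "v *\<^sub>R diag_mat (\<chi> j. k (?x T j))"] uv by (simp add: scale)
      also have "\<dots> \<le> u * N (mat_fun k L) + v * N (mat_fun k L)"
        using S T uv by (intro add_mono mult_left_mono) (auto simp: G_def)
      also have "\<dots> = N (mat_fun k L)" using uv by (simp flip: distrib_right)
      finally show "u *\<^sub>R S + v *\<^sub>R T \<in> G" using 1 by (simp add: G_def)
    qed
  qed
  then show "?x T j \<in> I" "N (diag_mat (\<chi> j. k (?x T j))) \<le> N (mat_fun k L)"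
    by (auto simp: G_def)
qed

lemma self_in_unitary_hull: "L \<in> unitary_hull L"
  unfolding unitary_hull_def by (rule hull_inc) (auto intro!: image_eqI [of _ _ "mat 1"])

lemma ui_seminorm_symmetric_norm:
  fixes N :: "complex^'n^'n \<Rightarrow> real"
  assumes "symmetric_norm N"
  shows "ui_seminorm N"
proof
  fix c and A :: "complex^'n^'n"
  have "c *\<^sub>R A = (\<chi> i j. of_real c * A $ i $ j)"
    by (simp add: vec_eq_iff; simp add: scaleR_conv_of_real)
  then show "N (c *\<^sub>R A) = \<bar>c\<bar> * N A" using assms by (simp add: symmetric_norm_def)
qed (use assms in \<open>auto simp: symmetric_norm_def\<close>)

lemma ui_seminorm_norm: "ui_seminorm (norm :: complex^'n^'n \<Rightarrow> real)"
  by standard (auto simp: norm_triangle_ineq norm_unitary)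

section \<open>The Riemannian distance\<close>

lemma riem_dist_eq: "riem_dist A B = norm (mat_fun ln (inv_root_mat A ** B ** inv_root_mat A))"
  by (simp add: riem_dist_def inv_root_mat_def)

lemma riem_dist_factor:
  assumes "S ** T = mat 1" "hermitian B"
  shows "riem_dist (S ** adjoint_mat S) B = norm (mat_fun ln (T ** B ** adjoint_mat T))"
proof -
  obtain W where W: "unitary W"
    and eq: "\<And>B. inv_root_mat (S ** adjoint_mat S) ** B ** inv_root_mat (S ** adjoint_mat S)
        = W ** (T ** B ** adjoint_mat T) ** adjoint_mat W"
    using inv_root_conj_factor [OF assms(1)] by blast
  show ?thesis
    unfolding riem_dist_eq eq by (simp add: mat_fun_unitary W hermitian_conj assms norm_unitary)
qed

lemma riem_dist_congruence:
  assumes ST: "S ** T = mat 1" and X: "X \<in> pd_matrices" and A: "A \<in> pd_matrices"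
  shows "riem_dist (S ** X ** adjoint_mat S) (S ** A ** adjoint_mat S) = riem_dist X A"
proof -
  have TS: "T ** S = mat 1" using ST matrix_left_right_inverse by blast
  then have TS': "adjoint_mat S ** adjoint_mat T = mat 1" by (metis adjoint_mul adjoint_one)
  have eq: "S ** X ** adjoint_mat S = (S ** root_mat X) ** adjoint_mat (S ** root_mat X)"
    using root_mul_root [OF X] by (simp add: X matrix_mul_assoc) (simp flip: matrix_mul_assoc)
  have "(S ** root_mat X) ** (inv_root_mat X ** T) = mat 1"
    using ST by (simp add: X matrix_mul_assoc inv_root_root_cancel)
  then have "riem_dist (S ** X ** adjoint_mat S) (S ** A ** adjoint_mat S)
      = norm (mat_fun ln ((inv_root_mat X ** T) ** (S ** A ** adjoint_mat S) ** adjoint_mat (inv_root_mat X ** T)))"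
    unfolding eq by (intro riem_dist_factor hermitian_conj pd_hermitian A)
  also have "(inv_root_mat X ** T) ** (S ** A ** adjoint_mat S) ** adjoint_mat (inv_root_mat X ** T)
      = inv_root_mat X ** (T ** S) ** A ** (adjoint_mat S ** adjoint_mat T) ** inv_root_mat X"
    by (simp add: X matrix_mul_assoc)
  finally show ?thesis by (simp add: TS TS' riem_dist_eq)
qed

lemma inv_root_mul_inv_root:
  assumes "C \<in> pd_matrices"
  shows "inv_root_mat C ** inv_root_mat C = mat_fun inverse C"
  unfolding inv_root_mat_def
proof (rule pd_mat_fun_mul_eq [OF assms])
  fix x :: real assume x: "x > 0"
  have "x powr (- 1 / 2) * x powr (- 1 / 2) = x powr (- 1 / 2 + - 1 / 2)" by (simp only: powr_add)
  also have "\<dots> = x powr (- 1)" by simp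
  also have "\<dots> = inverse x" using x by (simp only: powr_minus powr_one)
  finally show "x powr (- 1 / 2) * x powr (- 1 / 2) = inverse x" .
qed

text \<open>Both distances are norms of the logarithm of a matrix in the unitary orbit of \<open>C = X\<^sup>-\<^sup>1\<^sup>/\<^sup>2 A X\<^sup>-\<^sup>1\<^sup>/\<^sup>2\<close> or of
  \<open>C\<inverse>\<close>: factorise \<open>A = (X\<^sup>1\<^sup>/\<^sup>2 C\<^sup>1\<^sup>/\<^sup>2) (X\<^sup>1\<^sup>/\<^sup>2 C\<^sup>1\<^sup>/\<^sup>2)\<^sup>*\<close>.\<close>

lemma riem_dist_sym:
  assumes X: "X \<in> pd_matrices" and A: "A \<in> pd_matrices"
  shows "riem_dist X A = riem_dist A X"
proof -
  define C where "C = inv_root_mat X ** A ** inv_root_mat X"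
  have C: "C \<in> pd_matrices" unfolding C_def by (rule pd_inv_root_conj [OF X A])
  have "A = root_mat X ** C ** root_mat X"
    by (simp add: C_def matrix_mul_assoc inv_root_root_cancel X)
  then have eq: "A = (root_mat X ** root_mat C) ** adjoint_mat (root_mat X ** root_mat C)"
    using root_mul_root [OF C] by (simp add: X C matrix_mul_assoc) (simp flip: matrix_mul_assoc)
  have "(root_mat X ** root_mat C) ** (inv_root_mat C ** inv_root_mat X) = mat 1"
    by (simp add: X C matrix_mul_assoc inv_root_root_cancel)
  then have "riem_dist A X
      = norm (mat_fun ln ((inv_root_mat C ** inv_root_mat X) ** X ** adjoint_mat (inv_root_mat C ** inv_root_mat X)))"
    by (subst eq) (rule riem_dist_factor [OF _ pd_hermitian [OF X]])
  also have "(inv_root_mat C ** inv_root_mat X) ** X ** adjoint_mat (inv_root_mat C ** inv_root_mat X)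
      = inv_root_mat C ** (inv_root_mat X ** X ** inv_root_mat X) ** inv_root_mat C"
    by (simp add: X C matrix_mul_assoc)
  also have "\<dots> = mat_fun inverse C" by (simp add: inv_root_conj_self X inv_root_mul_inv_root C)
  also have "mat_fun ln (mat_fun inverse C) = mat_fun (\<lambda>x. - 1 * ln x) C"
    using C by (simp add: mat_fun_comp pd_hermitian) (rule mat_fun_cong [of C "{0<..}"], auto simp: pd_iff ln_inverse)
  also have "\<dots> = - 1 *\<^sub>R mat_fun ln C" by (rule mat_fun_scaleR [symmetric, OF pd_hermitian [OF C]])
  finally show ?thesis by (simp add: riem_dist_eq C_def)
qed

lemma norm_log_diff_le_riem_dist:
  assumes "A \<in> pd_matrices" "B \<in> pd_matrices"
  shows "norm (mat_fun ln A - mat_fun ln B) \<le> riem_dist A B"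
  using ui_seminorm.log_diff_le [OF ui_seminorm_norm assms] riem_dist_sym [OF assms]
  by (simp add: riem_dist_eq)

lemma exp_log: "A \<in> pd_matrices \<Longrightarrow> mat_fun exp (mat_fun ln A) = A"
  using mat_fun_cong [of A "{0<..}" "\<lambda>x. exp (ln x)" "\<lambda>x. x"]
  by (simp add: mat_fun_comp mat_fun_ident pd_hermitian pd_iff [symmetric])

lemma pd_exp: "hermitian K \<Longrightarrow> mat_fun exp K \<in> pd_matrices"
  unfolding pd_iff by (rule mat_fun_in [of K UNIV]) auto

lemma riem_dist_eq_0:
  assumes "X \<in> pd_matrices" "Y \<in> pd_matrices" "riem_dist X Y = 0"
  shows "X = Y"
proof -
  have "mat_fun ln X = mat_fun ln Y" using norm_log_diff_le_riem_dist [OF assms(1,2)] assms(3) by simp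
  then show ?thesis using exp_log assms by metis
qed

lemma hermitian_on_atLeast_iff:
  "C \<in> hermitian_on {m..} \<longleftrightarrow> hermitian C \<and> (\<forall>x. m * (x \<bullet> x) \<le> x \<bullet> (C *v x))"
proof
  have unit: "(\<Sum>i\<in>UNIV. (cmod ((adjoint_mat U *v x) $ i))\<^sup>2) = x \<bullet> x" if "unitary U" for U :: "complex^'n^'n" and x
    using quadratic_form_spectral [of x U "\<chi> i. 1"] that by (simp add: spectral_const)
  {
    assume "C \<in> hermitian_on {m..}"
    then obtain U d where U: "unitary U" and C: "C = spectral_mat U d" and d: "\<And>i. m \<le> d $ i"
      by (auto elim: hermitian_onE)
    have "m * (x \<bullet> x) \<le> x \<bullet> (C *v x)" for x
      unfolding C quadratic_form_spectral unit [OF U, symmetric] sum_distrib_left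
      by (intro sum_mono mult_right_mono d) simp
    then show "hermitian C \<and> (\<forall>x. m * (x \<bullet> x) \<le> x \<bullet> (C *v x))" by (simp add: C)
  next
    assume C: "hermitian C \<and> (\<forall>x. m * (x \<bullet> x) \<le> x \<bullet> (C *v x))"
    then obtain U d where U: "unitary U" and Cd: "C = spectral_mat U d"
      using hermitian_diagonalizable by blast
    have "m \<le> d $ j" for j
    proof -
      have coord: "(\<Sum>i\<in>UNIV. e $ i * (cmod ((adjoint_mat U *v (U *v axis j 1)) $ i))\<^sup>2) = e $ j" for e :: "real^'a"
      proof -
        have "(\<Sum>i\<in>UNIV. e $ i * (cmod ((adjoint_mat U *v (U *v axis j 1)) $ i))\<^sup>2) = (\<Sum>i\<in>UNIV. if i = j then e $ j else 0)"
          unfolding eigenvector_column(2) [OF U] by (rule sum.cong) (auto simp: axis_def)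
        then show ?thesis by simp
      qed
      have "m * ((U *v axis j 1) \<bullet> (U *v axis j 1)) \<le> (U *v axis j 1) \<bullet> (C *v (U *v axis j 1))"
        using C by blast
      then show ?thesis
        unfolding unit [OF U, symmetric] Cd quadratic_form_spectral using coord [of d] coord [of "\<chi> i. 1"] by simp
    qed
    then show "C \<in> hermitian_on {m..}" using U Cd by (auto intro: spectral_in)
  }
qed

lemma hermitian_on_atLeast_conj:
  fixes B S :: "complex^'n^'n"
  assumes B: "B \<in> hermitian_on {m..}" and S: "hermitian S" "S ** S \<in> hermitian_on {s..}" and "0 \<le> m"
  shows "S ** B ** S \<in> hermitian_on {m * s..}"
  unfolding hermitian_on_atLeast_iff
proof (intro conjI allI)
  have adj: "adjoint_mat S = S" using S(1) by (simp add: hermitian_def)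
  show "hermitian (S ** B ** S)" using hermitian_conj [OF hermitian_onD [OF B], of S] by (simp add: adj)
  fix x :: "complex^'n"
  have "m * s * (x \<bullet> x) = m * (s * (x \<bullet> x))" by simp
  also have "\<dots> \<le> m * (x \<bullet> (S ** S *v x))"
    using S(2) \<open>0 \<le> m\<close> unfolding hermitian_on_atLeast_iff by (intro mult_left_mono) auto
  also have "\<dots> = m * ((S *v x) \<bullet> (S *v x))"
    by (simp add: inner_matrix_vector adj matrix_vector_mul_assoc)
  also have "\<dots> \<le> (S *v x) \<bullet> (B *v (S *v x))" using B by (simp add: hermitian_on_atLeast_iff)
  also have "\<dots> = x \<bullet> (S ** B ** S *v x)"
    by (simp add: inner_matrix_vector adj matrix_vector_mul_assoc matrix_mul_assoc)
  finally show "m * s * (x \<bullet> x) \<le> x \<bullet> (S ** B ** S *v x)" .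
qed

lemma pd_bounds:
  assumes "A \<in> pd_matrices"
  obtains m M where "m > 0" "A \<in> hermitian_on {m..M}"
proof -
  obtain U d where U: "unitary U" and A: "A = spectral_mat U d" and d: "\<And>i. d $ i > 0"
    using hermitian_onE [OF assms [unfolded pd_iff]] by auto
  have "Min (range (($) d)) > 0" using d by (subst Min_gr_iff) auto
  moreover have "A \<in> hermitian_on {Min (range (($) d))..Max (range (($) d))}"
    unfolding A by (rule spectral_in [OF U]) simp
  ultimately show ?thesis by (rule that)
qed

text \<open>Logarithms range over a vector space, where closed balls are compact; the exponential and the distance are
  continuous on them because the spectra stay in a fixed compact interval.\<close>

definition hermitian_ball :: "real \<Rightarrow> (complex^'n^'n) set" where
  "hermitian_ball r = {K. hermitian K \<and> norm K \<le> r}"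

lemma compact_hermitian_ball: "compact (hermitian_ball r :: (complex^'n^'n) set)"
proof -
  have "closed ((\<lambda>K :: complex^'n^'n. adjoint_mat K - K) -` {0})"
    by (rule closed_vimage [OF closed_singleton])
      (rule continuous_on_diff [OF continuous_on_adjoint [OF continuous_on_id] continuous_on_id])
  then have "compact (cball 0 r \<inter> ((\<lambda>K :: complex^'n^'n. adjoint_mat K - K) -` {0}))"
    by (intro compact_Int_closed compact_cball)
  moreover have "hermitian_ball r = cball 0 r \<inter> ((\<lambda>K :: complex^'n^'n. adjoint_mat K - K) -` {0})"
    by (auto simp: hermitian_ball_def hermitian_def)
  ultimately show ?thesis by simp
qed

lemma hermitian_ball_in:
  assumes "K \<in> hermitian_ball r"
  shows "K \<in> hermitian_on {-r..r}"
proof -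
  obtain U d where U: "unitary U" and K: "K = spectral_mat U d"
    using assms hermitian_diagonalizable [of K] by (auto simp: hermitian_ball_def)
  have "norm (diag_mat d) \<le> r"
    using assms norm_unitary [of U "adjoint_mat U" "diag_mat d"] U by (simp add: hermitian_ball_def K spectral_mat_def)
  moreover have "\<bar>d $ i\<bar> \<le> norm (diag_mat d)" for i
  proof -
    have "\<bar>d $ i\<bar> = norm (diag_mat d $ i $ i)" by (simp add: diag_mat_nth)
    also have "\<dots> \<le> norm (diag_mat d)" by (rule order_trans [OF Finite_Cartesian_Product.norm_nth_le Finite_Cartesian_Product.norm_nth_le])
    finally show ?thesis .
  qed
  ultimately have "\<bar>d $ i\<bar> \<le> r" for i using order_trans by blast
  then have "d $ i \<in> {-r..r}" for i by (metis abs_le_iff atLeastAtMost_iff minus_le_iff)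
  then show ?thesis unfolding K by (rule spectral_in [OF U])
qed

lemma continuous_on_Lipschitz:
  fixes f :: "'a::metric_space \<Rightarrow> 'b::metric_space"
  assumes "\<And>x y. x \<in> S \<Longrightarrow> y \<in> S \<Longrightarrow> dist (f x) (f y) \<le> L * dist x y" "L \<ge> 0"
  shows "continuous_on S f"
  by (rule lipschitz_on_continuous_on [of L]) (auto intro!: lipschitz_onI assms)

lemma continuous_on_mat_fun_exp: "continuous_on (hermitian_ball r) (mat_fun exp :: complex^'n^'n \<Rightarrow> complex^'n^'n)"
proof (rule continuous_on_Lipschitz)
  fix K L :: "complex^'n^'n" assume "K \<in> hermitian_ball r" "L \<in> hermitian_ball r"
  then have KL: "K \<in> hermitian_on {-r..r}" "L \<in> hermitian_on {-r..r}" by (auto intro: hermitian_ball_in)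
  have lip: "\<bar>exp x - exp y\<bar> \<le> exp r * \<bar>x - y\<bar>" if "x \<in> {-r..r}" "y \<in> {-r..r}" for x y
  proof -
    have le: "\<bar>exp x - exp y\<bar> \<le> exp r * \<bar>x - y\<bar>" if "x \<le> y" "y \<le> r" for x y
    proof -
      have "1 + (x - y) \<le> exp (x - y)" by (rule exp_ge_add_one_self)
      then have "exp y * (1 + (x - y)) \<le> exp y * exp (x - y)" by (intro mult_left_mono) auto
      then have "exp y - exp x \<le> exp y * (y - x)" by (simp add: exp_diff algebra_simps)
      also have "\<dots> \<le> exp r * (y - x)" using that by (intro mult_right_mono) auto
      finally show ?thesis using that by simp
    qed
    show ?thesis using le [of x y] le [of y x] that by (cases "x \<le> y") (auto simp: abs_minus_commute)
  qed
  show "dist (mat_fun exp K) (mat_fun exp L) \<le> exp r * dist K L"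
    unfolding dist_norm by (rule mat_fun_Lipschitz [OF KL _ lip]) auto
qed simp

lemma continuous_on_mat_fun_ln: "m > 0 \<Longrightarrow> continuous_on (hermitian_on {m..}) (mat_fun ln :: complex^'n^'n \<Rightarrow> complex^'n^'n)"
proof (rule continuous_on_Lipschitz)
  assume m: "m > 0"
  fix K L :: "complex^'n^'n" assume KL: "K \<in> hermitian_on {m..}" "L \<in> hermitian_on {m..}"
  have lip: "\<bar>ln x - ln y\<bar> \<le> 1 / m * \<bar>x - y\<bar>" if "x \<in> {m..}" "y \<in> {m..}" for x y
  proof -
    have le: "\<bar>ln x - ln y\<bar> \<le> 1 / m * \<bar>x - y\<bar>" if "m \<le> x" "x \<le> y" for x y
    proof -
      have "ln y - ln x \<le> (y - x) / x" using ln_diff_le [of y x] that m by simp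
      also have "\<dots> \<le> (y - x) / m" using that m by (intro divide_left_mono) auto
      finally show ?thesis using that m by simp
    qed
    show ?thesis using le [of x y] le [of y x] that by (cases "x \<le> y") (auto simp: abs_minus_commute)
  qed
  show "dist (mat_fun ln K) (mat_fun ln L) \<le> 1 / m * dist K L"
    unfolding dist_norm by (rule mat_fun_Lipschitz [OF KL _ lip]) (use m in auto)
qed simp

lemma continuous_on_riem_dist_exp:
  assumes A: "A \<in> pd_matrices"
  shows "continuous_on (hermitian_ball r) (\<lambda>K. riem_dist (mat_fun exp K) A)"
proof -
  obtain m M where m: "m > 0" and "mat_fun inverse A \<in> hermitian_on {m..M}"
    using pd_bounds [OF pd_mat_fun [OF A, of inverse]] by auto
  then have inv: "mat_fun inverse A \<in> hermitian_on {m..}"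
    by (elim hermitian_on_mono [rotated]) auto
  let ?f = "\<lambda>K. inv_root_mat A ** mat_fun exp K ** inv_root_mat A"
  have "?f ` hermitian_ball r \<subseteq> hermitian_on {exp (- r) * m..}"
  proof clarify
    fix K :: "complex^'a^'a" assume "K \<in> hermitian_ball r"
    then have "mat_fun exp K \<in> hermitian_on {exp (- r)..}"
      by (intro mat_fun_in [OF hermitian_ball_in]) auto
    then show "?f K \<in> hermitian_on {exp (- r) * m..}"
      using inv adjoint_inv_root [OF A]
      by (intro hermitian_on_atLeast_conj) (simp_all add: inv_root_mul_inv_root A hermitian_def)
  qed
  moreover have "continuous_on (hermitian_ball r) ?f"
    by (intro matmul.continuous_on continuous_on_const continuous_on_mat_fun_exp)
  ultimately have "continuous_on (hermitian_ball r) (\<lambda>K. mat_fun ln (?f K))"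
    using continuous_on_compose2 [OF continuous_on_mat_fun_ln] m by (metis exp_gt_zero mult_pos_pos)
  then have "continuous_on (hermitian_ball r) (\<lambda>K. norm (mat_fun ln (?f K)))" by (rule continuous_on_norm)
  moreover have "riem_dist (mat_fun exp K) A = norm (mat_fun ln (?f K))" if "K \<in> hermitian_ball r" for K
    using that riem_dist_sym [OF pd_exp A, of K] by (simp add: hermitian_ball_def riem_dist_eq)
  ultimately show ?thesis by (simp cong: continuous_on_cong)
qed

section \<open>The weighted geometric mean\<close>

text \<open>A one-sided Taylor formula for \<open>(log x)\<^sup>2\<close>, uniform for arguments above \<open>m\<close>. Only the upper bound matters: it will be
  compared with a minimum.\<close>

lemma log_square_taylor:
  fixes b c m l :: real
  assumes m: "0 < m" "m \<le> b" "m \<le> c" and l: "\<bar>ln b\<bar> \<le> l"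
  shows "(ln c)\<^sup>2 \<le> (ln b)\<^sup>2 + 2 * (ln b / b * (c - b)) + (2 * l + 1) / m\<^sup>2 * (c - b)\<^sup>2"
proof -
  define y where "y = ln c - ln b"
  have pos: "b > 0" "c > 0" using m by auto
  have up: "y \<le> (c - b) / b" using ln_diff_le [of c b] pos by (simp add: y_def)
  have low: "(c - b) / c \<le> y" using ln_diff_le [of b c] pos by (simp add: y_def field_simps)
  have bc: "m\<^sup>2 \<le> b * c" unfolding power2_eq_square using m by (intro mult_mono) auto
  have "(c - b) / b - (c - b) / c = (c - b)\<^sup>2 / (b * c)" using pos by (simp add: field_simps power2_eq_square)
  also have "\<dots> \<le> (c - b)\<^sup>2 / m\<^sup>2" using bc m by (intro divide_left_mono) auto
  finally have close: "\<bar>y - (c - b) / b\<bar> \<le> (c - b)\<^sup>2 / m\<^sup>2" using up low by linarith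
  have "\<bar>y\<bar> \<le> \<bar>c - b\<bar> / m"
  proof -
    have "(c - b) / b \<le> \<bar>c - b\<bar> / m" "- ((c - b) / c) \<le> \<bar>c - b\<bar> / m"
      using m pos unfolding minus_divide_left by (auto intro!: frac_le)
    then show ?thesis using up low by linarith
  qed
  then have "\<bar>y\<bar>\<^sup>2 \<le> (\<bar>c - b\<bar> / m)\<^sup>2" by (intro power_mono) auto
  then have sq: "y\<^sup>2 \<le> (c - b)\<^sup>2 / m\<^sup>2" by (simp add: power_divide)
  have "ln b * (y - (c - b) / b) \<le> \<bar>ln b\<bar> * \<bar>y - (c - b) / b\<bar>" by (metis abs_ge_self abs_mult)
  also have "\<dots> \<le> l * ((c - b)\<^sup>2 / m\<^sup>2)" using l close by (intro mult_mono) auto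
  finally have lin: "ln b * y \<le> ln b / b * (c - b) + l * ((c - b)\<^sup>2 / m\<^sup>2)"
    by (simp add: algebra_simps)
  have "(ln c)\<^sup>2 = (ln b)\<^sup>2 + 2 * (ln b * y) + y\<^sup>2" by (simp add: y_def power2_eq_square algebra_simps)
  also have "\<dots> \<le> (ln b)\<^sup>2 + 2 * (ln b / b * (c - b) + l * ((c - b)\<^sup>2 / m\<^sup>2)) + (c - b)\<^sup>2 / m\<^sup>2"
    by (intro add_mono sq order_refl mult_left_mono lin) simp
  also have "\<dots> = (ln b)\<^sup>2 + 2 * (ln b / b * (c - b)) + (2 * l + 1) / m\<^sup>2 * (c - b)\<^sup>2"
    by (simp add: add_divide_distrib algebra_simps)
  finally show ?thesis .
qed

lemma norm_mat_fun_square: "hermitian A \<Longrightarrow> (norm (mat_fun f A))\<^sup>2 = mat_fun (\<lambda>x. (f x)\<^sup>2) A \<bullet> mat 1"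
  unfolding power2_norm_eq_inner
  using inner_mul_left [of "mat_fun f A" "mat 1" "mat_fun f A"] hermitian_mat_fun [of A f]
  by (simp add: mat_fun_mul hermitian_def power2_eq_square inner_commute)

lemma norm_log_square_taylor:
  fixes B C :: "complex^'n^'n"
  assumes m: "0 < m" and B: "B \<in> hermitian_on {m..M}" and C: "C \<in> hermitian_on {m..}"
    and l: "\<And>b. b \<in> {m..M} \<Longrightarrow> \<bar>ln b\<bar> \<le> l"
  shows "(norm (mat_fun ln C))\<^sup>2 \<le> (norm (mat_fun ln B))\<^sup>2 + 2 * (mat_fun (\<lambda>x. ln x / x) B \<bullet> (C - B))
      + (2 * l + 1) / m\<^sup>2 * (norm (C - B))\<^sup>2"
proof -
  obtain d e :: "real^'n" and P :: "'n \<Rightarrow> 'n \<Rightarrow> real"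
    where d: "\<And>i. d $ i \<in> {m..M}" and e: "\<And>j. e $ j \<in> {m..}" and P: "\<And>i j. P i j \<ge> 0"
    and eq: "\<And>f g. mat_fun f B \<bullet> mat_fun g C = (\<Sum>i\<in>UNIV. \<Sum>j\<in>UNIV. f (d $ i) * g (e $ j) * P i j)"
    and sq: "\<And>f. (norm (mat_fun f B - mat_fun f C))\<^sup>2 = (\<Sum>i\<in>UNIV. \<Sum>j\<in>UNIV. (f (d $ i) - f (e $ j))\<^sup>2 * P i j)"
    by (rule two_matrix_weights [OF B C]) (rule that)
  have nz: "d $ i \<noteq> 0" for i using d [of i] m by auto
  have hB: "hermitian B" and hC: "hermitian C" using B C by (auto dest: hermitian_onD)
  have one: "mat 1 = mat_fun (\<lambda>x. 1) C" "mat 1 = mat_fun (\<lambda>x. 1) B" by (simp_all add: mat_fun_const hB hC)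
  have id: "B = mat_fun (\<lambda>x. x) B" "C = mat_fun (\<lambda>x. x) C" by (simp_all add: mat_fun_ident hB hC)
  have adjB: "adjoint_mat (mat_fun f B) = mat_fun f B" for f
    using hermitian_mat_fun [OF hB] by (simp add: hermitian_def)
  have FB: "F \<bullet> mat_fun g B = (mat_fun g B ** F) \<bullet> mat_fun (\<lambda>x. 1) C" for F g
    using inner_mul_left [of "mat_fun g B" F "mat 1"] by (simp add: adjB flip: one)
  have "(norm (mat_fun ln C))\<^sup>2 = (\<Sum>i\<in>UNIV. \<Sum>j\<in>UNIV. (ln (e $ j))\<^sup>2 * P i j)"
    unfolding norm_mat_fun_square [OF hC] one(2) by (subst inner_commute) (simp add: eq)
  also have "\<dots> \<le> (\<Sum>i\<in>UNIV. \<Sum>j\<in>UNIV. ((ln (d $ i))\<^sup>2 + 2 * (ln (d $ i) / d $ i * (e $ j - d $ i))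
      + (2 * l + 1) / m\<^sup>2 * (e $ j - d $ i)\<^sup>2) * P i j)"
    using d e m l by (intro sum_mono mult_right_mono P log_square_taylor) auto
  also have "\<dots> = (\<Sum>i\<in>UNIV. \<Sum>j\<in>UNIV. (ln (d $ i))\<^sup>2 * P i j)
      + 2 * ((\<Sum>i\<in>UNIV. \<Sum>j\<in>UNIV. ln (d $ i) / d $ i * e $ j * P i j)
        - (\<Sum>i\<in>UNIV. \<Sum>j\<in>UNIV. d $ i * (ln (d $ i) / d $ i) * P i j))
      + (2 * l + 1) / m\<^sup>2 * (\<Sum>i\<in>UNIV. \<Sum>j\<in>UNIV. (d $ i - e $ j)\<^sup>2 * P i j)"
    by (simp only: sum_distrib_left sum_subtractf [symmetric] sum.distrib [symmetric])
      (intro sum.cong refl, simp add: nz power2_eq_square algebra_simps diff_divide_distrib)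
  also have "(\<Sum>i\<in>UNIV. \<Sum>j\<in>UNIV. (ln (d $ i))\<^sup>2 * P i j) = (norm (mat_fun ln B))\<^sup>2"
    unfolding norm_mat_fun_square [OF hB] one(1) eq by simp
  also have "(\<Sum>i\<in>UNIV. \<Sum>j\<in>UNIV. ln (d $ i) / d $ i * e $ j * P i j) = mat_fun (\<lambda>x. ln x / x) B \<bullet> C"
    using eq [of "\<lambda>x. ln x / x" "\<lambda>x. x"] by (simp add: mat_fun_ident hC)
  also have "(\<Sum>i\<in>UNIV. \<Sum>j\<in>UNIV. d $ i * (ln (d $ i) / d $ i) * P i j) = mat_fun (\<lambda>x. ln x / x) B \<bullet> B"
    using FB [of "mat_fun (\<lambda>x. ln x / x) B" "\<lambda>x. x"] eq [of "\<lambda>x. x * (ln x / x)" "\<lambda>x. 1"]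
      mat_fun_mul [OF hB, of "\<lambda>x. x" "\<lambda>x. ln x / x"]
    by (simp only: mat_fun_ident [OF hB] mult_1_right)
  also have "(\<Sum>i\<in>UNIV. \<Sum>j\<in>UNIV. (d $ i - e $ j)\<^sup>2 * P i j) = (norm (C - B))\<^sup>2"
    using sq [of "\<lambda>x. x"] by (simp add: mat_fun_ident hB hC norm_minus_commute)
  finally show ?thesis by (simp add: inner_diff_right)
qed

lemma one_minus_scaled:
  assumes "hermitian V"
  shows "mat 1 - s *\<^sub>R V = mat_fun (\<lambda>x. 1 - s * x) V"
  using mat_fun_add [OF assms, of "\<lambda>x. 1 - s * x" "\<lambda>x. s * x"] mat_fun_scaleR [OF assms, of s "\<lambda>x. x"]
  by (simp add: mat_fun_const mat_fun_ident assms diff_eq_eq)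

text \<open>How the squared distance to \<open>B\<close> changes when the identity moves in direction \<open>V\<close>. The identity is replaced by
  \<open>T\<^sup>-\<^sup>2\<close> with \<open>T = I - (t/2) V\<close> rather than by \<open>e\<^sup>t\<^sup>V\<close>, so that \<open>T B T\<close> is a polynomial in \<open>t\<close>.\<close>

lemma first_variation:
  fixes B V :: "complex^'n^'n"
  assumes B: "B \<in> pd_matrices" and V: "hermitian V"
  obtains k where "k \<ge> 0" "\<And>t. 0 < t \<Longrightarrow> t \<le> 1 \<Longrightarrow> t * norm V \<le> 1 \<Longrightarrow>
    (norm (mat_fun ln ((mat 1 - (t / 2) *\<^sub>R V) ** B ** (mat 1 - (t / 2) *\<^sub>R V))))\<^sup>2
      \<le> (norm (mat_fun ln B))\<^sup>2 - 2 * t * (V \<bullet> mat_fun ln B) + k * t\<^sup>2"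
proof -
  obtain m M where m: "m > 0" and BmM: "B \<in> hermitian_on {m..M}" using pd_bounds [OF B] by blast
  have hB: "hermitian B" by (rule pd_hermitian [OF B])
  define l where "l = \<bar>ln (m / 4)\<bar> + \<bar>ln M\<bar>"
  define F where "F = mat_fun (\<lambda>x. ln x / x) B"
  define E where "E = V ** B + B ** V"
  define G where "G = V ** B ** V"
  define q where "q = (2 * l + 1) / (m / 4)\<^sup>2"
  define k where "k = \<bar>F \<bullet> G\<bar> + q * (norm E + norm G)\<^sup>2"
  have q: "q \<ge> 0" by (simp add: q_def l_def)
  have Bm: "B \<in> hermitian_on {m..}" and Bm4: "B \<in> hermitian_on {m / 4..M}"
    using BmM m by (auto elim!: hermitian_on_mono [rotated])
  have l: "\<bar>ln b\<bar> \<le> l" if "b \<in> {m / 4..M}" for b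
  proof -
    have "ln (m / 4) \<le> ln b" "ln b \<le> ln M" using that m by auto
    then show ?thesis unfolding l_def by linarith
  qed
  have adj: "adjoint_mat V = V" "adjoint_mat B = B" using V hB by (simp_all add: hermitian_def)
  have FB: "F ** B = mat_fun ln B" "B ** F = mat_fun ln B"
    using pd_mat_fun_mul_eq [OF B, of "\<lambda>x. ln x / x" "\<lambda>x. x" ln] pd_mat_fun_mul_eq [OF B, of "\<lambda>x. x" "\<lambda>x. ln x / x" ln]
    by (simp_all add: F_def mat_fun_ident hB)
  have FE: "F \<bullet> E = 2 * (V \<bullet> mat_fun ln B)"
    using inner_mul_right [of V B F] inner_mul_left [of B V F]
    by (simp add: E_def inner_add_right adj FB inner_commute [of F])
  have "(norm (mat_fun ln ((mat 1 - (t / 2) *\<^sub>R V) ** B ** (mat 1 - (t / 2) *\<^sub>R V))))\<^sup>2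
      \<le> (norm (mat_fun ln B))\<^sup>2 - 2 * t * (V \<bullet> mat_fun ln B) + k * t\<^sup>2"
    if t: "0 < t" "t \<le> 1" "t * norm V \<le> 1" for t
  proof -
    define T where "T = mat 1 - (t / 2) *\<^sub>R V"
    define C where "C = T ** B ** T"
    have Vball: "V \<in> hermitian_on {- norm V..norm V}"
      by (rule hermitian_ball_in) (simp add: hermitian_ball_def V)
    have T_eq: "T = mat_fun (\<lambda>x. 1 - t / 2 * x) V"
      unfolding T_def by (rule one_minus_scaled [OF V])
    have hT: "hermitian T" unfolding T_eq by (rule hermitian_mat_fun [OF V])
    have "T ** T = mat_fun (\<lambda>x. (1 - t / 2 * x) * (1 - t / 2 * x)) V"
      unfolding T_eq by (rule mat_fun_mul [OF V])
    also have "\<dots> \<in> hermitian_on {1 / 4..}"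
    proof (rule mat_fun_in [OF Vball], clarsimp)
      fix x assume x: "- norm V \<le> x" "x \<le> norm V"
      have "t * x \<le> t * norm V" using x t by (intro mult_left_mono) auto
      then have "1 / 2 \<le> 1 - t * x / 2" using t(3) by simp
      then have "1 / 2 * (1 / 2) \<le> (1 - t * x / 2) * (1 - t * x / 2)" by (intro mult_mono) auto
      then show "1 \<le> (1 - t * x / 2) * (1 - t * x / 2) * 4" by simp
    qed
    finally have "T ** T \<in> hermitian_on {1 / 4..}" .
    from hermitian_on_atLeast_conj [OF Bm hT this] m
    have C: "C \<in> hermitian_on {m / 4..}" by (simp add: C_def)
    have CB: "C - B = (- t / 2) *\<^sub>R E + (t\<^sup>2 / 4) *\<^sub>R G"
      by (simp add: C_def T_def E_def G_def matmul.diff_left matmul.diff_right matmul.scaleR_left matmul.scaleR_right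
          scaleR_add_right scaleR_diff_right power2_eq_square matrix_mul_assoc)
    have "norm (C - B) \<le> t * (norm E + norm G)"
    proof -
      have "norm (C - B) \<le> (t / 2) * norm E + (t\<^sup>2 / 4) * norm G"
        unfolding CB using norm_triangle_ineq [of "(- t / 2) *\<^sub>R E" "(t\<^sup>2 / 4) *\<^sub>R G"] t by simp
      also have "\<dots> \<le> t * norm E + t * norm G"
        using t by (intro add_mono mult_right_mono) (auto simp: power2_eq_square mult_le_one intro: order_trans [of _ "t * 1"])
      finally show ?thesis by (simp add: algebra_simps)
    qed
    then have n: "(norm (C - B))\<^sup>2 \<le> (t * (norm E + norm G))\<^sup>2" by (intro power_mono) auto
    have "(norm (mat_fun ln C))\<^sup>2 \<le> (norm (mat_fun ln B))\<^sup>2 + 2 * (F \<bullet> (C - B)) + q * (norm (C - B))\<^sup>2"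
      unfolding F_def q_def using m by (intro norm_log_square_taylor [OF _ Bm4 C l]) auto
    also have "F \<bullet> (C - B) = - t * (V \<bullet> mat_fun ln B) + (t\<^sup>2 / 4) * (F \<bullet> G)"
      by (simp add: CB inner_add_right inner_diff_right FE)
    also have "(norm (mat_fun ln B))\<^sup>2 + 2 * (- t * (V \<bullet> mat_fun ln B) + (t\<^sup>2 / 4) * (F \<bullet> G)) + q * (norm (C - B))\<^sup>2
        \<le> (norm (mat_fun ln B))\<^sup>2 - 2 * t * (V \<bullet> mat_fun ln B) + (t\<^sup>2 * \<bar>F \<bullet> G\<bar> + q * (t * (norm E + norm G))\<^sup>2)"
    proof -
      have "(t\<^sup>2 / 2) * (F \<bullet> G) \<le> (t\<^sup>2 / 2) * \<bar>F \<bullet> G\<bar>" by (intro mult_left_mono) auto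
      also have "\<dots> \<le> t\<^sup>2 * \<bar>F \<bullet> G\<bar>" by (intro mult_right_mono) auto
      finally have "(t\<^sup>2 / 2) * (F \<bullet> G) \<le> t\<^sup>2 * \<bar>F \<bullet> G\<bar>" .
      moreover have "q * (norm (C - B))\<^sup>2 \<le> q * (t * (norm E + norm G))\<^sup>2" using n q by (rule mult_left_mono)
      ultimately show ?thesis by (simp add: algebra_simps)
    qed
    finally show ?thesis unfolding k_def C_def T_def power_mult_distrib by (simp add: algebra_simps)
  qed
  moreover have "k \<ge> 0" using q by (simp add: k_def)
  ultimately show ?thesis using that by blast
qed

definition cost :: "real^'m \<Rightarrow> ('m \<Rightarrow> complex^'n^'n) \<Rightarrow> complex^'n^'n \<Rightarrow> real" where
  "cost w A X = (\<Sum>i\<in>UNIV. w $ i * (riem_dist X (A i))\<^sup>2)"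

text \<open>The critical points of the cost: the tangent vectors at \<open>X\<close> towards the \<open>A\<^sub>i\<close> balance.\<close>

definition karcher :: "real^'m \<Rightarrow> ('m \<Rightarrow> complex^'n^'n) \<Rightarrow> complex^'n^'n \<Rightarrow> bool" where
  "karcher w A X \<longleftrightarrow> X \<in> pd_matrices \<and>
     (\<Sum>i\<in>UNIV. w $ i *\<^sub>R mat_fun ln (inv_root_mat X ** A i ** inv_root_mat X)) = 0"

text \<open>A radius, independent of the weights, of a ball that contains \<open>log X\<close> for every \<open>X\<close> whose cost does not exceed that
  of the identity.\<close>

definition log_radius :: "('m::finite \<Rightarrow> complex^'n^'n) \<Rightarrow> real" where
  "log_radius A = (\<Sum>i\<in>UNIV. norm (mat_fun ln (A i))) + sqrt (\<Sum>i\<in>UNIV. (riem_dist (mat 1) (A i))\<^sup>2) + 1"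

lemma mat_fun_zero: "mat_fun f (0 :: complex^'n^'n) = f 0 *\<^sub>R mat 1"
proof -
  have z: "spectral_mat (mat 1) (\<chi> i. 0) = (0 :: complex^'n^'n)" by (simp add: spectral_const)
  have "mat_fun f (spectral_mat (mat 1 :: complex^'n^'n) (\<chi> i. 0)) = spectral_mat (mat 1) (\<chi> i. f 0)"
    by (simp add: mat_fun_spectral)
  then show ?thesis by (simp only: z spectral_const [OF unitary_one])
qed

context
  fixes A :: "'m::finite \<Rightarrow> complex^'n^'n" and w :: "real^'m"
  assumes A: "\<And>i. A i \<in> pd_matrices" and w: "w \<in> weight_simplex"
begin

lemma weight_nonneg: "0 \<le> w $ i" and weight_sum: "(\<Sum>i\<in>UNIV. w $ i) = 1"
  using w by (auto simp: weight_simplex_def)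

text \<open>Move \<open>X\<close> to the identity by a congruence; then the exponential metric increasing property compares
  the cost with the Euclidean one at \<open>log Y\<close>, where the balance condition is the vanishing of a mean.\<close>

lemma variance_inequality:
  assumes X: "karcher w A X" and Y: "Y \<in> pd_matrices"
  shows "cost w A X + (riem_dist X Y)\<^sup>2 \<le> cost w A Y"
proof -
  have Xpd: "X \<in> pd_matrices" using X by (simp add: karcher_def)
  define H where "H i = mat_fun ln (inv_root_mat X ** A i ** inv_root_mat X)" for i
  define Z where "Z = mat_fun ln (inv_root_mat X ** Y ** inv_root_mat X)"
  have H0: "(\<Sum>i\<in>UNIV. w $ i *\<^sub>R H i) = 0" using X by (simp add: karcher_def H_def)
  have le: "norm (H i - Z) \<le> riem_dist Y (A i)" for i
  proof -
    have "norm (Z - H i) \<le> riem_dist (inv_root_mat X ** Y ** inv_root_mat X) (inv_root_mat X ** A i ** inv_root_mat X)"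
      unfolding H_def Z_def by (intro norm_log_diff_le_riem_dist pd_inv_root_conj Xpd Y A)
    also have "\<dots> = riem_dist Y (A i)"
      using riem_dist_congruence [of "inv_root_mat X" "root_mat X" Y "A i"] Xpd Y A by simp
    finally show ?thesis by (simp add: norm_minus_commute)
  qed
  have "cost w A X + (riem_dist X Y)\<^sup>2 = (\<Sum>i\<in>UNIV. w $ i * (norm (H i))\<^sup>2) - 2 * ((\<Sum>i\<in>UNIV. w $ i *\<^sub>R H i) \<bullet> Z)
      + (\<Sum>i\<in>UNIV. w $ i) * (norm Z)\<^sup>2"
    by (simp add: cost_def riem_dist_eq H_def Z_def weight_sum H0 [unfolded H_def])
  also have "\<dots> = (\<Sum>i\<in>UNIV. w $ i * (norm (H i - Z))\<^sup>2)"
    by (simp add: inner_sum_left sum_distrib_left sum_distrib_right sum_subtractf [symmetric] sum.distrib [symmetric]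
        power2_norm_eq_inner inner_diff_left inner_diff_right)
      (intro sum.cong refl, simp add: inner_commute algebra_simps)
  also have "\<dots> \<le> cost w A Y"
    unfolding cost_def by (intro sum_mono mult_left_mono power_mono le weight_nonneg) simp
  finally show ?thesis .
qed

text \<open>Let \<open>V\<close> be the weighted mean of the logarithms. Moving the minimiser in direction \<open>V\<close> by \<open>t\<close> lowers the cost by
  \<open>2 t \<parallel>V\<parallel>\<^sup>2\<close> up to a term of order \<open>t\<^sup>2\<close>, which is impossible unless \<open>V = 0\<close>.\<close>

lemma minimizer_karcher:
  assumes X: "X \<in> pd_matrices" and min: "\<And>Y. Y \<in> pd_matrices \<Longrightarrow> cost w A X \<le> cost w A Y"
  shows "karcher w A X"
proof -
  define B where "B i = inv_root_mat X ** A i ** inv_root_mat X" for i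
  define V where "V = (\<Sum>i\<in>UNIV. w $ i *\<^sub>R mat_fun ln (B i))"
  have B: "B i \<in> pd_matrices" for i unfolding B_def by (rule pd_inv_root_conj [OF X A])
  have V: "hermitian V"
    using hermitian_mat_fun [OF pd_hermitian [OF B]]
    by (simp add: V_def hermitian_def linear_sum [OF bounded_linear.linear [OF bounded_linear_adjoint]] adjoint_scaleR)
  let ?T = "\<lambda>t. mat 1 - (t / 2) *\<^sub>R V"
  have "\<exists>k. k \<ge> 0 \<and> (\<forall>t. 0 < t \<longrightarrow> t \<le> 1 \<longrightarrow> t * norm V \<le> 1 \<longrightarrow>
      (norm (mat_fun ln (?T t ** B i ** ?T t)))\<^sup>2
        \<le> (norm (mat_fun ln (B i)))\<^sup>2 - 2 * t * (V \<bullet> mat_fun ln (B i)) + k * t\<^sup>2)" for i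
    using first_variation [OF B V, of i] by metis
  then obtain k where k0: "\<And>i. k i \<ge> 0"
    and k: "\<And>i t. 0 < t \<Longrightarrow> t \<le> 1 \<Longrightarrow> t * norm V \<le> 1 \<Longrightarrow> (norm (mat_fun ln (?T t ** B i ** ?T t)))\<^sup>2
        \<le> (norm (mat_fun ln (B i)))\<^sup>2 - 2 * t * (V \<bullet> mat_fun ln (B i)) + k i * t\<^sup>2"
    by metis
  define K where "K = (\<Sum>i\<in>UNIV. w $ i * k i)"
  have K: "K \<ge> 0" unfolding K_def by (intro sum_nonneg mult_nonneg_nonneg weight_nonneg k0)
  have small: "2 * (norm V)\<^sup>2 \<le> K * t" if t: "0 < t" "t \<le> 1" "t * norm V \<le> 1" for t
  proof -
    have Vball: "V \<in> hermitian_on {- norm V..norm V}"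
      by (rule hermitian_ball_in) (simp add: hermitian_ball_def V)
    have T_eq: "?T t = mat_fun (\<lambda>x. 1 - t / 2 * x) V"
      by (rule one_minus_scaled [OF V])
    \<comment> \<open>The competitor is \<open>Y = X\<^sup>1\<^sup>/\<^sup>2 T\<^sup>-\<^sup>2 X\<^sup>1\<^sup>/\<^sup>2\<close>, where \<open>S\<close> is the inverse of \<open>T = I - (t/2) V\<close>.\<close>
    define S where "S = mat_fun (\<lambda>x. inverse (1 - t / 2 * x)) V"
    have ST: "S ** ?T t = mat 1"
    proof -
      have "S ** ?T t = mat_fun (\<lambda>x. inverse (1 - t / 2 * x) * (1 - t / 2 * x)) V"
        unfolding S_def T_eq by (rule mat_fun_mul [OF V])
      also have "\<dots> = mat_fun (\<lambda>x. 1) V"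
      proof (rule mat_fun_cong [OF Vball])
        fix x assume "x \<in> {- norm V..norm V}"
        then have "t * x \<le> t * norm V" using t by (intro mult_left_mono) auto
        then have "1 - t / 2 * x \<noteq> 0" using t(3) by simp
        then show "inverse (1 - t / 2 * x) * (1 - t / 2 * x) = 1" by (rule left_inverse)
      qed
      finally show ?thesis by (simp add: mat_fun_const V)
    qed
    have adjT: "adjoint_mat (?T t) = ?T t" using hermitian_mat_fun [OF V] unfolding T_eq by (simp add: hermitian_def)
    define Y where "Y = (root_mat X ** S) ** adjoint_mat (root_mat X ** S)"
    have YT: "(root_mat X ** S) ** (?T t ** inv_root_mat X) = mat 1"
    proof -
      have "(root_mat X ** S) ** (?T t ** inv_root_mat X) = root_mat X ** (S ** ?T t) ** inv_root_mat X"
        by (simp only: matrix_mul_assoc)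
      then show ?thesis using X by (simp add: ST)
    qed
    have Y: "Y \<in> pd_matrices" using pd_congruence [OF pd_one YT] by (simp only: Y_def matrix_mul_rid)
    have dist: "riem_dist Y (A i) = norm (mat_fun ln (?T t ** B i ** ?T t))" for i
    proof -
      have "(?T t ** inv_root_mat X) ** A i ** adjoint_mat (?T t ** inv_root_mat X) = ?T t ** B i ** ?T t"
        unfolding adjoint_mul adjT B_def by (simp only: adjoint_inv_root [OF X] matrix_mul_assoc)
      then show ?thesis unfolding Y_def riem_dist_factor [OF YT pd_hermitian [OF A]] by (simp only:)
    qed
    have "cost w A X \<le> cost w A Y" by (rule min [OF Y])
    also have "\<dots> \<le> (\<Sum>i\<in>UNIV. w $ i * ((norm (mat_fun ln (B i)))\<^sup>2 - 2 * t * (V \<bullet> mat_fun ln (B i)) + k i * t\<^sup>2))"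
      unfolding cost_def dist by (intro sum_mono mult_left_mono weight_nonneg k t)
    also have "\<dots> = (\<Sum>i\<in>UNIV. w $ i * (norm (mat_fun ln (B i)))\<^sup>2)
        - 2 * t * (V \<bullet> (\<Sum>i\<in>UNIV. w $ i *\<^sub>R mat_fun ln (B i))) + K * t\<^sup>2"
      by (simp add: K_def inner_sum_right sum_distrib_left sum_distrib_right sum_subtractf [symmetric] sum.distrib [symmetric])
        (intro sum.cong refl, simp add: algebra_simps)
    also have "\<dots> = cost w A X - 2 * t * (norm V)\<^sup>2 + K * t\<^sup>2"
      by (simp add: cost_def riem_dist_eq B_def V_def power2_norm_eq_inner)
    finally have "t * (2 * (norm V)\<^sup>2) \<le> t * (K * t)" by (simp add: power2_eq_square algebra_simps)
    then show ?thesis using t(1) by simp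
  qed
  have "V = 0"
  proof (rule ccontr)
    assume "V \<noteq> 0"
    then have v: "norm V > 0" by simp
    define t where "t = min (min 1 (1 / norm V)) ((norm V)\<^sup>2 / (K + 1))"
    have "t > 0" using v K by (simp add: t_def)
    moreover have "t * norm V \<le> 1"
    proof -
      have "t * norm V \<le> 1 / norm V * norm V" by (intro mult_right_mono) (auto simp: t_def)
      then show ?thesis using v by simp
    qed
    moreover have "t \<le> 1" by (simp add: t_def)
    ultimately have "2 * (norm V)\<^sup>2 \<le> K * t" by (intro small)
    also have "K * t \<le> K * ((norm V)\<^sup>2 / (K + 1))" using K by (intro mult_left_mono) (auto simp: t_def)
    also have "\<dots> \<le> (norm V)\<^sup>2" using K by (simp add: field_simps)
    finally show False using v by simp
  qed
  then show ?thesis using X by (simp add: karcher_def V_def B_def)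
qed

text \<open>By the exponential metric increasing property, a large logarithm puts \<open>Y\<close> far from all \<open>A\<^sub>i\<close> at once.\<close>

lemma norm_log_le_if_cost_le:
  assumes Y: "Y \<in> pd_matrices" and le: "cost w A Y \<le> cost w A (mat 1)"
  shows "norm (mat_fun ln Y) \<le> log_radius A"
proof (rule ccontr)
  define D where "D = (\<Sum>i\<in>UNIV. (riem_dist (mat 1) (A i))\<^sup>2)"
  have D: "D \<ge> 0" unfolding D_def by (intro sum_nonneg) simp
  assume "\<not> norm (mat_fun ln Y) \<le> log_radius A"
  then have big: "norm (mat_fun ln Y) > (\<Sum>i\<in>UNIV. norm (mat_fun ln (A i))) + sqrt D + 1"
    by (simp add: log_radius_def D_def)
  have far: "sqrt D + 1 \<le> riem_dist Y (A i)" for i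
  proof -
    have "norm (mat_fun ln (A i)) \<le> (\<Sum>i\<in>UNIV. norm (mat_fun ln (A i)))" by (rule member_le_sum) auto
    moreover have "norm (mat_fun ln Y) \<le> norm (mat_fun ln Y - mat_fun ln (A i)) + norm (mat_fun ln (A i))"
      using norm_triangle_ineq [of "mat_fun ln Y - mat_fun ln (A i)" "mat_fun ln (A i)"] by simp
    ultimately show ?thesis using norm_log_diff_le_riem_dist [OF Y A, of i] big by linarith
  qed
  have "(sqrt D + 1)\<^sup>2 = D + 2 * sqrt D + 1" using D by (simp add: power2_eq_square algebra_simps)
  then have "D < (sqrt D + 1)\<^sup>2" using real_sqrt_ge_zero [OF D] by linarith
  also have "(sqrt D + 1)\<^sup>2 = (\<Sum>i\<in>UNIV. w $ i) * (sqrt D + 1)\<^sup>2" by (simp add: weight_sum)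
  also have "\<dots> = (\<Sum>i\<in>UNIV. w $ i * (sqrt D + 1)\<^sup>2)" by (rule sum_distrib_right)
  also have "\<dots> \<le> cost w A Y"
    unfolding cost_def using D by (intro sum_mono mult_left_mono power_mono far weight_nonneg) auto
  also have "\<dots> \<le> cost w A (mat 1)" by (rule le)
  also have "\<dots> \<le> D"
  proof -
    have "w $ i \<le> 1" for i
      using member_le_sum [of i UNIV "\<lambda>i. w $ i"] weight_nonneg weight_sum by simp
    then have "w $ i * (riem_dist (mat 1) (A i))\<^sup>2 \<le> 1 * (riem_dist (mat 1) (A i))\<^sup>2" for i
      by (intro mult_right_mono) auto
    then show ?thesis unfolding cost_def D_def by (intro sum_mono) simp
  qed
  finally show False by simp
qed

lemma cost_minimizer_exists:
  obtains X where "X \<in> pd_matrices" "\<And>Y. Y \<in> pd_matrices \<Longrightarrow> cost w A X \<le> cost w A Y"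
proof -
  have cont: "continuous_on (hermitian_ball (log_radius A)) (\<lambda>K. cost w A (mat_fun exp K))"
    unfolding cost_def
    by (intro continuous_on_sum continuous_on_mult continuous_on_const continuous_on_power continuous_on_riem_dist_exp A)
  have "0 \<le> log_radius A" by (simp add: log_radius_def add_nonneg_nonneg sum_nonneg)
  then have zero: "0 \<in> hermitian_ball (log_radius A)"
    using adjoint_scaleR [of 0 0] by (simp add: hermitian_ball_def hermitian_def)
  then obtain K where K: "K \<in> hermitian_ball (log_radius A)"
    and min: "\<And>L. L \<in> hermitian_ball (log_radius A) \<Longrightarrow> cost w A (mat_fun exp K) \<le> cost w A (mat_fun exp L)"
    using continuous_attains_inf [OF compact_hermitian_ball _ cont] by blast
  have "cost w A (mat_fun exp K) \<le> cost w A Y" if Y: "Y \<in> pd_matrices" for Y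
  proof (cases "cost w A Y \<le> cost w A (mat 1)")
    case True
    then have "mat_fun ln Y \<in> hermitian_ball (log_radius A)"
      using norm_log_le_if_cost_le [OF Y] by (simp add: hermitian_ball_def hermitian_mat_fun pd_hermitian Y)
    from min [OF this] show ?thesis by (simp add: exp_log Y)
  next
    case False
    with min [OF zero] show ?thesis by (simp add: mat_fun_zero)
  qed
  moreover have "mat_fun exp K \<in> pd_matrices" using K by (simp add: pd_exp hermitian_ball_def)
  ultimately show ?thesis using that by blast
qed

text \<open>A minimiser exists by compactness in the space of logarithms and is critical; the variance inequality at a critical
  point makes it the only minimiser.\<close>

theorem geometric_mean_karcher:
  shows "karcher w A (geometric_mean w A)" and "norm (mat_fun ln (geometric_mean w A)) \<le> log_radius A"
proof -
  obtain X where X: "X \<in> pd_matrices" and min: "\<And>Y. Y \<in> pd_matrices \<Longrightarrow> cost w A X \<le> cost w A Y"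
    using cost_minimizer_exists by blast
  have kX: "karcher w A X" by (rule minimizer_karcher [OF X min])
  have "geometric_mean w A = X"
    unfolding geometric_mean_def cost_def [symmetric]
  proof (rule the_equality)
    show "is_arg_min (\<lambda>X. cost w A X) (\<lambda>X. X \<in> pd_matrices) X"
      using X min by (auto simp: is_arg_min_def not_less)
  next
    fix Y assume "is_arg_min (\<lambda>X. cost w A X) (\<lambda>X. X \<in> pd_matrices) Y"
    then have Y: "Y \<in> pd_matrices" "cost w A Y \<le> cost w A X" using X by (auto simp: is_arg_min_def not_less)
    then have "(riem_dist X Y)\<^sup>2 \<le> 0" using variance_inequality [OF kX Y(1)] by linarith
    from antisym [OF this zero_le_power2] show "Y = X" using riem_dist_eq_0 [OF X Y(1)] by simp
  qed
  then show "karcher w A (geometric_mean w A)" "norm (mat_fun ln (geometric_mean w A)) \<le> log_radius A"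
    using kX norm_log_le_if_cost_le [OF X min [OF pd_one]] by simp_all
qed

lemma geometric_mean_pd: "geometric_mean w A \<in> pd_matrices"
  using geometric_mean_karcher(1) by (simp add: karcher_def)

text \<open>Write \<open>K = log G\<close> and \<open>H\<^sub>i = log (G\<^sup>-\<^sup>1\<^sup>/\<^sup>2 A\<^sub>i G\<^sup>-\<^sup>1\<^sup>/\<^sup>2)\<close>. The weighted mean of the \<open>H\<^sub>i\<close> vanishes, so \<open>K\<close> is the
  weighted mean of the \<open>K + H\<^sub>i = log e\<^sup>H\<^sup>i - log G\<inverse>\<close>, each of which is majorized by
  \<open>log (G\<^sup>1\<^sup>/\<^sup>2 e\<^sup>H\<^sup>i G\<^sup>1\<^sup>/\<^sup>2) = log A\<^sub>i\<close>.\<close>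

theorem log_geometric_mean_majorized:
  obtains T where "\<And>i. T i \<in> unitary_hull (mat_fun ln (A i))"
    "mat_fun ln (geometric_mean w A) = (\<Sum>i\<in>UNIV. w $ i *\<^sub>R T i)"
proof -
  define G where "G = geometric_mean w A"
  have G: "G \<in> pd_matrices" unfolding G_def by (rule geometric_mean_pd)
  define B where "B i = inv_root_mat G ** A i ** inv_root_mat G" for i
  define T where "T i = mat_fun ln (B i) + mat_fun ln G" for i
  have B: "B i \<in> pd_matrices" for i unfolding B_def by (rule pd_inv_root_conj [OF G A])
  define J where "J = mat_fun inverse G"
  have J: "J \<in> pd_matrices" unfolding J_def using G by (rule pd_mat_fun) simp
  have lnJ: "mat_fun ln J = - mat_fun ln G"
  proof -
    have "mat_fun ln J = mat_fun (\<lambda>x. - 1 * ln x) G"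
      unfolding J_def using G
      by (simp add: mat_fun_comp pd_hermitian) (rule mat_fun_cong [of G "{0<..}"], auto simp: pd_iff ln_inverse)
    also have "\<dots> = - 1 *\<^sub>R mat_fun ln G" by (rule mat_fun_scaleR [symmetric, OF pd_hermitian [OF G]])
    finally show ?thesis by simp
  qed
  have rootJ: "inv_root_mat J = root_mat G"
    unfolding J_def inv_root_mat_def root_mat_def using G
    by (simp add: mat_fun_comp pd_hermitian)
      (rule mat_fun_cong [of G "{0<..}"], auto simp: pd_iff powr_minus inverse_powr)
  have "T i \<in> unitary_hull (mat_fun ln (A i))" for i
  proof -
    have "mat_fun ln (B i) - mat_fun ln J \<in> unitary_hull (mat_fun ln (root_mat G ** B i ** root_mat G))"
      using log_diff_majorized [OF B J] by (simp add: rootJ)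
    moreover have "root_mat G ** B i ** root_mat G = A i"
      by (simp add: B_def matrix_mul_assoc inv_root_root_cancel G)
    ultimately show ?thesis by (simp add: T_def lnJ)
  qed
  moreover have "mat_fun ln G = (\<Sum>i\<in>UNIV. w $ i *\<^sub>R T i)"
  proof -
    have "(\<Sum>i\<in>UNIV. w $ i *\<^sub>R T i) = (\<Sum>i\<in>UNIV. w $ i *\<^sub>R mat_fun ln (B i)) + (\<Sum>i\<in>UNIV. w $ i) *\<^sub>R mat_fun ln G"
      by (simp add: T_def scaleR_add_right sum.distrib scaleR_sum_left)
    then show ?thesis
      using geometric_mean_karcher(1) by (simp add: karcher_def B_def G_def weight_sum)
  qed
  ultimately show ?thesis unfolding G_def by (rule that)
qed

end

text \<open>Adding the variance inequalities at the two means gives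
  \<open>2 \<delta>(G\<^sub>v, G\<^sub>w)\<^sup>2 \<le> \<Sum>\<^sub>i (v\<^sub>i - w\<^sub>i) (\<delta>(G\<^sub>w, A\<^sub>i)\<^sup>2 - \<delta>(G\<^sub>v, A\<^sub>i)\<^sup>2)\<close>, and the distances are bounded.\<close>

theorem continuous_on_geometric_mean:
  fixes A :: "'m::finite \<Rightarrow> complex^'n^'n"
  assumes A: "\<And>i. A i \<in> pd_matrices"
  shows "continuous_on weight_simplex (\<lambda>w. geometric_mean w A)"
proof -
  let ?G = "\<lambda>w. geometric_mean w A"
  let ?B = "hermitian_ball (log_radius A) :: (complex^'n^'n) set"
  have in_ball: "mat_fun ln (?G w) \<in> ?B" if "w \<in> weight_simplex" for w
    using geometric_mean_karcher(2) [OF A that] geometric_mean_pd [OF A that]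
    by (simp add: hermitian_ball_def hermitian_mat_fun pd_hermitian)
  have "\<exists>D. \<forall>K\<in>?B. (riem_dist (mat_fun exp K) (A i))\<^sup>2 \<le> D" for i
  proof -
    have "continuous_on ?B (\<lambda>K. (riem_dist (mat_fun exp K) (A i))\<^sup>2)"
      by (intro continuous_on_power continuous_on_riem_dist_exp A)
    then have "bounded ((\<lambda>K. (riem_dist (mat_fun exp K) (A i))\<^sup>2) ` ?B)"
      by (intro compact_imp_bounded compact_continuous_image compact_hermitian_ball)
    then show ?thesis by (auto simp: bounded_iff)
  qed
  then obtain D where D: "\<And>i K. K \<in> ?B \<Longrightarrow> (riem_dist (mat_fun exp K) (A i))\<^sup>2 \<le> D i" by metis
  have D': "(riem_dist (?G w) (A i))\<^sup>2 \<le> D i" if "w \<in> weight_simplex" for w i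
    using D [OF in_ball [OF that], of i] by (simp add: exp_log geometric_mean_pd [OF A that])
  define c where "c = (\<Sum>i\<in>UNIV. D i)"
  have est: "(norm (mat_fun ln (?G v) - mat_fun ln (?G w)))\<^sup>2 \<le> c * norm (v - w)"
    if v: "v \<in> weight_simplex" and w: "w \<in> weight_simplex" for v w
  proof -
    note G = geometric_mean_pd [OF A v] geometric_mean_pd [OF A w]
    note K = geometric_mean_karcher(1) [OF A v] geometric_mean_karcher(1) [OF A w]
    let ?d = "riem_dist (?G v) (?G w)"
    have "cost v A (?G v) + ?d\<^sup>2 \<le> cost v A (?G w)" by (rule variance_inequality [OF A v K(1) G(2)])
    moreover have "cost w A (?G w) + ?d\<^sup>2 \<le> cost w A (?G v)"
      using variance_inequality [OF A w K(2) G(1)] riem_dist_sym [OF G] by simp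
    ultimately have "2 * ?d\<^sup>2 \<le> (cost v A (?G w) - cost w A (?G w)) + (cost w A (?G v) - cost v A (?G v))"
      by linarith
    also have "\<dots> = (\<Sum>i\<in>UNIV. (v $ i - w $ i) * ((riem_dist (?G w) (A i))\<^sup>2 - (riem_dist (?G v) (A i))\<^sup>2))"
      by (simp add: cost_def sum_subtractf [symmetric] sum.distrib [symmetric] algebra_simps)
    also have "\<dots> \<le> (\<Sum>i\<in>UNIV. norm (v - w) * D i)"
    proof (intro sum_mono)
      fix i
      have "(v $ i - w $ i) * ((riem_dist (?G w) (A i))\<^sup>2 - (riem_dist (?G v) (A i))\<^sup>2)
          \<le> \<bar>(v - w) $ i\<bar> * \<bar>(riem_dist (?G w) (A i))\<^sup>2 - (riem_dist (?G v) (A i))\<^sup>2\<bar>"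
        by (metis abs_ge_self abs_mult vector_minus_component)
      also have "\<dots> \<le> norm (v - w) * D i"
      proof (rule mult_mono)
        show "\<bar>(v - w) $ i\<bar> \<le> norm (v - w)" by (rule component_le_norm_cart)
        have "0 \<le> (riem_dist (?G w) (A i))\<^sup>2" "0 \<le> (riem_dist (?G v) (A i))\<^sup>2" by simp_all
        then show "\<bar>(riem_dist (?G w) (A i))\<^sup>2 - (riem_dist (?G v) (A i))\<^sup>2\<bar> \<le> D i"
          using D' [OF v, of i] D' [OF w, of i] by linarith
      qed auto
      finally show "(v $ i - w $ i) * ((riem_dist (?G w) (A i))\<^sup>2 - (riem_dist (?G v) (A i))\<^sup>2) \<le> norm (v - w) * D i" .
    qed
    also have "\<dots> = c * norm (v - w)" by (simp only: c_def sum_distrib_right mult.commute [of "norm (v - w)"])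
    finally have "2 * ?d\<^sup>2 \<le> c * norm (v - w)" .
    moreover have "(norm (mat_fun ln (?G v) - mat_fun ln (?G w)))\<^sup>2 \<le> ?d\<^sup>2"
      by (intro power_mono norm_log_diff_le_riem_dist G) simp
    moreover have "0 \<le> ?d\<^sup>2" by simp
    ultimately show ?thesis by linarith
  qed
  have "continuous_on weight_simplex (\<lambda>w. mat_fun ln (?G w))"
    unfolding continuous_on_iff
  proof (intro ballI allI impI)
    fix v :: "real^'m" and e :: real assume v: "v \<in> weight_simplex" and e: "e > 0"
    have "\<bar>c\<bar> + 1 > 0" by simp
    show "\<exists>d>0. \<forall>w\<in>weight_simplex. dist w v < d \<longrightarrow> dist (mat_fun ln (?G w)) (mat_fun ln (?G v)) < e"
    proof (intro exI conjI ballI impI)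
      show "e\<^sup>2 / (\<bar>c\<bar> + 1) > 0" using e \<open>\<bar>c\<bar> + 1 > 0\<close> by simp
      fix w assume w: "w \<in> weight_simplex" and d: "dist w v < e\<^sup>2 / (\<bar>c\<bar> + 1)"
      have "(norm (mat_fun ln (?G w) - mat_fun ln (?G v)))\<^sup>2 \<le> c * norm (w - v)" by (rule est [OF w v])
      also have "\<dots> \<le> (\<bar>c\<bar> + 1) * norm (w - v)" by (intro mult_right_mono) auto
      also have "\<dots> < e\<^sup>2" using d \<open>\<bar>c\<bar> + 1 > 0\<close> by (simp add: dist_norm field_simps)
      finally show "dist (mat_fun ln (?G w)) (mat_fun ln (?G v)) < e"
        unfolding dist_norm by (rule power2_less_imp_less) (use e in simp)
    qed
  qed
  then have "continuous_on weight_simplex (\<lambda>w. mat_fun exp (mat_fun ln (?G w)))"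
    by (rule continuous_on_compose2 [OF continuous_on_mat_fun_exp [of "log_radius A"]]) (use in_ball in blast)
  then show ?thesis by (simp add: exp_log geometric_mean_pd [OF A] cong: continuous_on_cong)
qed

section \<open>Convexity on intervals\<close>

text \<open>Subtract the chord. At the leftmost maximiser of the difference, midpoint convexity forces the maximum
  to be attained further left unless that maximiser is an endpoint.\<close>

lemma convex_on_if_midpoint_convex:
  fixes f :: "real \<Rightarrow> real"
  assumes cont: "continuous_on {p..q} f"
    and mid: "\<And>x y. x \<in> {p..q} \<Longrightarrow> y \<in> {p..q} \<Longrightarrow> f ((x + y) / 2) \<le> (f x + f y) / 2"
  shows "convex_on {p..q} f"
proof (rule convex_onI)
  fix t x y :: real assume t: "0 < t" "t < 1" and x: "x \<in> {p..q}" and y: "y \<in> {p..q}"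
  define l where "l s = (1 - s) * x + s * y" for s
  define g where "g s = f (l s) - (1 - s) * f x - s * f y" for s
  have l_in: "l s \<in> {p..q}" if "s \<in> {0..1}" for s
    using convexD [of "{p..q}" x y "1 - s" s] that x y by (simp add: l_def)
  have l_cont: "continuous_on {0..1} l" unfolding l_def by (intro continuous_intros)
  have g_cont: "continuous_on {0..1} g"
    unfolding g_def by (intro continuous_intros continuous_on_compose2 [OF cont l_cont]) (use l_in in blast)
  obtain m where m: "m \<in> {0..1}" and max: "\<And>s. s \<in> {0..1} \<Longrightarrow> g s \<le> g m"
    using continuous_attains_sup [OF compact_Icc _ g_cont] by auto
  have g01: "g 0 = 0" "g 1 = 0" by (simp_all add: g_def l_def)
  have "g m \<le> 0"
  proof (rule ccontr)
    assume "\<not> g m \<le> 0"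
    have "closed {s \<in> {0..1}. g s \<in> {g m}}"
      using continuous_closed_preimage [OF g_cont, of "{g m}"] by (simp add: vimage_def Int_def)
    then have "compact {s \<in> {0..1}. g s \<in> {g m}}"
      by (simp add: compact_eq_bounded_closed bounded_subset [OF bounded_closed_interval [of 0 1]] subset_iff)
    moreover have "{s \<in> {0..1}. g s \<in> {g m}} \<noteq> {}" using m by auto
    ultimately obtain s where s: "s \<in> {0..1}" "g s = g m" and least: "\<And>r. r \<in> {0..1} \<Longrightarrow> g r = g m \<Longrightarrow> s \<le> r"
      using continuous_attains_inf [of "{s \<in> {0..1}. g s \<in> {g m}}" "\<lambda>s. s"] by (auto intro: continuous_on_id)
    have "s \<noteq> 0" "s \<noteq> 1" using s g01 \<open>\<not> g m \<le> 0\<close> by auto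
    then have s01: "0 < s" "s < 1" using s(1) by auto
    \<comment> \<open>The largest symmetric step that stays in the interval.\<close>
    define h where "h = min s (1 - s)"
    have h: "h > 0" "s - h \<in> {0..1}" "s + h \<in> {0..1}" using s01 by (auto simp: h_def min_def)
    have "l s = (l (s - h) + l (s + h)) / 2" by (simp add: l_def field_simps)
    then have "f (l s) \<le> (f (l (s - h)) + f (l (s + h))) / 2" using mid l_in h by metis
    then have "2 * g s \<le> g (s - h) + g (s + h)" by (simp add: g_def field_simps)
    moreover have "g (s + h) \<le> g s" using max [OF h(3)] s(2) by simp
    moreover have "g (s - h) < g s"
    proof -
      have "g (s - h) \<noteq> g m" using least [OF h(2)] h(1) by auto
      then show ?thesis using max [OF h(2)] s(2) by simp
    qed
    ultimately show False by linarith
  qed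
  then have "g t \<le> 0" using max [of t] t by simp
  then show "f ((1 - t) *\<^sub>R x + t *\<^sub>R y) \<le> (1 - t) * f x + t * f y" by (simp add: g_def l_def)
qed simp

text \<open>Where \<open>h\<close> is positive this is convexity of \<open>t \<mapsto> log h(e\<^sup>t)\<close>, in the midpoint form in which doubly convex functions
  are given.\<close>

definition geometrically_convex_on :: "real set \<Rightarrow> (real \<Rightarrow> real) \<Rightarrow> bool" where
  "geometrically_convex_on I h \<longleftrightarrow> continuous_on I h \<and> (\<forall>x\<in>I. \<forall>y\<in>I. h (sqrt (x * y)) \<le> sqrt (h x * h y))"

lemma convex_on_ln_exp:
  assumes h: "geometrically_convex_on {a..b} h" and a: "0 < a" "a \<le> b"
    and pos: "\<And>x. x \<in> {a..b} \<Longrightarrow> 0 < h x"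
  shows "convex_on {ln a..ln b} (\<lambda>t. ln (h (exp t)))"
proof -
  have e: "exp t \<in> {a..b}" if "t \<in> {ln a..ln b}" for t
    using that a by (metis atLeastAtMost_iff exp_le_cancel_iff exp_ln order_less_le_trans)
  show ?thesis
  proof (rule convex_on_if_midpoint_convex)
    have "continuous_on {a..b} h" using h by (simp add: geometrically_convex_on_def)
    then have "continuous_on {ln a..ln b} (\<lambda>t. h (exp t))"
      by (rule continuous_on_compose2 [OF _ continuous_on_exp [OF continuous_on_id]]) (use e in blast)
    moreover have "h (exp t) \<noteq> 0" if "t \<in> {ln a..ln b}" for t using pos [OF e [OF that]] by simp
    ultimately show "continuous_on {ln a..ln b} (\<lambda>t. ln (h (exp t)))"
      by (intro continuous_on_ln) blast+
  next
    fix s t assume s: "s \<in> {ln a..ln b}" and t: "t \<in> {ln a..ln b}"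
    have "sqrt (exp s * exp t) = exp ((s + t) / 2)"
    proof (rule real_sqrt_unique)
      show "(exp ((s + t) / 2))\<^sup>2 = exp s * exp t" by (simp add: power2_eq_square flip: exp_add)
    qed simp
    then have "h (exp ((s + t) / 2)) \<le> sqrt (h (exp s) * h (exp t))"
      using h e [OF s] e [OF t] by (metis geometrically_convex_on_def)
    moreover have "0 < h (exp ((s + t) / 2))" using s t by (intro pos e) auto
    ultimately have "ln (h (exp ((s + t) / 2))) \<le> ln (sqrt (h (exp s) * h (exp t)))"
      using pos [OF e [OF s]] pos [OF e [OF t]] by (subst ln_le_cancel_iff) auto
    also have "\<dots> = (ln (h (exp s)) + ln (h (exp t))) / 2"
      using pos [OF e [OF s]] pos [OF e [OF t]] by (simp add: ln_sqrt ln_mult)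
    finally show "ln (h (exp ((s + t) / 2))) \<le> (ln (h (exp s)) + ln (h (exp t))) / 2" .
  qed
qed

lemma convex_on_exp_comp:
  assumes "convex_on I f"
  shows "convex_on I (\<lambda>t. exp (f t :: real))"
proof (rule convex_onI)
  show "convex I" using assms by (rule convex_on_imp_convex)
  fix t x y assume t: "0 < (t :: real)" "t < 1" and x: "x \<in> I" and y: "y \<in> I"
  have "exp (f ((1 - t) *\<^sub>R x + t *\<^sub>R y)) \<le> exp ((1 - t) *\<^sub>R f x + t *\<^sub>R f y)"
    using convex_onD [OF assms, of t x y] t x y by simp
  also have "\<dots> \<le> (1 - t) * exp (f x) + t * exp (f y)"
    using convex_onD [OF exp_convex, of t "f x" "f y"] t by simp
  finally show "exp (f ((1 - t) *\<^sub>R x + t *\<^sub>R y)) \<le> (1 - t) * exp (f x) + t * exp (f y)" .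
qed

text \<open>The zero of \<open>g\<close> closest to \<open>y\<close> is \<open>y\<close> itself: geometric means with \<open>y\<close> of a zero are zeros.\<close>

lemma geometrically_convex_zero:
  assumes g: "geometrically_convex_on {a..b} g" and a: "0 < a" and nonneg: "\<And>x. x \<in> {a..b} \<Longrightarrow> 0 \<le> g x"
    and z: "z \<in> {a..b}" "g z = 0" and y: "y \<in> {a..b}"
  shows "g y = 0"
proof -
  define Z where "Z = {x \<in> {a..b}. g x \<in> {0}}"
  have "continuous_on {a..b} g" using g by (simp add: geometrically_convex_on_def)
  then have "closed Z"
    using continuous_closed_preimage [of "{a..b}" g "{0}"] by (simp add: Z_def vimage_def Int_def)
  then obtain c where c: "c \<in> Z" and least: "\<And>x. x \<in> Z \<Longrightarrow> dist y c \<le> dist y x"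
    using distance_attains_inf [of Z y] z by (auto simp: Z_def)
  have cz: "c \<in> {a..b}" "g c = 0" using c by (auto simp: Z_def)
  have "c = y"
  proof (rule ccontr)
    assume ne: "c \<noteq> y"
    define r where "r = sqrt (c * y)"
    have cy: "0 < c" "0 < y" using cz y a by auto
    have r: "min c y < r" "r < max c y"
    proof -
      have "min c y * min c y < c * y" "c * y < max c y * max c y"
        using ne cy by (auto simp: min_def max_def intro: mult_strict_left_mono mult_strict_right_mono)
      then show "min c y < r" "r < max c y"
        using cy by (auto simp: r_def intro!: real_less_rsqrt real_less_lsqrt simp: power2_eq_square)
    qed
    then have rab: "r \<in> {a..b}" using cz y by (auto simp: min_def max_def split: if_splits)
    have "g r \<le> sqrt (g c * g y)"
      using g cz y unfolding r_def geometrically_convex_on_def by blast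
    then have "g r = 0" using nonneg [OF rab] cz by simp
    then have "dist y c \<le> dist y r" using rab by (intro least) (simp add: Z_def)
    then show False using r by (auto simp: dist_real_def min_def max_def split: if_splits)
  qed
  then show ?thesis using cz by simp
qed

lemma (in prob_space) jensen_interval:
  fixes g X :: "_ \<Rightarrow> real"
  assumes X: "integrable M X" "\<And>w. w \<in> space M \<Longrightarrow> X w \<in> {a..b}"
    and g: "convex_on {a..b} g" "integrable M (\<lambda>w. g (X w))"
  shows "expectation X \<in> {a..b}" and "g (expectation X) \<le> expectation (\<lambda>w. g (X w))"
proof -
  have ge: "a \<le> expectation X" and le: "expectation X \<le> b"
    using X by (auto intro!: integral_ge_const integral_le_const)
  then show "expectation X \<in> {a..b}" by simp
  \<comment> \<open>The mean is an endpoint only if the variable is constant; there the slope of \<open>g\<close> may be infinite.\<close>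
  have const: "g (expectation X) \<le> expectation (\<lambda>w. g (X w))" if "AE w in M. X w = expectation X"
  proof -
    have "expectation (\<lambda>w. g (X w)) = expectation (\<lambda>w. g (expectation X))"
      using that g(2) by (intro integral_cong_AE) auto
    then show ?thesis using prob_space by simp
  qed
  consider "expectation X = a" | "expectation X = b" | "expectation X \<in> {a<..<b}"
    using ge le by fastforce
  then show "g (expectation X) \<le> expectation (\<lambda>w. g (X w))"
  proof cases
    case 1
    then have "expectation (\<lambda>w. X w - a) = 0" using X prob_space by simp
    then have "AE w in M. X w - a = 0"
      using X by (subst (asm) integral_nonneg_eq_0_iff_AE) auto
    then show ?thesis using 1 by (intro const) auto
  next
    case 2
    then have "expectation (\<lambda>w. b - X w) = 0" using X prob_space by simp
    then have "AE w in M. b - X w = 0"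
      using X by (subst (asm) integral_nonneg_eq_0_iff_AE) auto
    then show ?thesis using 2 by (intro const) auto
  next
    case 3
    let ?x = "expectation X"
    obtain s where s: "\<And>y. y \<in> {a..b} \<Longrightarrow> g ?x + s * (y - ?x) \<le> g y"
      using convex_le_Inf_differential [OF g(1), of ?x] 3 by (auto simp: interior_atLeastAtMost_real)
    have "g ?x = expectation (\<lambda>w. g ?x + s * (X w - ?x))" using X(1) prob_space by simp
    also have "\<dots> \<le> expectation (\<lambda>w. g (X w))"
      using X g(2) s by (intro integral_mono) auto
    finally show ?thesis .
  qed
qed

text \<open>The integrand of the scalar geodesic mean.\<close>

abbreviation weighted_product :: "real^'m \<Rightarrow> ('m::finite \<Rightarrow> real) \<Rightarrow> real" where
  "weighted_product w c \<equiv> \<Prod>i\<in>UNIV. if w $ i = 0 then 1 else c i powr (w $ i)"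

lemma conj_spectral_self: "unitary U \<Longrightarrow> adjoint_mat U ** spectral_mat U d ** U = diag_mat d"
  by (simp add: spectral_mat_def matrix_mul_assoc unitaryD unitary_cancel)

section \<open>The geometric mean in its eigenbasis\<close>

lemma ln_hermitian_on:
  assumes "A \<in> hermitian_on {a..b}" "0 < a"
  shows "mat_fun ln A \<in> hermitian_on {ln a..ln b}"
  using assms by (intro mat_fun_in) auto

lemma exp_in_interval: "0 < a \<Longrightarrow> a \<le> b \<Longrightarrow> t \<in> {ln a..ln b} \<Longrightarrow> exp t \<in> {a..b}" for a b t :: real
  by (metis atLeastAtMost_iff exp_le_cancel_iff exp_ln order_less_le_trans)

lemma interval_nonempty_if_hermitian_on:
  fixes A :: "complex^'n^'n"
  assumes "A \<in> hermitian_on {a..b}"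
  shows "a \<le> b"
proof -
  obtain d :: "real^'n" where "\<And>j. d $ j \<in> {a..b}" using hermitian_onE [OF assms] by metis
  from this [of undefined] show ?thesis by simp
qed

text \<open>Let \<open>x\<^sub>j\<close> be the eigenvalues of the mean and \<open>\<kappa>\<^sub>i\<^sub>j\<close> the diagonal, in its eigenbasis, of the matrix that is
  majorized by \<open>log A\<^sub>i\<close>. The interval has to contain only the spectra
  that enter with positive weight: in the concave case the function may vanish on the others.\<close>

lemma geometric_mean_eigenbasis:
  fixes A :: "'m::finite \<Rightarrow> complex^'n^'n"
  assumes A: "\<And>i. A i \<in> pd_matrices" and w: "w \<in> weight_simplex"
    and Aab: "\<And>i. w $ i \<noteq> 0 \<Longrightarrow> A i \<in> hermitian_on {a..b}" and a: "0 < a"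
  obtains U x \<kappa> where "unitary U" "geometric_mean w A = spectral_mat U x" "a \<le> b"
    "\<And>j. x $ j \<in> {a..b}" "\<And>i j. w $ i \<noteq> 0 \<Longrightarrow> \<kappa> i j \<in> {ln a..ln b}"
    "\<And>j. ln (x $ j) = (\<Sum>i | w $ i \<noteq> 0. w $ i *\<^sub>R \<kappa> i j)"
    "\<And>N k i. ui_seminorm N \<Longrightarrow> convex_on {ln a..ln b} k \<Longrightarrow> (\<And>t. t \<in> {ln a..ln b} \<Longrightarrow> 0 \<le> k t) \<Longrightarrow>
      w $ i \<noteq> 0 \<Longrightarrow> N (diag_mat (\<chi> j. k (\<kappa> i j))) \<le> N (mat_fun (\<lambda>x. k (ln x)) (A i))"
proof -
  define G where "G = geometric_mean w A"
  define I where "I = {i. w $ i \<noteq> 0}"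
  have w0: "0 \<le> w $ i" for i using weight_nonneg [OF A w] .
  have w1: "(\<Sum>i\<in>I. w $ i) = 1"
    using weight_sum [OF A w] unfolding I_def by (subst sum.mono_neutral_left [of UNIV]) auto
  have ne: "I \<noteq> {}" using w1 by auto
  have Gpd: "G \<in> pd_matrices" unfolding G_def by (rule geometric_mean_pd [OF A w])
  obtain T where T: "\<And>i. T i \<in> unitary_hull (mat_fun ln (A i))" and lnG: "mat_fun ln G = (\<Sum>i\<in>UNIV. w $ i *\<^sub>R T i)"
    by (rule log_geometric_mean_majorized [where A = A, OF A w, folded G_def]) (rule that)
  obtain U x where U: "unitary U" and Gx: "G = spectral_mat U x" and x: "\<And>j. 0 < x $ j"
    using hermitian_onE [OF Gpd [unfolded pd_iff]] by auto
  define \<kappa> where "\<kappa> i j = diag_entry U (T i) j" for i j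
  have lnx: "ln (x $ j) = (\<Sum>i\<in>I. w $ i *\<^sub>R \<kappa> i j)" for j
  proof -
    have "adjoint_mat U ** mat_fun ln G ** U = diag_mat (\<chi> j. ln (x $ j))"
      by (simp only: Gx mat_fun_spectral [OF U] conj_spectral_self [OF U])
    then have "ln (x $ j) = diag_entry U (\<Sum>i\<in>UNIV. w $ i *\<^sub>R T i) j"
      unfolding lnG by (simp add: diag_mat_nth)
    also have "\<dots> = (\<Sum>i\<in>UNIV. w $ i *\<^sub>R \<kappa> i j)"
      by (simp add: matmul.sum_left matmul.sum_right matmul.scaleR_left matmul.scaleR_right \<kappa>_def)
    also have "\<dots> = (\<Sum>i\<in>I. w $ i *\<^sub>R \<kappa> i j)"
      by (rule sum.mono_neutral_right) (auto simp: I_def)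
    finally show ?thesis .
  qed
  obtain i0 where "w $ i0 \<noteq> 0" using ne by (auto simp: I_def)
  then have ab: "a \<le> b" using interval_nonempty_if_hermitian_on Aab by blast
  have lnA: "mat_fun ln (A i) \<in> hermitian_on {ln a..ln b}" if "w $ i \<noteq> 0" for i
    using that by (intro ln_hermitian_on Aab a)
  have zero: "convex_on {ln a..ln b} (\<lambda>t. 0 :: real)" by (simp add: convex_on_def)
  have \<kappa>in: "\<kappa> i j \<in> {ln a..ln b}" if "w $ i \<noteq> 0" for i j
    unfolding \<kappa>_def
    by (rule ui_seminorm.diagonal_le_of_unitary_hull(1) [OF ui_seminorm_norm lnA [OF that] zero order_refl T U])
  have "ln (x $ j) \<in> {ln a..ln b}" for j
    unfolding lnx by (rule convex_sum) (use w1 w0 \<kappa>in in \<open>auto simp: I_def\<close>)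
  then have xin: "x $ j \<in> {a..b}" for j using exp_in_interval [OF a ab, of "ln (x $ j)"] x [of j] by simp
  have le: "N (diag_mat (\<chi> j. k (\<kappa> i j))) \<le> N (mat_fun (\<lambda>x. k (ln x)) (A i))"
    if N: "ui_seminorm N" and k: "convex_on {ln a..ln b} k" "\<And>t. t \<in> {ln a..ln b} \<Longrightarrow> 0 \<le> k t" and i: "w $ i \<noteq> 0"
    for N k i
    using ui_seminorm.diagonal_le_of_unitary_hull(2) [OF N lnA [OF i] k T U] A [of i]
    by (simp add: \<kappa>_def mat_fun_comp pd_hermitian)
  show ?thesis
    using that [OF U Gx [unfolded G_def] ab xin \<kappa>in lnx [unfolded I_def] le] .
qed

lemma geometric_mean_in_interval:
  fixes A :: "'m::finite \<Rightarrow> complex^'n^'n"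
  assumes "\<And>i. A i \<in> pd_matrices" "w \<in> weight_simplex"
    "\<And>i. w $ i \<noteq> 0 \<Longrightarrow> A i \<in> hermitian_on {a..b}" "0 < a"
  shows "geometric_mean w A \<in> hermitian_on {a..b}"
  by (rule geometric_mean_eigenbasis [where A = A, OF assms]) (auto intro: spectral_in)

section \<open>Symmetric norms of diagonal matrices\<close>

context
  fixes N :: "complex^'n^'n \<Rightarrow> real"
  assumes N: "symmetric_norm N"
begin

interpretation ui: ui_seminorm N by (rule ui_seminorm_symmetric_norm [OF N])

lemma symmetric_norm_pos: "A \<noteq> 0 \<Longrightarrow> 0 < N A"
  using N ui.nonneg [of A] by (auto simp: symmetric_norm_def less_le)

lemma symmetric_norm_diag_pos:
  assumes "\<And>j. 0 < u $ j"
  shows "0 < N (diag_mat u)"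
proof (rule symmetric_norm_pos)
  have "diag_mat u $ j $ j \<noteq> 0" for j using assms [of j] by (simp add: diag_mat_nth)
  then show "diag_mat u \<noteq> 0" by auto
qed

text \<open>After normalising all norms to \<open>1\<close>, the inequality between the weighted means bounds the geometric mean
  entrywise by an arithmetic mean of matrices of norm \<open>1\<close>.\<close>

lemma hoelder_diag:
  fixes u :: "'i \<Rightarrow> real^'n"
  assumes I: "finite I" and w: "\<And>i. i \<in> I \<Longrightarrow> 0 \<le> w i" "(\<Sum>i\<in>I. w i) = 1"
    and u: "\<And>i j. i \<in> I \<Longrightarrow> 0 < u i $ j"
  shows "N (diag_mat (\<chi> j. \<Prod>i\<in>I. u i $ j powr w i)) \<le> (\<Prod>i\<in>I. N (diag_mat (u i)) powr w i)"
proof -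
  define c where "c i = N (diag_mat (u i))" for i
  define P where "P = (\<Prod>i\<in>I. c i powr w i)"
  have c: "0 < c i" if "i \<in> I" for i unfolding c_def by (rule symmetric_norm_diag_pos [OF u [OF that]])
  have P: "0 \<le> P" unfolding P_def by (intro prod_nonneg) simp
  have ne: "I \<noteq> {}" using w(2) by auto
  have amgm: "(\<Prod>i\<in>I. u i $ j powr w i) \<le> P * (\<Sum>i\<in>I. w i * (u i $ j / c i))" for j
  proof -
    have "(\<Prod>i\<in>I. (u i $ j / c i) powr w i) = exp (\<Sum>i\<in>I. w i *\<^sub>R ln (u i $ j / c i))"
      unfolding exp_sum [OF I] by (rule prod.cong) (use u c in \<open>auto simp: powr_def less_imp_neq [THEN not_sym]\<close>)
    also have "\<dots> \<le> (\<Sum>i\<in>I. w i * exp (ln (u i $ j / c i)))"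
      by (rule convex_on_sum [OF I ne exp_convex w(2) w(1)]) auto
    also have "\<dots> = (\<Sum>i\<in>I. w i * (u i $ j / c i))"
      by (rule sum.cong) (use u c in auto)
    finally have "P * (\<Prod>i\<in>I. (u i $ j / c i) powr w i) \<le> P * (\<Sum>i\<in>I. w i * (u i $ j / c i))"
      using P by (rule mult_left_mono)
    moreover have "P * (\<Prod>i\<in>I. (u i $ j / c i) powr w i) = (\<Prod>i\<in>I. u i $ j powr w i)"
      unfolding P_def prod.distrib [symmetric]
      by (rule prod.cong) (use u c in \<open>auto simp: powr_divide less_imp_le less_imp_neq [THEN not_sym]\<close>)
    ultimately show ?thesis by simp
  qed
  have "N (diag_mat (\<chi> j. \<Prod>i\<in>I. u i $ j powr w i)) \<le> N (diag_mat (P *\<^sub>R (\<Sum>i\<in>I. (w i / c i) *\<^sub>R u i)))"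
  proof (rule ui.diag_mono)
    fix j
    show "0 \<le> (\<chi> j. \<Prod>i\<in>I. u i $ j powr w i) $ j" by (simp add: prod_nonneg)
    show "(\<chi> j. \<Prod>i\<in>I. u i $ j powr w i) $ j \<le> (P *\<^sub>R (\<Sum>i\<in>I. (w i / c i) *\<^sub>R u i)) $ j"
      using amgm [of j] by (simp add: sum_component mult.commute)
  qed
  also have "\<dots> = P * N (\<Sum>i\<in>I. (w i / c i) *\<^sub>R diag_mat (u i))"
    using P by (simp add: diag_scaleR diag_sum ui.scale)
  also have "\<dots> \<le> P * (\<Sum>i\<in>I. N ((w i / c i) *\<^sub>R diag_mat (u i)))"
    using P by (intro mult_left_mono ui.sum_le)
  also have "(\<Sum>i\<in>I. N ((w i / c i) *\<^sub>R diag_mat (u i))) = (\<Sum>i\<in>I. w i)"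
    by (rule sum.cong) (use w(1) c in \<open>auto simp: ui.scale c_def [symmetric] abs_of_nonneg less_imp_le less_imp_neq [THEN not_sym]\<close>)
  finally show ?thesis by (simp add: w(2) P_def c_def)
qed

text \<open>A supporting hyperplane at \<open>diag(v)\<close> of the ball of its norm, with the negative coefficients deleted.\<close>

lemma norming_functional:
  fixes v :: "real^'n"
  assumes v: "\<And>j. 0 \<le> v $ j"
  obtains y where "\<And>j. 0 \<le> y $ j" "(\<Sum>j\<in>UNIV. y $ j * v $ j) = N (diag_mat v)"
    "\<And>b. (\<And>j. 0 \<le> b $ j) \<Longrightarrow> (\<Sum>j\<in>UNIV. y $ j * b $ j) \<le> N (diag_mat b)"
proof (cases "N (diag_mat v) = 0")
  case True
  show ?thesis by (rule that [of 0]) (simp_all add: True ui.nonneg)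
next
  case False
  define r where "r = N (diag_mat v)"
  have r: "r > 0" using False ui.nonneg [of "diag_mat v"] by (simp add: r_def)
  define S where "S = {b :: real^'n. N (diag_mat b) < r}"
  have "convex S"
  proof (rule convexI)
    fix x y :: "real^'n" and s t :: real
    assume xy: "x \<in> S" "y \<in> S" and st: "0 \<le> s" "0 \<le> t" "s + t = 1"
    have "N (diag_mat (s *\<^sub>R x + t *\<^sub>R y)) \<le> s * N (diag_mat x) + t * N (diag_mat y)"
      using ui.triangle [of "s *\<^sub>R diag_mat x" "t *\<^sub>R diag_mat y"] st by (simp add: diag_add diag_scaleR ui.scale)
    also have "\<dots> < r" using xy st by (intro convex_bound_lt) (auto simp: S_def)
    finally show "s *\<^sub>R x + t *\<^sub>R y \<in> S" by (simp add: S_def)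
  qed
  moreover have "0 \<in> S" using r diag_scaleR [of 0 "0 :: real^'n"] by (simp add: S_def)
  moreover have "S \<inter> {v} = {}" by (auto simp: S_def r_def)
  ultimately obtain a \<beta> where a: "a \<noteq> 0" and "\<forall>x\<in>S. a \<bullet> x \<le> \<beta>" "\<beta> \<le> a \<bullet> v"
    using separating_hyperplane_sets [of S "{v}"] by auto
  then have aS: "a \<bullet> x \<le> a \<bullet> v" if "x \<in> S" for x using that by fastforce
  have av: "a \<bullet> v > 0"
  proof -
    define e where "e = r / (2 * (N (diag_mat a) + 1))"
    have Na: "0 \<le> N (diag_mat a)" by (rule ui.nonneg)
    have e: "e > 0" using r Na by (simp add: e_def)
    have "e * N (diag_mat a) < r"
    proof -
      have "e * N (diag_mat a) \<le> e * (N (diag_mat a) + 1)" using e by (intro mult_left_mono) auto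
      also have "\<dots> = r / 2" using Na by (simp add: e_def field_simps)
      finally show ?thesis using r by simp
    qed
    then have "e *\<^sub>R a \<in> S" using e by (simp add: S_def diag_scaleR ui.scale)
    from aS [OF this] have "e * (a \<bullet> a) \<le> a \<bullet> v" by simp
    moreover have "0 < e * (a \<bullet> a)" using e a by simp
    ultimately show ?thesis by linarith
  qed
  define y0 where "y0 = (r / (a \<bullet> v)) *\<^sub>R a"
  have y0v: "y0 \<bullet> v = r" using av by (simp add: y0_def)
  have y0: "y0 \<bullet> b \<le> N (diag_mat b)" for b
  proof (rule dense_ge)
    fix \<theta> assume \<theta>: "N (diag_mat b) < \<theta>"
    then have pos: "\<theta> > 0" using ui.nonneg [of "diag_mat b"] by linarith
    have "(r / \<theta>) *\<^sub>R b \<in> S" using r pos \<theta> by (simp add: S_def diag_scaleR ui.scale field_simps)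
    from aS [OF this] have "(r / \<theta>) * (a \<bullet> b) \<le> a \<bullet> v" by simp
    then show "y0 \<bullet> b \<le> \<theta>" using pos av by (simp add: y0_def field_simps)
  qed
  define y where "y = (\<chi> j. max 0 (y0 $ j))"
  have le: "(\<Sum>j\<in>UNIV. y $ j * b $ j) \<le> N (diag_mat b)" if b: "\<And>j. 0 \<le> b $ j" for b
  proof -
    have "(\<Sum>j\<in>UNIV. y $ j * b $ j) = y0 \<bullet> (\<chi> j. if 0 \<le> y0 $ j then b $ j else 0)"
      by (auto simp: inner_vec_def y_def max_def intro!: sum.cong)
    also have "\<dots> \<le> N (diag_mat (\<chi> j. if 0 \<le> y0 $ j then b $ j else 0))" by (rule y0)
    also have "\<dots> \<le> N (diag_mat b)" by (rule ui.diag_mono) (auto simp: b)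
    finally show ?thesis .
  qed
  have "r \<le> (\<Sum>j\<in>UNIV. y $ j * v $ j)"
    unfolding y0v [symmetric] by (auto simp: inner_vec_def y_def intro!: sum_mono mult_right_mono v)
  with le [OF v] have "(\<Sum>j\<in>UNIV. y $ j * v $ j) = N (diag_mat v)" by (simp add: r_def)
  with le show ?thesis by (intro that [of y]) (auto simp: y_def)
qed


text \<open>With \<open>x\<^sub>j\<close> and \<open>\<kappa>\<^sub>i\<^sub>j\<close> as above, \<open>log x\<^sub>j = \<Sum>\<^sub>i w\<^sub>i \<kappa>\<^sub>i\<^sub>j\<close> gives \<open>h(x\<^sub>j) \<le> \<Prod>\<^sub>i h(e\<^sup>\<kappa>\<^sup>i\<^sup>j)\<^sup>w\<^sup>i\<close>. Hoelder's inequality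
  and the majorization of \<open>(\<kappa>\<^sub>i\<^sub>j)\<^sub>j\<close> by the spectrum of \<open>log A\<^sub>i\<close> finish the proof.\<close>

theorem norm_fun_geometric_mean_le:
  fixes A :: "'m::finite \<Rightarrow> complex^'n^'n"
  assumes A: "\<And>i. A i \<in> pd_matrices" and w: "w \<in> weight_simplex"
    and Aab: "\<And>i. w $ i \<noteq> 0 \<Longrightarrow> A i \<in> hermitian_on {a..b}" and a: "0 < a"
    and h: "geometrically_convex_on {a..b} h" and pos: "\<And>x. x \<in> {a..b} \<Longrightarrow> 0 < h x"
  shows "N (mat_fun h (geometric_mean w A)) \<le> weighted_product w (\<lambda>i. N (mat_fun h (A i)))"
proof (rule geometric_mean_eigenbasis [where A = A, OF A w Aab a])
  fix U x \<kappa>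
  assume U: "unitary U" and Gx: "geometric_mean w A = spectral_mat U x" and ab: "a \<le> b"
    and xin: "\<And>j. x $ j \<in> {a..b}" and \<kappa>in: "\<And>i j. w $ i \<noteq> 0 \<Longrightarrow> \<kappa> i j \<in> {ln a..ln b}"
    and lnx: "\<And>j. ln (x $ j) = (\<Sum>i | w $ i \<noteq> 0. w $ i *\<^sub>R \<kappa> i j)"
    and le: "\<And>N k i. ui_seminorm N \<Longrightarrow> convex_on {ln a..ln b} k \<Longrightarrow> (\<And>t. t \<in> {ln a..ln b} \<Longrightarrow> 0 \<le> k t) \<Longrightarrow>
      w $ i \<noteq> 0 \<Longrightarrow> N (diag_mat (\<chi> j. k (\<kappa> i j))) \<le> N (mat_fun (\<lambda>x. k (ln x)) (A i))"
  define I where "I = {i. w $ i \<noteq> 0}"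
  define k where "k t = exp (ln (h (exp t)))" for t
  have w0: "0 \<le> w $ i" for i using weight_nonneg [OF A w] .
  have w1: "(\<Sum>i\<in>I. w $ i) = 1"
    using weight_sum [OF A w] unfolding I_def by (subst sum.mono_neutral_left [of UNIV]) auto
  have ne: "I \<noteq> {}" using w1 by auto
  have kcv: "convex_on {ln a..ln b} (\<lambda>t. ln (h (exp t)))" by (rule convex_on_ln_exp [OF h a ab pos])
  have kc: "convex_on {ln a..ln b} k" unfolding k_def by (rule convex_on_exp_comp [OF kcv])
  have \<kappa>le: "N (diag_mat (\<chi> j. k (\<kappa> i j))) \<le> N (mat_fun h (A i))" if "i \<in> I" for i
  proof -
    have "N (diag_mat (\<chi> j. k (\<kappa> i j))) \<le> N (mat_fun (\<lambda>x. k (ln x)) (A i))"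
      using that by (intro le kc ui.ui_seminorm_axioms) (simp_all add: I_def k_def)
    also have "mat_fun (\<lambda>x. k (ln x)) (A i) = mat_fun h (A i)"
      using that a pos by (intro mat_fun_cong [OF Aab]) (auto simp: k_def I_def)
    finally show ?thesis .
  qed
  have hx: "h (x $ j) \<le> (\<Prod>i\<in>I. (\<chi> j. k (\<kappa> i j)) $ j powr (w $ i))" for j
  proof -
    have "ln (h (exp (ln (x $ j)))) \<le> (\<Sum>i\<in>I. w $ i * ln (h (exp (\<kappa> i j))))"
      unfolding lnx I_def [symmetric] by (rule convex_on_sum [OF _ ne kcv w1 w0]) (use \<kappa>in in \<open>auto simp: I_def\<close>)
    then have "exp (ln (h (x $ j))) \<le> exp (\<Sum>i\<in>I. w $ i * ln (h (exp (\<kappa> i j))))"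
      using xin [of j] a by simp
    also have "\<dots> = (\<Prod>i\<in>I. (\<chi> j. k (\<kappa> i j)) $ j powr (w $ i))"
      unfolding exp_sum [OF finite] by (rule prod.cong) (simp_all add: powr_def k_def)
    finally show ?thesis using pos [OF xin] by simp
  qed
  have "N (mat_fun h (geometric_mean w A)) = N (diag_mat (\<chi> j. h (x $ j)))"
    by (simp add: Gx mat_fun_spectral U ui.diag_spectral)
  also have "\<dots> \<le> N (diag_mat (\<chi> j. \<Prod>i\<in>I. (\<chi> j. k (\<kappa> i j)) $ j powr (w $ i)))"
    using hx pos [OF xin] by (intro ui.diag_mono) (auto simp: less_imp_le)
  also have "\<dots> \<le> (\<Prod>i\<in>I. N (diag_mat (\<chi> j. k (\<kappa> i j))) powr (w $ i))"
    by (rule hoelder_diag) (use w0 w1 in \<open>auto simp: k_def\<close>)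
  also have "\<dots> \<le> (\<Prod>i\<in>I. N (mat_fun h (A i)) powr (w $ i))"
    by (intro prod_mono conjI powr_mono2 \<kappa>le w0 ui.nonneg) auto
  also have "\<dots> = weighted_product w (\<lambda>i. N (mat_fun h (A i)))"
    by (rule prod.mono_neutral_cong_left) (auto simp: I_def)
  finally show ?thesis .
qed

end

section \<open>Derived anti-norms\<close>

lemma invertible_spectral_iff:
  assumes U: "unitary U"
  shows "invertible (spectral_mat U d) \<longleftrightarrow> (\<forall>j. d $ j \<noteq> 0)"
proof
  assume "invertible (spectral_mat U d)"
  then obtain S where S: "S ** spectral_mat U d = mat 1" by (auto simp: invertible_def)
  show "\<forall>j. d $ j \<noteq> 0"
  proof (intro allI notI)
    fix j assume "d $ j = 0"
    then have "spectral_mat U d *v (U *v axis j 1) = 0" using eigenvector_column(1) [OF U, of d j] by simp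
    then have "(S ** spectral_mat U d) *v (U *v axis j 1) = 0"
      by (simp only: matrix_vector_mul_assoc [symmetric] matrix_vector_mult_0_right)
    then have "U *v axis j 1 = 0" by (simp only: S matrix_vector_mul_lid)
    then show False using eigenvector_column(3) [OF U] by blast
  qed
next
  assume d: "\<forall>j. d $ j \<noteq> 0"
  have "spectral_mat U d ** spectral_mat U (\<chi> j. 1 / d $ j) = mat 1"
    using d by (simp add: spectral_mul U spectral_const)
  then show "invertible (spectral_mat U d)"
    unfolding invertible_def using matrix_left_right_inverse by blast
qed

text \<open>In the functional calculus of \<open>X\<close> the anti-norm of \<open>f(X)\<close> is a function of the norm of \<open>f\<^sup>-\<^sup>p(X)\<close>, provided that \<open>f\<close>
  has no zero on the spectrum.\<close>

lemma derived_anti_norm_fun: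
  assumes M: "\<And>B. B \<in> psd_matrices \<Longrightarrow> M B = (if invertible B then N (mat_fun (\<lambda>x. x powr (- p)) B) powr (- 1 / p) else 0)"
    and X: "X \<in> hermitian_on D" and f: "\<And>x. x \<in> D \<Longrightarrow> 0 \<le> f x"
  shows "M (mat_fun f X) = (if X \<in> hermitian_on {x \<in> D. f x \<noteq> 0}
      then N (mat_fun (\<lambda>x. f x powr (- p)) X) powr (- 1 / p) else 0)"
proof -
  obtain U d where U: "unitary U" and Xd: "X = spectral_mat U d" and d: "\<And>j. d $ j \<in> D"
    using hermitian_onE [OF X] by blast
  have psd: "mat_fun f X \<in> psd_matrices" by (rule psd_if, rule mat_fun_in [OF X]) (use f in auto)
  have inv: "invertible (mat_fun f X) \<longleftrightarrow> (\<forall>j. f (d $ j) \<noteq> 0)"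
    by (simp add: Xd mat_fun_spectral U invertible_spectral_iff)
  have "X \<in> hermitian_on {x \<in> D. f x \<noteq> 0} \<longleftrightarrow> (\<forall>j. f (d $ j) \<noteq> 0)"
  proof
    assume "X \<in> hermitian_on {x \<in> D. f x \<noteq> 0}"
    then obtain V e where V: "unitary V" and Xe: "X = spectral_mat V e" and e: "\<And>j. f (e $ j) \<noteq> 0"
      by (auto elim: hermitian_onE)
    have "invertible (mat_fun f X)" using e by (simp add: Xe mat_fun_spectral V invertible_spectral_iff)
    then show "\<forall>j. f (d $ j) \<noteq> 0" by (simp add: inv)
  next
    assume "\<forall>j. f (d $ j) \<noteq> 0"
    then show "X \<in> hermitian_on {x \<in> D. f x \<noteq> 0}" unfolding Xd using d by (intro spectral_in U) auto
  qed
  then show ?thesis using hermitian_onD [OF X] by (simp add: M [OF psd] inv mat_fun_comp)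
qed

lemma symmetric_norm_fun_pos:
  assumes N: "symmetric_norm N" and X: "X \<in> hermitian_on D" and h: "\<And>x. x \<in> D \<Longrightarrow> 0 < h x"
  shows "0 < N (mat_fun h X)"
proof -
  obtain U d where U: "unitary U" and Xd: "X = spectral_mat U d" and d: "\<And>j. d $ j \<in> D"
    using hermitian_onE [OF X] by blast
  have "0 < N (diag_mat (\<chi> j. h (d $ j)))"
    by (rule symmetric_norm_diag_pos [OF N]) (simp add: h d)
  then show ?thesis
    by (simp add: Xd mat_fun_spectral U ui_seminorm.diag_spectral [OF ui_seminorm_symmetric_norm [OF N]])
qed

lemma common_interval:
  fixes A :: "'i \<Rightarrow> complex^'n^'n"
  assumes "finite I" "I \<noteq> {}" "\<And>i. i \<in> I \<Longrightarrow> A i \<in> hermitian_on S"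
  obtains c d where "c \<in> S" "d \<in> S" "\<And>i. i \<in> I \<Longrightarrow> A i \<in> hermitian_on {c..d}"
proof -
  have "\<exists>U d. unitary U \<and> A i = spectral_mat U d \<and> (\<forall>j. d $ j \<in> S)" if "i \<in> I" for i
    using assms(3) [OF that] by (simp add: hermitian_on_iff)
  then obtain U d where U: "\<And>i. i \<in> I \<Longrightarrow> unitary (U i)" and A: "\<And>i. i \<in> I \<Longrightarrow> A i = spectral_mat (U i) (d i)"
    and d: "\<And>i j. i \<in> I \<Longrightarrow> d i $ j \<in> S" by metis
  define E where "E = (\<lambda>(i, j). d i $ j) ` (I \<times> UNIV)"
  have E: "finite E" "E \<noteq> {}" "E \<subseteq> S" using assms(1,2) d by (auto simp: E_def)
  have mem: "d i $ j \<in> E" if "i \<in> I" for i j using that by (auto simp: E_def)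
  show ?thesis
  proof
    show "Min E \<in> S" "Max E \<in> S" using E Min_in Max_in by blast+
    fix i assume i: "i \<in> I"
    show "A i \<in> hermitian_on {Min E..Max E}"
      unfolding A [OF i] using mem [OF i] E(1) by (intro spectral_in U i) simp
  qed
qed

lemma concave_pos_interval:
  fixes f :: "real \<Rightarrow> real"
  assumes f: "concave_on {a..b} f" and c: "c \<in> {a..b}" "d \<in> {a..b}" "0 < f c" "0 < f d" and x: "x \<in> {c..d}"
  shows "0 < f x"
proof (cases "c = d")
  case False
  then have cd: "c < d" using x by simp
  define t where "t = (x - c) / (d - c)"
  have t: "0 \<le> t" "t \<le> 1" using x cd by (auto simp: t_def)
  have xt: "x = (1 - t) *\<^sub>R c + t *\<^sub>R d"
  proof -
    have "(1 - t) * c + t * d = c + t * (d - c)" by (simp add: algebra_simps)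
    then show ?thesis using cd by (simp add: t_def)
  qed
  have "(1 - t) * f c + t * f d \<le> f x"
    unfolding xt using concave_onD [OF f t c(1,2)] .
  moreover have "0 < (1 - t) * f c + t * f d"
    using t c by (cases "t = 0") (auto intro: add_nonneg_pos)
  ultimately show ?thesis by simp
qed (use x c in auto)

lemma convex_on_powr_neg:
  assumes "p > 0"
  shows "convex_on {0<..} (\<lambda>x :: real. x powr (- p))"
proof (rule f''_ge0_imp_convex)
  fix x :: real assume x: "x \<in> {0<..}"
  show "((\<lambda>x. x powr (- p)) has_real_derivative (- p) * x powr (- p - 1)) (at x)"
    using x by (auto intro!: derivative_eq_intros)
  show "((\<lambda>x. (- p) * x powr (- p - 1)) has_real_derivative (- p) * ((- p - 1) * x powr (- p - 1 - 1))) (at x)"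
    using x by (auto intro!: derivative_eq_intros)
  show "0 \<le> (- p) * ((- p - 1) * x powr (- p - 1 - 1))"
    using assms by (simp add: mult_nonpos_nonpos mult_le_0_iff)
qed simp

text \<open>A decreasing convex function of a concave one.\<close>

lemma convex_on_concave_powr_neg:
  assumes f: "concave_on {c..d} f" and pos: "\<And>x. x \<in> {c..d} \<Longrightarrow> 0 < f x" and p: "p > 0"
  shows "convex_on {c..d} (\<lambda>x :: real. f x powr (- p))"
proof (rule convex_onI)
  fix t x y :: real assume t: "0 < t" "t < 1" and x: "x \<in> {c..d}" and y: "y \<in> {c..d}"
  have le: "(1 - t) * f x + t * f y \<le> f ((1 - t) *\<^sub>R x + t *\<^sub>R y)"
    using concave_onD [OF f _ _ x y, of t] t by simp
  moreover have "0 < (1 - t) * f x + t * f y" using t pos [OF x] pos [OF y] by (simp add: add_pos_pos)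
  ultimately have "f ((1 - t) *\<^sub>R x + t *\<^sub>R y) powr (- p) \<le> ((1 - t) *\<^sub>R f x + t *\<^sub>R f y) powr (- p)"
    using p by (intro powr_mono2') auto
  also have "\<dots> \<le> (1 - t) * f x powr (- p) + t * f y powr (- p)"
    using convex_onD [OF convex_on_powr_neg [OF p], of t "f x" "f y"] t pos [OF x] pos [OF y] by simp
  finally show "f ((1 - t) *\<^sub>R x + t *\<^sub>R y) powr (- p) \<le> (1 - t) * f x powr (- p) + t * f y powr (- p)" .
qed simp

section \<open>Integration over the weight simplex\<close>

lemma compact_weight_simplex: "compact (weight_simplex :: (real^'m) set)"
  unfolding compact_eq_bounded_closed
proof
  have "norm w \<le> 1" if "w \<in> weight_simplex" for w :: "real^'m"
    using norm_le_l1_cart [of w] that by (simp add: weight_simplex_def)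
  then show "bounded (weight_simplex :: (real^'m) set)" unfolding bounded_iff by blast
  have "weight_simplex = (\<Inter>i. {w :: real^'m. 0 \<le> w $ i}) \<inter> {w. (\<Sum>i\<in>UNIV. w $ i) = 1}"
    by (auto simp: weight_simplex_def)
  also have "closed \<dots>"
    by (intro closed_Int closed_INT ballI closed_Collect_le closed_Collect_eq continuous_intros)
  finally show "closed (weight_simplex :: (real^'m) set)" .
qed

context
  fixes \<nu> :: "(real^'m::finite) measure"
  assumes \<nu>: "simplex_probability \<nu>"
begin

interpretation prob_space \<nu>
  using \<nu> by (simp add: simplex_probability_def)

lemma space_simplex: "space \<nu> = weight_simplex"
  using \<nu> sets_eq_imp_space_eq [of \<nu> "restrict_space borel weight_simplex"]
  by (simp add: simplex_probability_def space_restrict_space)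

lemma measurable_continuous_simplex:
  assumes "continuous_on weight_simplex f"
  shows "f \<in> borel_measurable \<nu>"
  using borel_measurable_continuous_on_restrict [OF assms] \<nu>
  by (simp add: simplex_probability_def cong: measurable_cong_sets)

lemma integrable_continuous_simplex:
  fixes f :: "real^'m \<Rightarrow> 'b::euclidean_space"
  assumes "continuous_on weight_simplex f"
  shows "integrable \<nu> f"
proof -
  have "bounded (f ` weight_simplex)"
    by (intro compact_imp_bounded compact_continuous_image assms compact_weight_simplex)
  then obtain B where "\<And>w. w \<in> weight_simplex \<Longrightarrow> norm (f w) \<le> B" by (auto simp: bounded_iff)
  then show ?thesis
    by (intro integrable_const_bound [of _ B] measurable_continuous_simplex assms AE_I2) (simp add: space_simplex)
qed

text \<open>The integrand need not be continuous in the weights, as \<open>0\<^sup>0 = 1\<close>; it is bounded because the weights are at most \<open>1\<close>.\<close>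

lemma integrable_weighted_product:
  assumes c: "\<And>i. 0 \<le> c i"
  shows "integrable \<nu> (\<lambda>w. weighted_product w c)"
proof (rule integrable_const_bound [of _ "\<Prod>i\<in>UNIV. max 1 (c i)"])
  have coord: "(\<lambda>w. w $ i) \<in> borel_measurable \<nu>" for i
    by (intro measurable_continuous_simplex continuous_intros)
  show "(\<lambda>w. weighted_product w c) \<in> borel_measurable \<nu>"
    using coord by measurable
  have "weighted_product w c \<le> (\<Prod>i\<in>UNIV. max 1 (c i))" if w: "w \<in> weight_simplex" for w
  proof (rule prod_mono)
    fix i
    have w0: "0 \<le> w $ i" using w by (simp add: weight_simplex_def)
    have w1: "w $ i \<le> 1"
      using w member_le_sum [of i UNIV "\<lambda>i. w $ i"] by (simp add: weight_simplex_def)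
    have "c i powr (w $ i) \<le> max 1 (c i) powr (w $ i)" using c w0 by (intro powr_mono2) auto
    also have "\<dots> \<le> max 1 (c i) powr 1" using w1 by (intro powr_mono) auto
    finally show "0 \<le> (if w $ i = 0 then 1 else c i powr (w $ i)) \<and> (if w $ i = 0 then 1 else c i powr (w $ i)) \<le> max 1 (c i)"
      by simp
  qed
  moreover have "0 \<le> weighted_product w c" for w by (intro prod_nonneg) auto
  ultimately show "AE w in \<nu>. norm (weighted_product w c) \<le> (\<Prod>i\<in>UNIV. max 1 (c i))"
    by (intro AE_I2) (simp add: space_simplex)
qed

section \<open>The geodesic mean\<close>

context
  fixes A :: "'m \<Rightarrow> complex^'n^'n" and a b :: real
  assumes a: "0 < a" and Aab: "\<And>i. A i \<in> hermitian_on {a..b}"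
begin

lemma pd_if_in_interval: "X \<in> hermitian_on {a..b} \<Longrightarrow> X \<in> pd_matrices"
  unfolding pd_iff using a by (elim hermitian_on_mono [rotated]) auto

lemma A_pd: "A i \<in> pd_matrices"
  by (rule pd_if_in_interval [OF Aab])

lemma integrable_geometric_mean: "integrable \<nu> (\<lambda>w. geometric_mean w A)"
  by (intro integrable_continuous_simplex continuous_on_geometric_mean A_pd)

lemma hermitian_geodesic_mean: "hermitian (geodesic_mean \<nu> A)"
proof -
  have "adjoint_mat (geodesic_mean \<nu> A) = (LINT w|\<nu>. adjoint_mat (geometric_mean w A))"
    unfolding geodesic_mean_def
    by (rule integral_bounded_linear [OF bounded_linear_adjoint integrable_geometric_mean, symmetric])
  also have "\<dots> = geodesic_mean \<nu> A"
    unfolding geodesic_mean_def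
  proof (rule Bochner_Integration.integral_cong [OF refl])
    fix w assume "w \<in> space \<nu>"
    then show "adjoint_mat (geometric_mean w A) = geometric_mean w A"
      using pd_hermitian [OF geometric_mean_pd [of A w]] A_pd by (simp add: space_simplex hermitian_def)
  qed
  finally show ?thesis by (simp add: hermitian_def)
qed

text \<open>The mean is diagonalised together with the diagonals of the matrices that it averages.\<close>

lemma geodesic_mean_diagonal:
  obtains U x \<xi> where "unitary U" "geodesic_mean \<nu> A = spectral_mat U x"
    "\<And>w j. \<xi> w j = diag_entry U (geometric_mean w A) j"
    "\<And>w j. w \<in> weight_simplex \<Longrightarrow> \<xi> w j \<in> {a..b}"
    "\<And>j. continuous_on weight_simplex (\<lambda>w. \<xi> w j)"
    "\<And>j. (LINT w|\<nu>. \<xi> w j) = x $ j"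
proof -
  obtain U x where U: "unitary U" and X: "geodesic_mean \<nu> A = spectral_mat U x"
    using hermitian_diagonalizable [OF hermitian_geodesic_mean] by blast
  define \<xi> where "\<xi> w j = diag_entry U (geometric_mean w A) j" for w j
  have lin: "bounded_linear (\<lambda>X :: complex^'n^'n. diag_entry U X j)" for j
    unfolding linear_conv_bounded_linear [symmetric]
    by (rule linearI) (simp_all add: matmul.add_left matmul.add_right matmul.scaleR_left matmul.scaleR_right)
  have "(LINT w|\<nu>. \<xi> w j) = x $ j" for j
  proof -
    have "(LINT w|\<nu>. \<xi> w j) = diag_entry U (geodesic_mean \<nu> A) j"
      unfolding \<xi>_def geodesic_mean_def by (rule integral_bounded_linear [OF lin integrable_geometric_mean])
    then show ?thesis by (simp add: X conj_spectral_self [OF U] diag_mat_nth)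
  qed
  moreover have "continuous_on weight_simplex (\<lambda>w. \<xi> w j)" for j
    unfolding \<xi>_def by (rule bounded_linear.continuous_on [OF lin continuous_on_geometric_mean]) (rule A_pd)
  moreover have "\<xi> w j \<in> {a..b}" if "w \<in> weight_simplex" for w j
    unfolding \<xi>_def
  proof (rule ui_seminorm.diagonal_le_of_unitary_hull(1) [OF ui_seminorm_norm _ _ _ self_in_unitary_hull U])
    show "geometric_mean w A \<in> hermitian_on {a..b}"
      using that A_pd Aab a by (intro geometric_mean_in_interval)
    show "convex_on {a..b} (\<lambda>x. 0 :: real)" by (simp add: convex_on_def)
  qed simp
  ultimately show ?thesis using that [OF U X \<xi>_def] by blast
qed

lemma norm_fun_diagonal_le:
  assumes N: "symmetric_norm N" and k: "convex_on I k" "\<And>x. x \<in> I \<Longrightarrow> 0 \<le> k x"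
    and G: "G \<in> hermitian_on I" and U: "unitary U"
  shows "N (diag_mat (\<chi> j. k (diag_entry U G j))) \<le> N (mat_fun k G)"
  by (rule ui_seminorm.diagonal_le_of_unitary_hull(2)
      [OF ui_seminorm_symmetric_norm [OF N] G k self_in_unitary_hull U])

text \<open>In the eigenbasis of the mean, with eigenvalues \<open>x\<^sub>j = \<integral> \<xi>\<^sub>j\<close>, a norming functional \<open>y\<close> linearises the norm:
  \<open>\<Sum>\<^sub>j y\<^sub>j g(x\<^sub>j) \<le> \<integral> \<Sum>\<^sub>j y\<^sub>j g(\<xi>\<^sub>j)\<close> by Jensen's inequality, and the integrand is at most the norm of \<open>g(G\<^sub>w)\<close>.\<close>

theorem norm_fun_geodesic_mean_le:
  assumes N: "symmetric_norm N" and g: "geometrically_convex_on {a..b} g" "convex_on {a..b} g"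
    and g0: "\<And>x. x \<in> {a..b} \<Longrightarrow> 0 \<le> g x"
  shows "N (mat_fun g (geodesic_mean \<nu> A)) \<le> scalar_geodesic_mean \<nu> (\<lambda>i. N (mat_fun g (A i)))"
proof -
  interpret ui: ui_seminorm N by (rule ui_seminorm_symmetric_norm [OF N])
  let ?c = "\<lambda>w. weighted_product w (\<lambda>i. N (mat_fun g (A i)))"
  obtain U x \<xi> where U: "unitary U" and X: "geodesic_mean \<nu> A = spectral_mat U x"
    and \<xi>: "\<And>w j. \<xi> w j = diag_entry U (geometric_mean w A) j"
    and \<xi>_in: "\<And>w j. w \<in> weight_simplex \<Longrightarrow> \<xi> w j \<in> {a..b}"
    and cont: "\<And>j. continuous_on weight_simplex (\<lambda>w. \<xi> w j)"
    and int: "\<And>j. (LINT w|\<nu>. \<xi> w j) = x $ j"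
    by (rule geodesic_mean_diagonal) (rule that)
  have g_cont: "continuous_on {a..b} g" using g(1) by (simp add: geometrically_convex_on_def)
  have int_\<xi>: "integrable \<nu> (\<lambda>w. \<xi> w j)" for j by (rule integrable_continuous_simplex [OF cont])
  have int_g: "integrable \<nu> (\<lambda>w. g (\<xi> w j))" for j
    by (rule integrable_continuous_simplex [OF continuous_on_compose2 [OF g_cont cont]]) (use \<xi>_in in blast)
  have x_in: "x $ j \<in> {a..b}" and jensen: "g (x $ j) \<le> (LINT w|\<nu>. g (\<xi> w j))" for j
    using jensen_interval [OF int_\<xi> _ g(2) int_g, of j] \<xi>_in by (simp_all add: int space_simplex)
  show ?thesis
  proof (cases "\<exists>z\<in>{a..b}. g z = 0")
    case True
    then have zero: "g y = 0" if "y \<in> {a..b}" for y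
      using geometrically_convex_zero [OF g(1) a g0] that by blast
    have "mat_fun g (geodesic_mean \<nu> A) = spectral_mat U (\<chi> j. 0)"
      by (simp add: X mat_fun_spectral U zero [OF x_in])
    then have "N (mat_fun g (geodesic_mean \<nu> A)) = 0" by (simp add: spectral_const U)
    moreover have "0 \<le> scalar_geodesic_mean \<nu> (\<lambda>i. N (mat_fun g (A i)))"
      unfolding scalar_geodesic_mean_def by (intro Bochner_Integration.integral_nonneg prod_nonneg) auto
    ultimately show ?thesis by simp
  next
    case False
    then have pos: "0 < g y" if "y \<in> {a..b}" for y using g0 [OF that] that by (metis less_le)
    obtain y where y: "\<And>j. 0 \<le> y $ j" "(\<Sum>j\<in>UNIV. y $ j * (\<chi> j. g (x $ j)) $ j) = N (diag_mat (\<chi> j. g (x $ j)))"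
      and y_le: "\<And>b. (\<And>j. 0 \<le> b $ j) \<Longrightarrow> (\<Sum>j\<in>UNIV. y $ j * b $ j) \<le> N (diag_mat b)"
      by (rule norming_functional [OF N, of "\<chi> j. g (x $ j)"]) (use g0 [OF x_in] that in auto)
    have pointwise: "(\<Sum>j\<in>UNIV. y $ j * g (\<xi> w j)) \<le> ?c w" if w: "w \<in> weight_simplex" for w
    proof -
      have G: "geometric_mean w A \<in> hermitian_on {a..b}"
        using w A_pd Aab a by (intro geometric_mean_in_interval)
      have "(\<Sum>j\<in>UNIV. y $ j * g (\<xi> w j)) \<le> N (diag_mat (\<chi> j. g (\<xi> w j)))"
        using y_le [of "\<chi> j. g (\<xi> w j)"] g0 [OF \<xi>_in [OF w]] by simp
      also have "\<dots> \<le> N (mat_fun g (geometric_mean w A))"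
        unfolding \<xi> by (rule norm_fun_diagonal_le [OF N g(2) g0 G U])
      also have "\<dots> \<le> ?c w"
        using A_pd Aab by (intro norm_fun_geometric_mean_le [OF N _ w _ a g(1) pos])
      finally show ?thesis .
    qed
    have "N (mat_fun g (geodesic_mean \<nu> A)) = N (diag_mat (\<chi> j. g (x $ j)))"
      by (simp add: X mat_fun_spectral U ui.diag_spectral)
    also have "\<dots> = (\<Sum>j\<in>UNIV. y $ j * g (x $ j))" using y(2) by simp
    also have "\<dots> \<le> (\<Sum>j\<in>UNIV. y $ j * (LINT w|\<nu>. g (\<xi> w j)))"
      by (intro sum_mono mult_left_mono jensen y)
    also have "\<dots> = (LINT w|\<nu>. (\<Sum>j\<in>UNIV. y $ j * g (\<xi> w j)))"
      using int_g by simp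
    also have "\<dots> \<le> (LINT w|\<nu>. ?c w)"
      using int_g pointwise
      by (intro integral_mono integrable_weighted_product ui.nonneg Bochner_Integration.integrable_sum integrable_mult_right)
        (auto simp: space_simplex)
    finally show ?thesis by (simp add: scalar_geodesic_mean_def)
  qed
qed

lemma diagonal_in_interval:
  assumes "G \<in> hermitian_on {c..d}" "unitary U"
  shows "diag_entry U G j \<in> {c..d}"
proof (rule ui_seminorm.diagonal_le_of_unitary_hull(1) [OF ui_seminorm_norm assms(1) _ _ self_in_unitary_hull assms(2)])
  show "convex_on {c..d} (\<lambda>x. 0 :: real)" by (simp add: convex_on_def)
qed simp

text \<open>If the weighted product does not vanish, all spectra that enter with positive weight lie in an interval on which
  \<open>f\<close> is positive, and there \<open>f\<^sup>-\<^sup>p\<close> is geometrically convex.\<close>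

lemma anti_norm_fun_geometric_mean_ge:
  assumes N: "symmetric_norm N" and p: "0 < p"
    and M: "\<And>B. B \<in> psd_matrices \<Longrightarrow> M B = (if invertible B then N (mat_fun (\<lambda>x. x powr (- p)) B) powr (- 1 / p) else 0)"
    and f: "concave_on {a..b} f" "continuous_on {a..b} f" and f0: "\<And>x. x \<in> {a..b} \<Longrightarrow> 0 \<le> f x"
    and geo: "\<And>x y. x \<in> {a..b} \<Longrightarrow> y \<in> {a..b} \<Longrightarrow> sqrt (f x * f y) \<le> f (sqrt (x * y))"
    and w: "w \<in> weight_simplex"
    and nz: "weighted_product w (\<lambda>i. M (mat_fun f (A i))) \<noteq> 0"
  obtains c d where "{c..d} \<subseteq> {a..b}" "geometric_mean w A \<in> hermitian_on {c..d}" "\<And>x. x \<in> {c..d} \<Longrightarrow> 0 < f x"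
    "0 < N (mat_fun (\<lambda>x. f x powr (- p)) (geometric_mean w A))"
    "weighted_product w (\<lambda>i. M (mat_fun f (A i)))
      \<le> N (mat_fun (\<lambda>x. f x powr (- p)) (geometric_mean w A)) powr (- 1 / p)"
proof -
  define h where "h x = f x powr (- p)" for x
  let ?S = "{x \<in> {a..b}. f x \<noteq> 0}"
  let ?G = "geometric_mean w A"
  have MA: "M (mat_fun f (A i)) = (if A i \<in> hermitian_on ?S then N (mat_fun h (A i)) powr (- 1 / p) else 0)" for i
    unfolding h_def by (rule derived_anti_norm_fun [where N = N, OF M Aab f0])
  have AS: "A i \<in> hermitian_on ?S" if "w $ i \<noteq> 0" for i
  proof (rule ccontr)
    assume "A i \<notin> hermitian_on ?S"
    then have "(if w $ i = 0 then 1 else M (mat_fun f (A i)) powr (w $ i)) = 0" using that by (simp add: MA)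
    then have "weighted_product w (\<lambda>i. M (mat_fun f (A i))) = 0"
      by (intro prod_zero [OF finite] bexI [of _ i]) simp_all
    then show False using nz by contradiction
  qed
  have "{i. w $ i \<noteq> 0} \<noteq> {}"
  proof
    assume "{i. w $ i \<noteq> 0} = {}"
    then have "\<And>i. w $ i = 0" by blast
    then show False using w by (simp add: weight_simplex_def)
  qed
  then obtain c d where c: "c \<in> ?S" and d: "d \<in> ?S" and Acd: "\<And>i. w $ i \<noteq> 0 \<Longrightarrow> A i \<in> hermitian_on {c..d}"
    using common_interval [of "{i. w $ i \<noteq> 0}" A ?S] AS by auto
  have sub: "{c..d} \<subseteq> {a..b}" using c d by auto
  have pos: "0 < f x" if "x \<in> {c..d}" for x
    using concave_pos_interval [OF f(1) _ _ _ _ that] c d f0 by (simp add: less_le)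
  have hpos: "0 < h x" if "x \<in> {c..d}" for x using pos [OF that] by (simp add: h_def)
  have hgeo: "geometrically_convex_on {c..d} h"
    unfolding geometrically_convex_on_def
  proof (intro conjI ballI)
    show "continuous_on {c..d} h"
      unfolding h_def using pos
      by (intro continuous_on_powr continuous_on_subset [OF f(2) sub] continuous_on_const) fastforce
    fix x y assume x: "x \<in> {c..d}" and y: "y \<in> {c..d}"
    have "h (sqrt (x * y)) \<le> sqrt (f x * f y) powr (- p)"
      unfolding h_def using p pos [OF x] pos [OF y] x y sub by (intro powr_mono2' geo) auto
    also have "\<dots> = sqrt (h x * h y)"
      using pos [OF x] pos [OF y] by (simp add: h_def powr_half_sqrt [symmetric] powr_powr powr_mult mult.commute)
    finally show "h (sqrt (x * y)) \<le> sqrt (h x * h y)" .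
  qed
  have c0: "0 < c" using c a by auto
  have G: "?G \<in> hermitian_on {c..d}"
    using A_pd w Acd c0 by (intro geometric_mean_in_interval)
  have NG: "0 < N (mat_fun h ?G)" by (rule symmetric_norm_fun_pos [OF N G hpos])
  have "weighted_product w (\<lambda>i. M (mat_fun f (A i)))
      = weighted_product w (\<lambda>i. N (mat_fun h (A i))) powr (- 1 / p)"
  proof -
    have "weighted_product w (\<lambda>i. N (mat_fun h (A i))) powr (- 1 / p)
        = (\<Prod>i\<in>UNIV. (if w $ i = 0 then 1 else N (mat_fun h (A i)) powr (w $ i)) powr (- 1 / p))"
      by (rule prod_powr_distrib)
    also have "\<dots> = weighted_product w (\<lambda>i. M (mat_fun f (A i)))"
      by (rule prod.cong) (use AS in \<open>auto simp: MA powr_powr mult.commute\<close>)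
    finally show ?thesis by simp
  qed
  also have "\<dots> \<le> N (mat_fun h ?G) powr (- 1 / p)"
    using p NG norm_fun_geometric_mean_le [OF N A_pd w Acd c0 hgeo hpos] by (intro powr_mono2') auto
  finally have le: "weighted_product w (\<lambda>i. M (mat_fun f (A i)))
      \<le> N (mat_fun h ?G) powr (- 1 / p)" .
  have h_eq: "h = (\<lambda>x. f x powr (- p))" by (simp add: h_def fun_eq_iff)
  show ?thesis by (rule that [OF sub G pos NG [unfolded h_eq] le [unfolded h_eq]])
qed

text \<open>As for norms, the problem is linearised in the eigenbasis of the mean, now by the tangent of the concave function
  \<open>r \<mapsto> (\<Sum>\<^sub>j \<pi>\<^sub>j r\<^sub>j\<^sup>-\<^sup>p)\<^sup>-\<^sup>1\<^sup>/\<^sup>p \<le> \<Sum>\<^sub>j \<pi>\<^sub>j r\<^sub>j\<close> at the ratios \<open>r\<^sub>j = f(\<xi>\<^sub>j) / f(x\<^sub>j)\<close>.\<close>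

theorem anti_norm_fun_geodesic_mean_ge:
  assumes M: "derived_anti_norm M"
    and f: "concave_on {a..b} f" "continuous_on {a..b} f" and f0: "\<And>x. x \<in> {a..b} \<Longrightarrow> 0 \<le> f x"
    and geo: "\<And>x y. x \<in> {a..b} \<Longrightarrow> y \<in> {a..b} \<Longrightarrow> sqrt (f x * f y) \<le> f (sqrt (x * y))"
  shows "scalar_geodesic_mean \<nu> (\<lambda>i. M (mat_fun f (A i))) \<le> M (mat_fun f (geodesic_mean \<nu> A))"
proof -
  obtain N p where N: "symmetric_norm N" and p: "0 < p"
    and Mdef: "\<And>B. B \<in> psd_matrices \<Longrightarrow> M B = (if invertible B then N (mat_fun (\<lambda>x. x powr (- p)) B) powr (- 1 / p) else 0)"
    using M by (auto simp: derived_anti_norm_def)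
  interpret ui: ui_seminorm N by (rule ui_seminorm_symmetric_norm [OF N])
  define h where "h x = f x powr (- p)" for x
  let ?c = "\<lambda>w. weighted_product w (\<lambda>i. M (mat_fun f (A i)))"
  note Mf = derived_anti_norm_fun [where N = N and M = M and f = f, OF Mdef _ f0, folded h_def]
  have M0: "0 \<le> M (mat_fun f (A i))" for i using Mf [OF _ Aab, of i] by simp
  have int_c: "integrable \<nu> ?c" by (rule integrable_weighted_product [OF M0])
  have c0: "0 \<le> ?c w" for w by (intro prod_nonneg) auto
  obtain U x \<xi> where U: "unitary U" and X: "geodesic_mean \<nu> A = spectral_mat U x"
    and \<xi>: "\<And>w j. \<xi> w j = diag_entry U (geometric_mean w A) j"
    and \<xi>_in: "\<And>w j. w \<in> weight_simplex \<Longrightarrow> \<xi> w j \<in> {a..b}"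
    and cont: "\<And>j. continuous_on weight_simplex (\<lambda>w. \<xi> w j)"
    and int: "\<And>j. (LINT w|\<nu>. \<xi> w j) = x $ j"
    by (rule geodesic_mean_diagonal) (rule that)
  have int_\<xi>: "integrable \<nu> (\<lambda>w. \<xi> w j)" for j by (rule integrable_continuous_simplex [OF cont])
  have int_f: "integrable \<nu> (\<lambda>w. f (\<xi> w j))" for j
    by (rule integrable_continuous_simplex [OF continuous_on_compose2 [OF f(2) cont]]) (use \<xi>_in in blast)
  have neg: "convex_on {a..b} (\<lambda>x. - f x)" using f(1) by (simp add: concave_on_def)
  have x_in: "x $ j \<in> {a..b}" and jensen: "(LINT w|\<nu>. f (\<xi> w j)) \<le> f (x $ j)" for j
    using jensen_interval [OF int_\<xi> _ neg, of j] int_f [of j] \<xi>_in by (simp_all add: int space_simplex)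
  have X_in: "geodesic_mean \<nu> A \<in> hermitian_on {a..b}" unfolding X by (rule spectral_in [OF U x_in])
  \<comment> \<open>If \<open>f\<close> vanishes at some \<open>x\<^sub>j\<close>, the left-hand side is the integral of a function that is \<open>0\<close> almost everywhere.\<close>
  show ?thesis
  proof (cases "\<exists>j. f (x $ j) = 0")
    case True
    then obtain j where j: "f (x $ j) = 0" by blast
    have "(LINT w|\<nu>. f (\<xi> w j)) = 0"
    proof (rule antisym)
      show "(LINT w|\<nu>. f (\<xi> w j)) \<le> 0" using jensen [of j] j by simp
      show "0 \<le> (LINT w|\<nu>. f (\<xi> w j))"
        using f0 [OF \<xi>_in] by (intro integral_nonneg_AE AE_I2) (simp add: space_simplex)
    qed
    then have "AE w in \<nu>. f (\<xi> w j) = 0"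
      using f0 [OF \<xi>_in] by (subst (asm) integral_nonneg_eq_0_iff_AE [OF int_f]) (auto simp: space_simplex intro!: AE_I2)
    then have "AE w in \<nu>. ?c w = 0"
    proof (rule AE_mp, intro AE_I2 impI)
      fix w assume "w \<in> space \<nu>" and z: "f (\<xi> w j) = 0"
      then have w: "w \<in> weight_simplex" by (simp add: space_simplex)
      show "?c w = 0"
      proof (rule ccontr)
        assume "?c w \<noteq> 0"
        then obtain c d where "geometric_mean w A \<in> hermitian_on {c..d}" "\<And>x. x \<in> {c..d} \<Longrightarrow> 0 < f x"
          using anti_norm_fun_geometric_mean_ge [OF N p Mdef f f0 geo w] by metis
        then have "0 < f (\<xi> w j)" unfolding \<xi> using diagonal_in_interval [OF _ U] by blast
        then show False using z by simp
      qed
    qed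
    then have "(LINT w|\<nu>. ?c w) = 0" by (rule integral_eq_zero_AE)
    moreover have "0 \<le> M (mat_fun f (geodesic_mean \<nu> A))" using Mf [OF _ X_in] by simp
    ultimately show ?thesis by (simp add: scalar_geodesic_mean_def)
  next
    case False
    then have fx: "0 < f (x $ j)" for j using f0 [OF x_in, of j] by (metis less_le)
    have hx: "0 < h (x $ j)" for j using fx [of j] by (simp add: h_def)
    obtain y where y: "\<And>j. 0 \<le> y $ j" "(\<Sum>j\<in>UNIV. y $ j * (\<chi> j. h (x $ j)) $ j) = N (diag_mat (\<chi> j. h (x $ j)))"
      and y_le: "\<And>b. (\<And>j. 0 \<le> b $ j) \<Longrightarrow> (\<Sum>j\<in>UNIV. y $ j * b $ j) \<le> N (diag_mat b)"
      by (rule norming_functional [OF N, of "\<chi> j. h (x $ j)"]) (use less_imp_le [OF hx] that in auto)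
    define S where "S = N (diag_mat (\<chi> j. h (x $ j)))"
    define \<pi> where "\<pi> j = y $ j * h (x $ j) / S" for j
    have S: "0 < S" unfolding S_def by (rule symmetric_norm_diag_pos [OF N]) (simp add: hx)
    have \<pi>0: "0 \<le> \<pi> j" for j using y(1) less_imp_le [OF hx] less_imp_le [OF S] by (simp add: \<pi>_def)
    have \<pi>1: "(\<Sum>j\<in>UNIV. \<pi> j) = 1"
      using y(2) S by (simp add: \<pi>_def S_def flip: sum_divide_distrib)
    have MX: "M (mat_fun f (geodesic_mean \<nu> A)) = S powr (- 1 / p)"
    proof -
      have "geodesic_mean \<nu> A \<in> hermitian_on {x \<in> {a..b}. f x \<noteq> 0}"
        unfolding X using x_in False by (intro spectral_in U) blast
      then have "M (mat_fun f (geodesic_mean \<nu> A)) = N (mat_fun h (geodesic_mean \<nu> A)) powr (- 1 / p)"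
        using Mf [OF _ X_in] by simp
      then show ?thesis by (simp add: S_def X mat_fun_spectral U ui.diag_spectral)
    qed
    have pointwise: "?c w \<le> S powr (- 1 / p) * (\<Sum>j\<in>UNIV. \<pi> j * (f (\<xi> w j) / f (x $ j)))"
      if w: "w \<in> weight_simplex" for w
    proof (cases "?c w = 0")
      case True
      have "0 \<le> (\<Sum>j\<in>UNIV. \<pi> j * (f (\<xi> w j) / f (x $ j)))"
        using \<pi>0 f0 [OF \<xi>_in [OF w]] less_imp_le [OF fx] by (intro sum_nonneg) simp
      then have "0 \<le> S powr (- 1 / p) * (\<Sum>j\<in>UNIV. \<pi> j * (f (\<xi> w j) / f (x $ j)))" by simp
      then show ?thesis by (simp only: True)
    next
      case nz: False
      obtain c d where sub: "{c..d} \<subseteq> {a..b}" and G: "geometric_mean w A \<in> hermitian_on {c..d}"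
        and pos: "\<And>x. x \<in> {c..d} \<Longrightarrow> 0 < f x" and NG: "0 < N (mat_fun h (geometric_mean w A))"
        and le: "?c w \<le> N (mat_fun h (geometric_mean w A)) powr (- 1 / p)"
        unfolding h_def
        by (rule anti_norm_fun_geometric_mean_ge [OF N p Mdef f f0 geo w nz]) (assumption | rule that [unfolded h_def])+
      define r where "r j = f (\<xi> w j) / f (x $ j)" for j
      have f\<xi>: "0 < f (\<xi> w j)" for j unfolding \<xi> by (rule pos [OF diagonal_in_interval [OF G U]])
      have r: "0 < r j" for j using f\<xi> fx by (simp add: r_def)
      have \<pi>r: "0 < (\<Sum>j\<in>UNIV. \<pi> j * r j)"
      proof -
        have "\<exists>j. \<pi> j \<noteq> 0" using \<pi>1 by (metis sum.neutral zero_neq_one)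
        then obtain j where "0 < \<pi> j" using \<pi>0 by (metis less_le)
        then show ?thesis using r \<pi>0 by (intro sum_pos2 [of _ j]) (auto simp: less_imp_le)
      qed
      have hc: "convex_on {c..d} h"
        unfolding h_def
        by (rule convex_on_concave_powr_neg [OF _ pos p]) (use f(1) sub in \<open>auto simp: concave_on_def intro: convex_on_subset\<close>)
      have "S * (\<Sum>j\<in>UNIV. \<pi> j * r j) powr (- p) \<le> S * (\<Sum>j\<in>UNIV. \<pi> j * r j powr (- p))"
        using convex_on_sum [OF finite _ convex_on_powr_neg [OF p] \<pi>1 \<pi>0, of r] r S by simp
      also have "\<dots> = (\<Sum>j\<in>UNIV. y $ j * h (\<xi> w j))"
        unfolding sum_distrib_left
      proof (rule sum.cong [OF refl])
        fix j
        have "h (x $ j) * r j powr (- p) = h (\<xi> w j)"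
          using fx [of j] f\<xi> [of j] by (simp add: h_def r_def powr_divide)
        then show "S * (\<pi> j * r j powr (- p)) = y $ j * h (\<xi> w j)"
          using S by (simp add: \<pi>_def)
      qed
      also have "\<dots> \<le> N (diag_mat (\<chi> j. h (\<xi> w j)))"
        using y_le [of "\<chi> j. h (\<xi> w j)"] by (simp add: h_def)
      also have "\<dots> \<le> N (mat_fun h (geometric_mean w A))"
        unfolding \<xi> by (rule norm_fun_diagonal_le [OF N hc _ G U]) (simp add: h_def)
      finally have "S * (\<Sum>j\<in>UNIV. \<pi> j * r j) powr (- p) \<le> N (mat_fun h (geometric_mean w A))" .
      then have "N (mat_fun h (geometric_mean w A)) powr (- 1 / p)
          \<le> (S * (\<Sum>j\<in>UNIV. \<pi> j * r j) powr (- p)) powr (- 1 / p)"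
        using S \<pi>r p by (intro powr_mono2') auto
      also have "\<dots> = S powr (- 1 / p) * (\<Sum>j\<in>UNIV. \<pi> j * r j)"
        using S \<pi>r p by (simp add: powr_mult powr_powr)
      finally show ?thesis using le by (simp add: r_def)
    qed
    have int_r: "integrable \<nu> (\<lambda>w. \<Sum>j\<in>UNIV. \<pi> j * (f (\<xi> w j) / f (x $ j)))"
      using int_f by (intro Bochner_Integration.integrable_sum integrable_mult_right integrable_divide)
    have "(LINT w|\<nu>. ?c w) \<le> (LINT w|\<nu>. S powr (- 1 / p) * (\<Sum>j\<in>UNIV. \<pi> j * (f (\<xi> w j) / f (x $ j))))"
      using pointwise by (intro integral_mono int_c integrable_mult_right int_r) (auto simp: space_simplex)
    also have "\<dots> = S powr (- 1 / p) * (\<Sum>j\<in>UNIV. \<pi> j * ((LINT w|\<nu>. f (\<xi> w j)) / f (x $ j)))"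
      using int_f by simp
    also have "\<dots> \<le> S powr (- 1 / p) * (\<Sum>j\<in>UNIV. \<pi> j * 1)"
      using fx jensen by (intro mult_left_mono sum_mono \<pi>0) (simp_all add: divide_le_eq_1 less_le)
    also have "\<dots> = M (mat_fun f (geodesic_mean \<nu> A))" by (simp add: \<pi>1 MX)
    finally show ?thesis by (simp add: scalar_geodesic_mean_def)
  qed
qed

end

end

theorem theorem5p5:
  fixes \<nu> :: "(real^'m) measure"
    and A :: "'m \<Rightarrow> complex^'n^'n"
    and \<Omega> :: "real set"
  assumes "simplex_probability \<nu>"
    and "is_interval \<Omega>" and "\<Omega> \<subseteq> {0<..}"
    and "\<And>i. A i \<in> hermitian_on \<Omega>"
  shows "(\<forall>f M. doubly_concave_on \<Omega> f \<longrightarrow> derived_anti_norm M \<longrightarrow>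
            M (mat_fun f (geodesic_mean \<nu> A))
              \<ge> scalar_geodesic_mean \<nu> (\<lambda>i. M (mat_fun f (A i)))) \<and>
         (\<forall>g N. doubly_convex_on \<Omega> g \<longrightarrow> symmetric_norm N \<longrightarrow>
            N (mat_fun g (geodesic_mean \<nu> A))
              \<le> scalar_geodesic_mean \<nu> (\<lambda>i. N (mat_fun g (A i))))"
proof -
  obtain c d where cd: "c \<in> \<Omega>" "d \<in> \<Omega>" and A: "\<And>i. A i \<in> hermitian_on {c..d}"
    using common_interval [of UNIV A \<Omega>] assms(4) by auto
  have mem: "x \<in> \<Omega>" if "c \<le> x" "x \<le> d" for x
    using mem_is_interval_1_I [OF assms(2) cd that] .
  then have sub: "{c..d} \<subseteq> \<Omega>" by auto
  have c: "0 < c" using cd assms(3) by auto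
  show ?thesis
  proof (intro conjI allI impI)
    fix f and M :: "complex^'n^'n \<Rightarrow> real"
    assume f: "doubly_concave_on \<Omega> f" and M: "derived_anti_norm M"
    show "scalar_geodesic_mean \<nu> (\<lambda>i. M (mat_fun f (A i))) \<le> M (mat_fun f (geodesic_mean \<nu> A))"
    proof (rule anti_norm_fun_geodesic_mean_ge [OF assms(1) c A M])
      show "concave_on {c..d} f"
        using f convex_on_subset [OF _ sub] by (simp add: doubly_concave_on_def concave_on_def)
      show "continuous_on {c..d} f"
        using f by (auto simp: doubly_concave_on_def intro: continuous_on_subset [OF _ sub])
    qed (use f mem in \<open>auto simp: doubly_concave_on_def\<close>)
  next
    fix g and N :: "complex^'n^'n \<Rightarrow> real"
    assume g: "doubly_convex_on \<Omega> g" and N: "symmetric_norm N"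
    show "N (mat_fun g (geodesic_mean \<nu> A)) \<le> scalar_geodesic_mean \<nu> (\<lambda>i. N (mat_fun g (A i)))"
    proof (rule norm_fun_geodesic_mean_le [OF assms(1) c A N])
      show "geometrically_convex_on {c..d} g"
        using g mem
        by (auto simp: doubly_convex_on_def geometrically_convex_on_def intro: continuous_on_subset [OF _ sub])
      show "convex_on {c..d} g"
        using g convex_on_subset [OF _ sub] by (simp add: doubly_convex_on_def)
    qed (use g mem in \<open>auto simp: doubly_convex_on_def\<close>)
  qed
qed

end
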